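(* Let $G\subset\mathbb{R}^d$ be a bounded domain with $\partial G\in C^{4,\epsilon}$ for some $\epsilon\in(0,1)$, let $T>0$, $Q=(0,T)\times G$, $S=(0,T)\times\partial G$, and let $\nu(z)$ be the inward unit normal at $z\in\partial G$. Let $b:\bar Q\to\mathbb{R}^d$, $\sigma:\bar Q\to\mathbb{R}^{d\times d}$, $c,g:\bar Q\to\mathbb{R}$ be in $C^{1+\epsilon,2+\epsilon}(\bar Q)$, let $\gamma,\psi:\bar S\to\mathbb{R}$ be in $C^{1+\epsilon,2+\epsilon}(\bar S)$, let $\mu\in C^{2+\epsilon}(\partial G)$ with $\mu(z)>0$ for all $z\in\partial G$, and let $\varphi\in C^{4+\epsilon}(\bar G)$. Put $a=\sigma\sigma^{\top}$ and $\mathcal{A}v=\frac12\sum_{i,j=1}^d a^{ij}\frac{\partial^2 v}{\partial x^i\partial x^j}+\sum_{i=1}^d b^i\frac{\partial v}{\partial x^i}$. Assume that the boundary value problem $$\frac{\partial u}{\partial t}+\mathcal{A}u+c(t,x)u+g(t,x)=0\ \text{ on }[0,T]\times\bar G,\qquad u(T,x)=\varphi(x)\ \text{ on }\bar G,$$ $$-\mu(z)\,\mathcal{A}u(t,z)+(\nu(z)\cdot\nabla u(t,z))+\gamma(t,z)u(t,z)=\psi(t,z)\ \text{ on }[0,T]\times\partial G$$ has a unique solution $u$, and that $u\in C^{4,\epsilon}(\bar Q)$. Let $t_0\in[0,T)$ and $x\in G$, and for $h\in(0,1)$ let $(t_k,X_k,Y_k,Z_k)_{k=0}^{\chi}$ be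 the Markov chain generated by the sticky Euler method (described in the context) with step $h$ started at $(t_0,X_0,Y_0,Z_0)=(t_0,x,1,0)$. Then there is a constant $C>0$ independent of $h$ such that, for all sufficiently small $h$, $$\big|\mathbb{E}\big(\varphi(X_\chi)Y_\chi+Z_\chi\big)-u(t_0,X_0)\big|\le Ch .$$
   Context: Function spaces: $C^{1+\epsilon,2+\epsilon}$ denotes the parabolic Hölder space of order $2+\epsilon$ (functions $v$ for which all derivatives $\partial_t^i\partial_x^j v$ with $2i+|j|<2+\epsilon$ are continuous up to the closure with finite parabolic Hölder norm of order $2+\epsilon$). $C^{2+\epsilon}(\partial G)$, $C^{4+\epsilon}(\bar G)$ are the usual Hölder spaces. $C^{4,\epsilon}(\bar Q)$ denotes functions of $(t,x)$ all of whose partial derivatives up to order 4 are continuous on $\bar Q$, those of order 4 being $\epsilon$-Hölder. Sticky Euler method. Let $\xi_{k+1}=(\xi_{k+1}^1,\dots,\xi_{k+1}^d)$, $k\ge 0$, where all components, for all $k$, are independent and take the values $\pm1$ with probability $1/2$ each. Given $(t_k,X_k,Y_k,Z_k)$ with $t_k<T$, $X_k\in\bar G$, compute the auxiliary step $$X'_{k+1}=X_k+hb(t_k,X_k)+h^{1/2}\sigma(t_k,X_k)\xi_{k+1},\quad t'_{k+1}=t_k+h,$$ $$Y'_{k+1}=Y_k+hc(t_k,X_k)Y_k,\quad Z'_{k+1}=Z_k+hg(t_k,X_k)Y_k .$$ If $X'_{k+1}\notin\bar G$, let $r_{k+1}=\operatorname{dist}(X'_{k+1},\partial G)$ and let $X^\pi_{k+1}\in\partial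 G$ be the projection of $X'_{k+1}$ on $\partial G$, i.e. $X^\pi_{k+1}=X'_{k+1}+r_{k+1}\nu(X^\pi_{k+1})$ (it exists and is unique for small $h$, with $r_{k+1}=O(h^{1/2})$); put $t''_{k+1}=t'_{k+1}+2r_{k+1}\mu(X^\pi_{k+1})$ and $t''_{k+1/2}=t'_{k+1}+r_{k+1}\mu(X^\pi_{k+1})$. Below write $r=r_{k+1}$, $\mu=\mu(X^\pi_{k+1})$. Case I ($t'_{k+1}<T$, $X'_{k+1}\in\bar G$): $(t_{k+1},X_{k+1},Y_{k+1},Z_{k+1})=(t'_{k+1},X'_{k+1},Y'_{k+1},Z'_{k+1})$. Case II ($t'_{k+1}\ge T$, $X'_{k+1}\in\bar G$): set $\chi=k+1$, $t_\chi=T$, $X_\chi=X'_{k+1}$, $Y_\chi=Y'_{k+1}$, $Z_\chi=Z'_{k+1}$ and stop. Case IIIa ($t'_{k+1}<T$, $X'_{k+1}\notin\bar G$, $t''_{k+1}<T$): $t_{k+1}=t''_{k+1}$, $X_{k+1}=X'_{k+1}+2r\,\nu(X^\pi_{k+1})$, and, with $\gamma,c,g,\psi$ evaluated at $(t''_{k+1/2},X^\pi_{k+1})$, $$Y_{k+1}=Y'_{k+1}+\big(2r\gamma+2r\mu c+2r^2\gamma^2+4r^2\mu\gamma c+2r^2\mu^2c^2\big)Y_k,$$ $$Z_{k+1}=Z'_{k+1}+\big(-2r\psi-2r^2\gamma\psi-2r^2\mu c\psi+2r\mu g+2r^2\mu\gamma g+2r^2\mu^2 c g\big)Y_k .$$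 Case IIIb ($t'_{k+1}<T$, $X'_{k+1}\notin\bar G$, $t''_{k+1}\ge T$): set $\chi=k+1$, $t_\chi=T$, $X_\chi=X'_{k+1}+2r\,\nu(X^\pi_{k+1})$ and, with $p=(T-t'_{k+1})/(2\mu)$ and $\gamma,c,g,\psi,\mathcal{A}\varphi$ evaluated at $(T,X^\pi_{k+1})$, $$Y_\chi=Y'_{k+1}+\big(2r\gamma+2p\mu c\big)Y_k,\qquad Z_\chi=Z'_{k+1}+\big(-2\mu(r-p)\mathcal{A}\varphi+2p\mu g-2r\psi\big)Y_k,$$ and stop. Case IV ($t'_{k+1}\ge T$, $X'_{k+1}\notin\bar G$): set $\chi=k+1$, $t_\chi=T$, $X_\chi=X'_{k+1}+2r\,\nu(X^\pi_{k+1})$ and, with $\gamma,\psi,\mathcal{A}\varphi$ evaluated at $(T,X^\pi_{k+1})$, $$Y_\chi=Y'_{k+1}+\big(2r\gamma+2r^2\gamma^2\big)Y_k,\qquad Z_\chi=Z'_{k+1}+\big(-2r\mu\mathcal{A}\varphi-2r^2\gamma\mu\mathcal{A}\varphi-2r\psi-2r^2\gamma\psi\big)Y_k,$$ and stop. Thus $\chi$ is the (random) number of steps. *)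

theory Defs
  imports "HOL-Probability.Probability"
begin

text \<open>Iterated directional derivatives. The head of the list is the direction differentiated last.\<close>

primrec dpartial :: "'a::euclidean_space list \<Rightarrow> ('a \<Rightarrow> real) \<Rightarrow> 'a \<Rightarrow> real" where
  "dpartial [] v = v"
| "dpartial (e # es) v = (\<lambda>x. deriv (\<lambda>s. dpartial es v (x + s *\<^sub>R e)) 0)"

text \<open>Derivative of a function of the closure of an open set: on the open set itself it is the
  derivative, on the rest of the closure its continuous extension.\<close>

definition cl_partial ::
  "'a::euclidean_space set \<Rightarrow> 'a list \<Rightarrow> ('a \<Rightarrow> real) \<Rightarrow> 'a \<Rightarrow> real" where
  "cl_partial \<Omega> es v x =
     (if x \<in> \<Omega> then dpartial es v x else Lim (at x within \<Omega>) (dpartial es v))"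

text \<open>All partial derivatives whose weighted order is at most \<open>m\<close> exist in \<open>\<Omega>\<close> and extend
  continuously to its closure. Weight 1 in all directions gives the space of \<open>m\<close> times
  continuously differentiable functions; weight 2 in time gives the parabolic analogue.
  The extension of the zeroth derivative has to be \<open>v\<close> itself, hence the first conjunct.\<close>

definition smooth_closure ::
  "('a::euclidean_space \<Rightarrow> nat) \<Rightarrow> nat \<Rightarrow> 'a set \<Rightarrow> ('a \<Rightarrow> real) \<Rightarrow> bool" where
  "smooth_closure wt m \<Omega> v \<longleftrightarrow>
     continuous_on (closure \<Omega>) v \<and>
     (\<forall>es. set es \<subseteq> Basis \<and> sum_list (map wt es) \<le> m \<longrightarrow>
        continuous_on (closure \<Omega>) (cl_partial \<Omega> es v) \<and>
        (\<forall>e\<in>Basis. wt e + sum_list (map wt es) \<le> m \<longrightarrow>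
           (\<forall>x\<in>\<Omega>. (\<lambda>s. dpartial es v (x + s *\<^sub>R e)) field_differentiable (at 0))))"

definition holder_on :: "real \<Rightarrow> 'a::metric_space set \<Rightarrow> ('a \<Rightarrow> real) \<Rightarrow> bool" where
  "holder_on \<alpha> S f \<longleftrightarrow> (\<exists>C. \<forall>x\<in>S. \<forall>y\<in>S. \<bar>f x - f y\<bar> \<le> C * dist x y powr \<alpha>)"

text \<open>The Hoelder space of order \<open>k + \<epsilon>\<close> on the closure of the bounded open set \<open>\<Omega>\<close>; the
  supremum norms of the derivatives are finite by compactness.\<close>

definition holder_space ::
  "nat \<Rightarrow> real \<Rightarrow> 'a::euclidean_space set \<Rightarrow> ('a \<Rightarrow> real) \<Rightarrow> bool" where
  "holder_space k \<epsilon> \<Omega> v \<longleftrightarrow>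
     smooth_closure (\<lambda>_. 1) k \<Omega> v \<and>
     (\<forall>es. set es \<subseteq> Basis \<and> length es = k \<longrightarrow>
        holder_on \<epsilon> (closure \<Omega>) (cl_partial \<Omega> es v))"

definition cyl :: "real \<Rightarrow> 'a set \<Rightarrow> (real \<times> 'a) set" where
  "cyl T G = {0<..<T} \<times> G"

definition parabolic_weight :: "real \<times> 'a::euclidean_space \<Rightarrow> nat" where
  "parabolic_weight e = (if fst e = 0 then 1 else 2)"

definition C12 ::
  "real \<Rightarrow> 'a::euclidean_space set \<Rightarrow> (real \<times> 'a \<Rightarrow> real) \<Rightarrow> bool" where
  "C12 T G v \<longleftrightarrow> smooth_closure parabolic_weight 2 (cyl T G) v"

text \<open>The parabolic Hoelder space of order \<open>2 + \<epsilon>\<close>. A derivative of parabolic order \<open>w\<close> has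
  exponent \<open>(2 + \<epsilon> - w) / 2\<close> in time whenever \<open>0 < 2 + \<epsilon> - w < 2\<close>, and the derivatives of
  top order \<open>w = 2\<close> have exponent \<open>\<epsilon>\<close> in space.\<close>

definition parabolic_holder ::
  "real \<Rightarrow> real \<Rightarrow> 'a::euclidean_space set \<Rightarrow> (real \<times> 'a \<Rightarrow> real) \<Rightarrow> bool" where
  "parabolic_holder \<epsilon> T G v \<longleftrightarrow>
     C12 T G v \<and>
     (\<forall>es w. set es \<subseteq> Basis \<and> w = sum_list (map parabolic_weight es) \<longrightarrow>
        (w = 1 \<or> w = 2 \<longrightarrow>
           (\<exists>C. \<forall>s\<in>{0..T}. \<forall>t\<in>{0..T}. \<forall>x\<in>closure G.
              \<bar>cl_partial (cyl T G) es v (s, x) - cl_partial (cyl T G) es v (t, x)\<bar>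
                \<le> C * \<bar>s - t\<bar> powr ((2 + \<epsilon> - real w) / 2))) \<and>
        (w = 2 \<longrightarrow>
           (\<exists>C. \<forall>t\<in>{0..T}. \<forall>x\<in>closure G. \<forall>y\<in>closure G.
              \<bar>cl_partial (cyl T G) es v (t, x) - cl_partial (cyl T G) es v (t, y)\<bar>
                \<le> C * dist x y powr \<epsilon>)))"

text \<open>Near its boundary point \<open>z\<close> the set \<open>G\<close> is the part above the graph of \<open>f\<close> in the
  direction \<open>e\<close>. A function of the coordinates orthogonal to \<open>e\<close> is represented by a function
  on the whole space that is constant along \<open>e\<close>.\<close>

definition graph_chart ::
  "nat \<Rightarrow> real \<Rightarrow> 'a::euclidean_space set \<Rightarrow> 'a \<Rightarrow> 'a \<Rightarrow> ('a \<Rightarrow> real) \<Rightarrow> real \<Rightarrow> bool" where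
  "graph_chart k \<epsilon> G z e f r \<longleftrightarrow>
     z \<in> frontier G \<and> norm e = 1 \<and> r > 0 \<and>
     (\<forall>y s. f (y + s *\<^sub>R e) = f y) \<and>
     holder_space k \<epsilon> (ball z r) f \<and>
     G \<inter> ball z r = {y \<in> ball z r. f y < y \<bullet> e}"

definition holder_boundary :: "nat \<Rightarrow> real \<Rightarrow> 'a::euclidean_space set \<Rightarrow> bool" where
  "holder_boundary k \<epsilon> G \<longleftrightarrow> (\<forall>z\<in>frontier G. \<exists>e f r. graph_chart k \<epsilon> G z e f r)"

definition graph_point :: "'a::euclidean_space \<Rightarrow> ('a \<Rightarrow> real) \<Rightarrow> 'a \<Rightarrow> 'a" where
  "graph_point e f y = y + (f y - y \<bullet> e) *\<^sub>R e"

text \<open>Hoelder spaces on the boundary, and on the lateral boundary of the cylinder, of a domain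
  whose boundary is of order \<open>4 + \<epsilon>\<close>: membership is tested in the graph coordinates.\<close>

definition holder_on_boundary ::
  "real \<Rightarrow> 'a::euclidean_space set \<Rightarrow> ('a \<Rightarrow> real) \<Rightarrow> bool" where
  "holder_on_boundary \<epsilon> G w \<longleftrightarrow>
     (\<forall>z e f r. graph_chart 4 \<epsilon> G z e f r \<longrightarrow>
        (\<exists>\<rho>>0. holder_space 2 \<epsilon> (ball z \<rho>) (\<lambda>y. w (graph_point e f y))))"

definition parabolic_holder_on_boundary ::
  "real \<Rightarrow> real \<Rightarrow> 'a::euclidean_space set \<Rightarrow> (real \<times> 'a \<Rightarrow> real) \<Rightarrow> bool" where
  "parabolic_holder_on_boundary \<epsilon> T G w \<longleftrightarrow>
     (\<forall>z e f r. graph_chart 4 \<epsilon> G z e f r \<longrightarrow>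
        (\<exists>\<rho>>0. parabolic_holder \<epsilon> T (ball z \<rho>) (\<lambda>(t, y). w (t, graph_point e f y))))"

text \<open>Orthogonal to the velocities of all curves in the boundary through \<open>z\<close>, and pointing
  into \<open>G\<close>.\<close>

definition inward_unit_normal :: "'a::euclidean_space set \<Rightarrow> 'a \<Rightarrow> 'a \<Rightarrow> bool" where
  "inward_unit_normal G z n \<longleftrightarrow>
     norm n = 1 \<and>
     (\<forall>p w. p 0 = z \<and> (\<forall>s. p s \<in> frontier G) \<and> (p has_vector_derivative w) (at (0::real)) \<longrightarrow>
        n \<bullet> w = 0) \<and>
     (\<exists>\<delta>>0. \<forall>s\<in>{0<..<\<delta>}. z + s *\<^sub>R n \<in> G)"

abbreviation time_dir :: "real \<times> (real ^ 'n)" where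
  "time_dir \<equiv> (1, 0)"

abbreviation space_dir :: "'n::finite \<Rightarrow> real \<times> (real ^ 'n)" where
  "space_dir i \<equiv> (0, axis i 1)"

definition generator ::
  "real \<Rightarrow> (real ^ 'n) set \<Rightarrow> (real \<times> (real ^ 'n) \<Rightarrow> real ^ 'n) \<Rightarrow> (real \<times> (real ^ 'n) \<Rightarrow> real ^ 'n ^ 'n) \<Rightarrow>
   (real \<times> (real ^ 'n) \<Rightarrow> real) \<Rightarrow> real \<times> (real ^ 'n) \<Rightarrow> real" where
  "generator T G b \<sigma> v p =
     1/2 * (\<Sum>i\<in>UNIV. \<Sum>j\<in>UNIV. (\<sigma> p ** transpose (\<sigma> p)) $ i $ j *
               cl_partial (cyl T G) [space_dir i, space_dir j] v p) +
     (\<Sum>i\<in>UNIV. b p $ i * cl_partial (cyl T G) [space_dir i] v p)"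

definition bvp_solution ::
  "real \<Rightarrow> (real ^ 'n) set \<Rightarrow> (real ^ 'n \<Rightarrow> real ^ 'n) \<Rightarrow>
   (real \<times> (real ^ 'n) \<Rightarrow> real ^ 'n) \<Rightarrow> (real \<times> (real ^ 'n) \<Rightarrow> real ^ 'n ^ 'n) \<Rightarrow>
   (real \<times> (real ^ 'n) \<Rightarrow> real) \<Rightarrow> (real \<times> (real ^ 'n) \<Rightarrow> real) \<Rightarrow>
   (real \<times> (real ^ 'n) \<Rightarrow> real) \<Rightarrow> (real \<times> (real ^ 'n) \<Rightarrow> real) \<Rightarrow>
   (real ^ 'n \<Rightarrow> real) \<Rightarrow> (real ^ 'n \<Rightarrow> real) \<Rightarrow> (real \<times> (real ^ 'n) \<Rightarrow> real) \<Rightarrow> bool" where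
  "bvp_solution T G \<nu> b \<sigma> c g \<gamma> \<psi> \<mu> \<phi> u \<longleftrightarrow>
     C12 T G u \<and>
     (\<forall>p \<in> {0..T} \<times> closure G.
        cl_partial (cyl T G) [time_dir] u p + generator T G b \<sigma> u p + c p * u p + g p = 0) \<and>
     (\<forall>x \<in> closure G. u (T, x) = \<phi> x) \<and>
     (\<forall>t \<in> {0..T}. \<forall>z \<in> frontier G.
        - \<mu> z * generator T G b \<sigma> u (t, z) +
        \<nu> z \<bullet> (\<chi> i. cl_partial (cyl T G) [space_dir i] u (t, z)) +
        \<gamma> (t, z) * u (t, z) = \<psi> (t, z))"

definition boundary_proj ::
  "(real ^ 'n) set \<Rightarrow> (real ^ 'n \<Rightarrow> real ^ 'n) \<Rightarrow> real ^ 'n \<Rightarrow> real ^ 'n" where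
  "boundary_proj G \<nu> x =
     (THE z. z \<in> frontier G \<and> z = x + infdist x (frontier G) *\<^sub>R \<nu> z)"

type_synonym 'n state = "real \<times> (real ^ 'n) \<times> real \<times> real"

text \<open>One step from \<open>(t\<^sub>k, X\<^sub>k, Y\<^sub>k, Z\<^sub>k)\<close>. The operator is applied to \<open>\<phi>\<close> regarded as a
  function of time and space that does not depend on time.\<close>

definition sticky_step ::
  "real \<Rightarrow> (real ^ 'n) set \<Rightarrow> (real ^ 'n \<Rightarrow> real ^ 'n) \<Rightarrow>
   (real \<times> (real ^ 'n) \<Rightarrow> real ^ 'n) \<Rightarrow> (real \<times> (real ^ 'n) \<Rightarrow> real ^ 'n ^ 'n) \<Rightarrow>
   (real \<times> (real ^ 'n) \<Rightarrow> real) \<Rightarrow> (real \<times> (real ^ 'n) \<Rightarrow> real) \<Rightarrow>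
   (real \<times> (real ^ 'n) \<Rightarrow> real) \<Rightarrow> (real \<times> (real ^ 'n) \<Rightarrow> real) \<Rightarrow>
   (real ^ 'n \<Rightarrow> real) \<Rightarrow> (real ^ 'n \<Rightarrow> real) \<Rightarrow>
   real \<Rightarrow> real ^ 'n \<Rightarrow> 'n state \<Rightarrow> 'n state" where
  "sticky_step T G \<nu> b \<sigma> c g \<gamma> \<psi> \<mu> \<phi> h \<xi> = (\<lambda>(t, X, Y, Z).
     let t' = t + h;
         X' = X + h *\<^sub>R b (t, X) + sqrt h *\<^sub>R (\<sigma> (t, X) *v \<xi>);
         Y' = Y + h * c (t, X) * Y;
         Z' = Z + h * g (t, X) * Y
     in
     if X' \<in> closure G then
       (if t' < T then (t', X', Y', Z') else (T, X', Y', Z'))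
     else
       let r = infdist X' (frontier G);
           P = boundary_proj G \<nu> X';
           m = \<mu> P;
           t'' = t' + 2 * r * m;
           X'' = X' + (2 * r) *\<^sub>R \<nu> P
       in
       if t' < T \<and> t'' < T then
         let q = (t' + r * m, P);
             \<gamma>q = \<gamma> q; cq = c q; gq = g q; \<psi>q = \<psi> q
         in (t'', X'',
             Y' + (2*r*\<gamma>q + 2*r*m*cq + 2*r^2*\<gamma>q^2 + 4*r^2*m*\<gamma>q*cq + 2*r^2*m^2*cq^2) * Y,
             Z' + (- 2*r*\<psi>q - 2*r^2*\<gamma>q*\<psi>q - 2*r^2*m*cq*\<psi>q
                   + 2*r*m*gq + 2*r^2*m*\<gamma>q*gq + 2*r^2*m^2*cq*gq) * Y)
       else
         let q = (T, P);
             \<gamma>q = \<gamma> q; cq = c q; gq = g q; \<psi>q = \<psi> q;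
             A\<phi> = generator T G b \<sigma> (\<lambda>(_, y). \<phi> y) q
         in
         if t' < T then
           let p = (T - t') / (2 * m)
           in (T, X'',
               Y' + (2*r*\<gamma>q + 2*p*m*cq) * Y,
               Z' + (- 2*m*(r - p)*A\<phi> + 2*p*m*gq - 2*r*\<psi>q) * Y)
         else
           (T, X'',
            Y' + (2*r*\<gamma>q + 2*r^2*\<gamma>q^2) * Y,
            Z' + (- 2*r*m*A\<phi> - 2*r^2*\<gamma>q*m*A\<phi> - 2*r*\<psi>q - 2*r^2*\<gamma>q*\<psi>q) * Y))"

text \<open>Every step that stops sets the time to \<open>T\<close> and every other one leaves it below \<open>T\<close>, so the
  time coordinate records whether the chain has stopped. A stopped chain is continued as a
  constant.\<close>

primrec sticky_chain ::
  "real \<Rightarrow> (real ^ 'n \<Rightarrow> 'n state \<Rightarrow> 'n state) \<Rightarrow> 'n state \<Rightarrow> (nat \<Rightarrow> real ^ 'n) \<Rightarrow> nat \<Rightarrow> 'n state" where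
  "sticky_chain T step s0 \<xi> 0 = s0"
| "sticky_chain T step s0 \<xi> (Suc k) =
     (let s = sticky_chain T step s0 \<xi> k in if fst s < T then step (\<xi> (Suc k)) s else s)"

definition num_steps ::
  "real \<Rightarrow> (real ^ 'n \<Rightarrow> 'n state \<Rightarrow> 'n state) \<Rightarrow> 'n state \<Rightarrow> (nat \<Rightarrow> real ^ 'n) \<Rightarrow> nat" where
  "num_steps T step s0 \<xi> = (LEAST k. fst (sticky_chain T step s0 \<xi> k) = T)"

definition final_state ::
  "real \<Rightarrow> (real ^ 'n \<Rightarrow> 'n state \<Rightarrow> 'n state) \<Rightarrow> 'n state \<Rightarrow> (nat \<Rightarrow> real ^ 'n) \<Rightarrow> 'n state" where
  "final_state T step s0 \<xi> = sticky_chain T step s0 \<xi> (num_steps T step s0 \<xi>)"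

definition payoff :: "(real ^ 'n \<Rightarrow> real) \<Rightarrow> 'n state \<Rightarrow> real" where
  "payoff \<phi> = (\<lambda>(t, X, Y, Z). \<phi> X * Y + Z)"

end

theory Submission
  imports Defs
begin

text \<open>Write \<open>f(t, X, Y, Z) = u(t, X) Y + Z\<close>. In one step from \<open>z = (t, X)\<close> the auxiliary point
  \<open>(t', X')\<close> may lie outside the domain; instead of extending \<open>u\<close> one compares with the cubic
  Taylor polynomial of \<open>u\<close> at \<open>z\<close>, whose average over the signs differs from \<open>f\<close> by \<open>O(h\<^sup>2)\<close>
  because of the equation. A reflection with overshoot \<open>r\<close> goes from \<open>(t', X')\<close> to the new point
  along \<open>(\<mu>, \<nu>)\<close> with midpoint on the boundary. There the equation turns the boundary condition
  into a first-order condition for the derivative of \<open>u\<close> along \<open>(\<mu>, \<nu>)\<close>, so the midpoint rule gives an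
  error \<open>O(r h)\<close>. Since \<open>\<mu>\<close> is bounded below and a reflection advances the clock by \<open>h + 2 r \<mu>\<close>, every
  step that does not stop has error \<open>O(h)\<close> times the elapsed time, and \<open>Y\<close> stays bounded; the
  stopping step has error \<open>O(h)\<close>. Summing over the steps bounds the total error by \<open>O(h)\<close>.

  The Taylor polynomial at \<open>z\<close> approximates \<open>u\<close> up to the boundary although the domain need not be
  convex: two nearby points are joined by three short segments inside the domain, leaving the
  boundary along the axis of a graph chart, and the remainder is propagated along them.\<close>

section \<open>Mixed partial derivatives and Taylor polynomials\<close>

text \<open>The obstacle is parity. A step has length of order \<open>sqrt h\<close>, and the
  averaged error is \<open>O(h\<^sup>2)\<close> only because odd powers of the noise cancel under
  \<open>\<xi> \<mapsto> - \<xi>\<close>. Reflection destroys this symmetry, since of two opposite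
  outcomes one may be reflected and the other not. Every outcome is therefore compared with one and
  the same polynomial at its own auxiliary point, where the symmetry is intact, and the reflection
  is charged separately. The quadratic terms in the coefficients of the scheme are what makes this
  charge \<open>O(r h)\<close>: with the boundary relation inserted, all terms of order
  \<open>r\<close> and \<open>r\<^sup>2\<close> either cancel or meet a small difference. Counting
  steps would not suffice: \<open>O(r h)\<close> may be of order \<open>h powr (3/2)\<close>, and
  there may be of order \<open>1 / h\<close> steps. Hence errors, and also the growth of
  \<open>Y\<close>, are measured by the clock. While the chain runs, every step advances the time by
  at least \<open>h\<close>, so all paths stop within a deterministic number of steps. Expectations
  are then finite averages over sign sequences, and conditioning on the past is a nested
  sum.\<close>

text \<open>Mean value inequality for \<open>g s - s * c\<close>; the closed segment admits negative
  \<open>\<tau>\<close>.\<close>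

lemma line_bound:
  fixes g g' :: "real \<Rightarrow> real"
  assumes "\<And>s. s \<in> closed_segment 0 \<tau> \<Longrightarrow> (g has_real_derivative g' s) (at s)"
    and "\<And>s. s \<in> closed_segment 0 \<tau> \<Longrightarrow> \<bar>g' s - c\<bar> \<le> \<eta>"
  shows "\<bar>g \<tau> - g 0 - \<tau> * c\<bar> \<le> \<eta> * \<bar>\<tau>\<bar>"
proof -
  have "norm ((g \<tau> - \<tau> * c) - (g 0 - 0 * c)) \<le> \<eta> * norm (\<tau> - 0)"
  proof (rule field_differentiable_bound[where S = "closed_segment 0 \<tau>" and f' = "\<lambda>s. g' s - c"])
    fix s assume s: "s \<in> closed_segment 0 \<tau>"
    show "((\<lambda>s. g s - s * c) has_real_derivative g' s - c) (at s within closed_segment 0 \<tau>)"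
      by (rule has_field_derivative_at_within)
        (auto intro!: derivative_eq_intros assms(1)[OF s])
    show "norm (g' s - c) \<le> \<eta>" using assms(2)[OF s] by simp
  qed auto
  thus ?thesis by (simp add: algebra_simps)
qed

text \<open>Continuity of the partial derivatives gives total differentiability: the increment is
  split into moves along single coordinates, and \<open>line_bound\<close> controls each of
  them.\<close>

lemma has_derivative_partials:
  fixes v :: "'a::euclidean_space \<Rightarrow> real"
  assumes "open \<Omega>" "x \<in> \<Omega>"
    and D: "\<And>e y. e \<in> Basis \<Longrightarrow> y \<in> \<Omega> \<Longrightarrow> ((\<lambda>s. v (y + s *\<^sub>R e)) has_real_derivative w e y) (at 0)"
    and C: "\<And>e. e \<in> Basis \<Longrightarrow> continuous_on \<Omega> (w e)"
  shows "(v has_derivative (\<lambda>h. \<Sum>e\<in>Basis. (h \<bullet> e) * w e x)) (at x)"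
  unfolding has_derivative_at_alt
proof (intro conjI allI impI)
  show "bounded_linear (\<lambda>h. \<Sum>e\<in>Basis. (h \<bullet> e) * w e x)"
    by (intro bounded_linear_intros)
next
  fix \<epsilon> :: real assume \<epsilon>: "\<epsilon> > 0"
  define N where "N = real DIM('a)"
  have N: "N \<ge> 1" using DIM_positive[where 'a='a] by (simp add: N_def Suc_leI)
  have "\<forall>e\<in>Basis. \<exists>d>0. \<forall>y. dist y x < d \<longrightarrow> y \<in> \<Omega> \<and> \<bar>w e y - w e x\<bar> \<le> \<epsilon> / N"
  proof
    fix e :: 'a assume e: "e \<in> Basis"
    from assms(1,2) obtain d1 where d1: "d1 > 0" "\<And>y. dist y x < d1 \<Longrightarrow> y \<in> \<Omega>"
      unfolding open_dist by blast
    have "isCont (w e) x" using C[OF e] assms(1,2) by (simp add: continuous_on_eq_continuous_at)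
    then obtain d2 where d2: "d2 > 0" "\<And>y. dist y x < d2 \<Longrightarrow> dist (w e y) (w e x) < \<epsilon> / N"
      unfolding continuous_at_eps_delta using \<epsilon> N
      by (metis divide_pos_pos less_le_trans zero_less_one)
    show "\<exists>d>0. \<forall>y. dist y x < d \<longrightarrow> y \<in> \<Omega> \<and> \<bar>w e y - w e x\<bar> \<le> \<epsilon> / N"
      using d1 d2 by (intro exI[of _ "min d1 d2"]) (auto simp: dist_real_def less_imp_le)
  qed
  then obtain dd where dd: "\<And>e. e \<in> Basis \<Longrightarrow> dd e > 0"
    "\<And>e y. e \<in> Basis \<Longrightarrow> dist y x < dd e \<Longrightarrow> y \<in> \<Omega> \<and> \<bar>w e y - w e x\<bar> \<le> \<epsilon> / N"
    by metis
  define d where "d = Min (dd ` Basis)"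
  have d0: "d > 0" using dd(1) by (auto simp: d_def)
  have dP: "y \<in> \<Omega> \<and> \<bar>w e y - w e x\<bar> \<le> \<epsilon> / N" if "e \<in> Basis" "dist y x < d" for e y
    using dd(2)[of e y] that by (auto simp: d_def)
  show "\<exists>d>0. \<forall>y. norm (y - x) < d \<longrightarrow>
      norm (v y - v x - (\<Sum>e\<in>Basis. (y - x) \<bullet> e * w e x)) \<le> \<epsilon> * norm (y - x)"
  \<comment> \<open>The intermediate points, reached by changing one coordinate after the other,
    have distance at most \<open>(N + 1) * norm h\<close> from \<open>x\<close>; hence this
    radius.\<close>
  proof (intro exI[of _ "d / (N + 1)"] conjI allI impI)
    show "d / (N + 1) > 0" using d0 N by simp
    fix y assume "norm (y - x) < d / (N + 1)"
    define h where "h = y - x"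
    have h: "(N + 1) * norm h < d"
      using \<open>norm (y - x) < _\<close> N by (simp add: h_def pos_less_divide_eq mult.commute)
    have key: "\<bar>v (x + (\<Sum>e\<in>B. (h \<bullet> e) *\<^sub>R e)) - v x - (\<Sum>e\<in>B. (h \<bullet> e) * w e x)\<bar> \<le> card B * (\<epsilon> / N * norm h)"
      if "B \<subseteq> Basis" for B :: "'a set"
      using finite_subset[OF that finite_Basis] that
    proof (induction B rule: finite_induct)
      case empty thus ?case by simp
    next
      case (insert f B)
      define hB where "hB = (\<Sum>e\<in>B. (h \<bullet> e) *\<^sub>R e)"
      have "norm hB \<le> (\<Sum>e\<in>B. norm h)"
        unfolding hB_def using insert.prems
        by (intro sum_norm_le) (auto simp: Basis_le_norm)
      also have "\<dots> \<le> N * norm h"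
        using insert.prems card_mono[of "Basis :: 'a set" B] by (auto simp: N_def intro!: mult_right_mono)
      finally have hB: "norm hB \<le> N * norm h" .
      have f: "f \<in> Basis" using insert.prems by simp
      have near: "dist (x + hB + s *\<^sub>R f) x < d" if "s \<in> closed_segment 0 (h \<bullet> f)" for s
      proof -
        have "\<bar>s\<bar> \<le> \<bar>h \<bullet> f\<bar>" using that by (auto simp: closed_segment_eq_real_ivl split: if_splits)
        also have "\<dots> \<le> norm h" using f by (rule Basis_le_norm)
        finally have "norm (hB + s *\<^sub>R f) \<le> N * norm h + norm h"
          using hB f by (intro order_trans[OF norm_triangle_ineq]) auto
        thus ?thesis using h by (simp add: dist_norm algebra_simps)
      qed
      have "\<bar>v (x + hB + (h \<bullet> f) *\<^sub>R f) - v (x + hB + 0 *\<^sub>R f) - (h \<bullet> f) * w f x\<bar> \<le> \<epsilon> / N * \<bar>h \<bullet> f\<bar>"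
      proof (rule line_bound[where g = "\<lambda>s. v (x + hB + s *\<^sub>R f)" and g' = "\<lambda>s. w f (x + hB + s *\<^sub>R f)"])
        fix s assume s: "s \<in> closed_segment 0 (h \<bullet> f)"
        show "\<bar>w f (x + hB + s *\<^sub>R f) - w f x\<bar> \<le> \<epsilon> / N" using dP[OF f near[OF s]] by simp
        have "((\<lambda>t. v (x + hB + s *\<^sub>R f + t *\<^sub>R f)) has_real_derivative w f (x + hB + s *\<^sub>R f)) (at 0)"
          using dP[OF f near[OF s]] D[OF f] by blast
        thus "((\<lambda>s. v (x + hB + s *\<^sub>R f)) has_real_derivative w f (x + hB + s *\<^sub>R f)) (at s)"
          using DERIV_shift[of "\<lambda>s. v (x + hB + s *\<^sub>R f)" _ 0 s]
          by (simp add: algebra_simps)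
      qed
      also have "\<dots> \<le> \<epsilon> / N * norm h" using f \<epsilon> N by (intro mult_left_mono Basis_le_norm) auto
      finally have 1: "\<bar>v (x + hB + (h \<bullet> f) *\<^sub>R f) - v (x + hB) - (h \<bullet> f) * w f x\<bar> \<le> \<epsilon> / N * norm h" by simp
      have 2: "\<bar>v (x + hB) - v x - (\<Sum>e\<in>B. (h \<bullet> e) * w e x)\<bar> \<le> card B * (\<epsilon> / N * norm h)"
        using insert by (simp add: hB_def)
      have e1: "x + (\<Sum>e\<in>insert f B. (h \<bullet> e) *\<^sub>R e) = x + hB + (h \<bullet> f) *\<^sub>R f"
        using insert by (simp add: hB_def)
      have e2: "(\<Sum>e\<in>insert f B. (h \<bullet> e) * w e x) = (h \<bullet> f) * w f x + (\<Sum>e\<in>B. (h \<bullet> e) * w e x)"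
        using insert by simp
      have e3: "card (insert f B) * (\<epsilon> / N * norm h) = card B * (\<epsilon> / N * norm h) + \<epsilon> / N * norm h"
        using insert by (simp add: distrib_right add_divide_distrib)
      show ?case unfolding e1 e2 e3 using 1 2 by linarith
    qed
    have "x + (\<Sum>e\<in>Basis. (h \<bullet> e) *\<^sub>R e) = y" by (simp add: euclidean_representation h_def)
    with key[OF subset_refl] N show "norm (v y - v x - (\<Sum>e\<in>Basis. (y - x) \<bullet> e * w e x)) \<le> \<epsilon> * norm (y - x)"
      by (simp add: h_def N_def)
  qed
qed

section \<open>Symmetry of iterated partial derivatives\<close>

text \<open>The interior content of \<open>smooth_closure\<close> with weight 1. Differentiability
  is asked along basis directions only; \<open>Ck_has_derivative\<close> recovers the total
  derivative of every order below \<open>k\<close>.\<close>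

definition Ck :: "nat \<Rightarrow> 'a::euclidean_space set \<Rightarrow> ('a \<Rightarrow> real) \<Rightarrow> bool" where
  "Ck k \<Omega> v \<longleftrightarrow> (\<forall>es. set es \<subseteq> Basis \<and> length es \<le> k \<longrightarrow>
     continuous_on \<Omega> (dpartial es v) \<and>
     (length es < k \<longrightarrow> (\<forall>e\<in>Basis. \<forall>x\<in>\<Omega>. (\<lambda>s. dpartial es v (x + s *\<^sub>R e)) field_differentiable (at 0))))"

lemma Ck_continuous:
  assumes "Ck k \<Omega> v" "set es \<subseteq> Basis" "length es \<le> k"
  shows "continuous_on \<Omega> (dpartial es v)"
  using assms unfolding Ck_def by blast

lemma dpartial_append: "dpartial (xs @ ys) v = dpartial xs (dpartial ys v)"
  by (induction xs) auto

lemma dpartial_cong_open: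
  assumes "open \<Omega>" "\<And>x. x \<in> \<Omega> \<Longrightarrow> v x = w x" "x \<in> \<Omega>"
  shows "dpartial es v x = dpartial es w x"
  using assms(3)
proof (induction es arbitrary: x)
  case Nil thus ?case using assms(2) by simp
next
  case (Cons e es)
  have "((\<lambda>s. x + s *\<^sub>R e) \<longlongrightarrow> x + 0 *\<^sub>R e) (at (0::real))" by (intro tendsto_intros)
  hence "(\<lambda>s. x + s *\<^sub>R e) \<midarrow>0\<rightarrow> x" by simp
  hence "eventually (\<lambda>s. x + s *\<^sub>R e \<in> \<Omega>) (at (0::real))"
    using assms(1) Cons.prems topological_tendstoD by blast
  hence "eventually (\<lambda>s. x + s *\<^sub>R e \<in> \<Omega>) (nhds (0::real))"
    using Cons.prems by (simp add: eventually_nhds_conv_at)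
  hence "eventually (\<lambda>s. dpartial es v (x + s *\<^sub>R e) = dpartial es w (x + s *\<^sub>R e)) (nhds (0::real))"
    by eventually_elim (rule Cons.IH)
  thus ?case by (simp add: deriv_cong_ev)
qed

lemma Ck_has_real_derivative:
  assumes "Ck k \<Omega> v" "set es \<subseteq> Basis" "length es < k" "e \<in> Basis" "x \<in> \<Omega>"
  shows "((\<lambda>s. dpartial es v (x + s *\<^sub>R e)) has_real_derivative dpartial (e # es) v x) (at 0)"
  using assms unfolding Ck_def dpartial.simps
  by (metis DERIV_deriv_iff_field_differentiable less_imp_le_nat)

lemma Ck_has_derivative:
  assumes "open \<Omega>" "Ck k \<Omega> v" "set es \<subseteq> Basis" "length es < k" "x \<in> \<Omega>"
  shows "(dpartial es v has_derivative (\<lambda>h. \<Sum>e\<in>Basis. (h \<bullet> e) * dpartial (e # es) v x)) (at x)"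
proof (rule has_derivative_partials[OF assms(1,5)])
  fix e :: 'a assume e: "e \<in> Basis"
  show "((\<lambda>s. dpartial es v (y + s *\<^sub>R e)) has_real_derivative dpartial (e # es) v y) (at 0)" if "y \<in> \<Omega>" for y
    by (rule Ck_has_real_derivative[OF assms(2-4) e that])
  have "set (e # es) \<subseteq> Basis" "length (e # es) \<le> k" using assms e by auto
  thus "continuous_on \<Omega> (dpartial (e # es) v)" using assms(2) unfolding Ck_def by blast
qed

text \<open>The mean value inequality is applied twice: along \<open>e\<close> to the first
  difference in direction \<open>f\<close>, and inside it along \<open>f\<close> to the derivative
  in direction \<open>e\<close>.\<close>

lemma second_difference:
  assumes "open \<Omega>" "Ck 2 \<Omega> v" "x \<in> \<Omega>" "e \<in> Basis" "f \<in> Basis" "\<eta> > 0"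
  shows "\<exists>d>0. \<forall>s. 0 < s \<and> s < d \<longrightarrow>
    \<bar>v (x + s *\<^sub>R e + s *\<^sub>R f) - v (x + s *\<^sub>R e) - v (x + s *\<^sub>R f) + v x - s * (s * dpartial [f, e] v x)\<bar> \<le> \<eta> * s * s"
proof -
  define A where "A = dpartial [f, e] v x"
  have "continuous_on \<Omega> (dpartial [f, e] v)" using assms by (intro Ck_continuous[of 2]) auto
  hence "isCont (dpartial [f, e] v) x" using assms by (simp add: continuous_on_eq_continuous_at)
  then obtain d2 where d2: "d2 > 0" "\<And>y. dist y x < d2 \<Longrightarrow> dist (dpartial [f, e] v y) A < \<eta>"
    unfolding continuous_at_eps_delta A_def using assms(6) by blast
  from assms(1,3) obtain d1 where d1: "d1 > 0" "\<And>y. dist y x < d1 \<Longrightarrow> y \<in> \<Omega>"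
    unfolding open_dist by blast
  define d where "d = min d1 d2 / 2"
  have nf: "norm e = 1" "norm f = 1" using assms by auto
  have near: "dist (x + \<tau> *\<^sub>R e + \<rho> *\<^sub>R f) x < d1 \<and> dist (x + \<tau> *\<^sub>R e + \<rho> *\<^sub>R f) x < d2"
    if "0 \<le> \<tau>" "\<tau> \<le> s" "0 \<le> \<rho>" "\<rho> \<le> s" "s < d" for \<tau> \<rho> s
  proof -
    have "norm (\<tau> *\<^sub>R e + \<rho> *\<^sub>R f) \<le> \<bar>\<tau>\<bar> + \<bar>\<rho>\<bar>"
      by (rule order_trans[OF norm_triangle_ineq]) (simp add: nf)
    also have "\<dots> < 2 * d" using that by simp
    finally show ?thesis by (simp add: d_def dist_norm algebra_simps)
  qed
  have shift: "((\<lambda>s. dpartial es v (y + s *\<^sub>R k)) has_real_derivative dpartial (k # es) v (y + s *\<^sub>R k)) (at s)"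
    if "y + s *\<^sub>R k \<in> \<Omega>" "set es \<subseteq> Basis" "length es < 2" "k \<in> Basis" for y s k es
  proof -
    have "((\<lambda>t. dpartial es v (y + s *\<^sub>R k + t *\<^sub>R k)) has_real_derivative dpartial (k # es) v (y + s *\<^sub>R k)) (at 0)"
      using Ck_has_real_derivative[OF assms(2) that(2,3,4,1)] .
    thus ?thesis
      using DERIV_shift[of "\<lambda>s. dpartial es v (y + s *\<^sub>R k)" _ 0 s]
      by (simp add: algebra_simps del: dpartial.simps)
  qed
  show ?thesis
  proof (intro exI[of _ d] conjI allI impI)
    show "d > 0" using d1 d2 by (simp add: d_def)
    fix s assume s: "0 < s \<and> s < d"
    define g where "g = (\<lambda>\<tau>. v (x + s *\<^sub>R f + \<tau> *\<^sub>R e) - v (x + \<tau> *\<^sub>R e))"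
    define g' where "g' = (\<lambda>\<tau>. dpartial [e] v (x + s *\<^sub>R f + \<tau> *\<^sub>R e) - dpartial [e] v (x + \<tau> *\<^sub>R e))"
    have "\<bar>g s - g 0 - s * (s * A)\<bar> \<le> (\<eta> * s) * \<bar>s\<bar>"
    proof (rule line_bound[where g' = g'])
      fix \<tau> assume "\<tau> \<in> closed_segment 0 s"
      hence \<tau>: "0 \<le> \<tau>" "\<tau> \<le> s" using s by (auto simp: closed_segment_eq_real_ivl)
      have in1: "x + s *\<^sub>R f + \<tau> *\<^sub>R e \<in> \<Omega>" "x + \<tau> *\<^sub>R e \<in> \<Omega>"
        using near[of \<tau> s s] near[of \<tau> s 0] \<tau> s d1 by (auto simp: algebra_simps)
      show "(g has_real_derivative g' \<tau>) (at \<tau>)"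
        unfolding g_def g'_def
        using shift[OF in1(1), of "[]"] shift[OF in1(2), of "[]"] assms(4) by (intro DERIV_diff) auto
      have "\<bar>dpartial [e] v (x + \<tau> *\<^sub>R e + s *\<^sub>R f) - dpartial [e] v (x + \<tau> *\<^sub>R e + 0 *\<^sub>R f) - s * A\<bar> \<le> \<eta> * \<bar>s\<bar>"
      proof (rule line_bound[where g = "\<lambda>\<rho>. dpartial [e] v (x + \<tau> *\<^sub>R e + \<rho> *\<^sub>R f)"
            and g' = "\<lambda>\<rho>. dpartial [f, e] v (x + \<tau> *\<^sub>R e + \<rho> *\<^sub>R f)"])
        fix \<rho> assume "\<rho> \<in> closed_segment 0 s"
        hence \<rho>: "0 \<le> \<rho>" "\<rho> \<le> s" using s by (auto simp: closed_segment_eq_real_ivl)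
        note n = near[OF \<tau> \<rho>]
        show "\<bar>dpartial [f, e] v (x + \<tau> *\<^sub>R e + \<rho> *\<^sub>R f) - A\<bar> \<le> \<eta>"
          using d2(2) n s by (force simp: dist_real_def)
        show "((\<lambda>\<rho>. dpartial [e] v (x + \<tau> *\<^sub>R e + \<rho> *\<^sub>R f)) has_real_derivative
               dpartial [f, e] v (x + \<tau> *\<^sub>R e + \<rho> *\<^sub>R f)) (at \<rho>)"
          using n s d1 assms(4,5) by (intro shift) auto
      qed
      thus "\<bar>g' \<tau> - s * A\<bar> \<le> \<eta> * s" using s by (simp add: g'_def algebra_simps)
    qed
    thus "\<bar>v (x + s *\<^sub>R e + s *\<^sub>R f) - v (x + s *\<^sub>R e) - v (x + s *\<^sub>R f) + v x
        - s * (s * dpartial [f, e] v x)\<bar> \<le> \<eta> * s * s"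
      using s by (simp add: g_def A_def algebra_simps del: dpartial.simps)
  qed
qed

text \<open>The second difference is symmetric in \<open>e\<close> and \<open>f\<close>, so it
  approximates both mixed derivatives up to \<open>\<eta> s\<^sup>2\<close>; a gap of
  \<open>3 \<eta>\<close> between them is impossible.\<close>

lemma dpartial_swap2:
  assumes "open \<Omega>" "Ck 2 \<Omega> v" "x \<in> \<Omega>" "e \<in> Basis" "f \<in> Basis"
  shows "dpartial [f, e] v x = dpartial [e, f] v x"
proof (rule ccontr)
  assume ne: "dpartial [f, e] v x \<noteq> dpartial [e, f] v x"
  define \<eta> where "\<eta> = \<bar>dpartial [f, e] v x - dpartial [e, f] v x\<bar> / 3"
  have \<eta>: "\<eta> > 0" using ne by (simp add: \<eta>_def)
  obtain d1 where d1: "d1 > 0" "\<And>s. 0 < s \<and> s < d1 \<Longrightarrow>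
    \<bar>v (x + s *\<^sub>R e + s *\<^sub>R f) - v (x + s *\<^sub>R e) - v (x + s *\<^sub>R f) + v x - s * (s * dpartial [f, e] v x)\<bar> \<le> \<eta> * s * s"
    using second_difference[OF assms \<eta>] by metis
  obtain d2 where d2: "d2 > 0" "\<And>s. 0 < s \<and> s < d2 \<Longrightarrow>
    \<bar>v (x + s *\<^sub>R f + s *\<^sub>R e) - v (x + s *\<^sub>R f) - v (x + s *\<^sub>R e) + v x - s * (s * dpartial [e, f] v x)\<bar> \<le> \<eta> * s * s"
    using second_difference[OF assms(1-3,5,4) \<eta>] by metis
  define s where "s = min d1 d2 / 2"
  have s: "0 < s" "s < d1" "s < d2" using d1(1) d2(1) by (auto simp: s_def)
  have swap: "x + s *\<^sub>R f + s *\<^sub>R e = x + s *\<^sub>R e + s *\<^sub>R f" by simp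
  have "\<bar>s * (s * dpartial [f, e] v x) - s * (s * dpartial [e, f] v x)\<bar> \<le> 2 * (\<eta> * s * s)"
    using d1(2)[of s] d2(2)[of s] s unfolding swap by (simp del: dpartial.simps)
  also have "s * (s * dpartial [f, e] v x) - s * (s * dpartial [e, f] v x)
      = (s * s) * (dpartial [f, e] v x - dpartial [e, f] v x)"
    by (simp add: algebra_simps del: dpartial.simps)
  finally have "(s * s) * (3 * \<eta>) \<le> (s * s) * (2 * \<eta>)"
    using s by (simp add: abs_mult \<eta>_def mult_ac del: dpartial.simps)
  thus False using s \<eta> by simp
qed

lemma Ck_dpartial:
  assumes "Ck k \<Omega> v" "set ys \<subseteq> Basis" "m + length ys \<le> k"
  shows "Ck m \<Omega> (dpartial ys v)"
  unfolding Ck_def dpartial_append[symmetric]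
  using assms unfolding Ck_def by simp

text \<open>The inner directions \<open>ys\<close> are absorbed into the function, and the outer
  ones \<open>xs\<close> see only its values on the open set.\<close>

lemma dpartial_swap:
  assumes "open \<Omega>" "Ck k \<Omega> v" "x \<in> \<Omega>" "set (xs @ e # f # ys) \<subseteq> Basis" "length (xs @ e # f # ys) \<le> k"
  shows "dpartial (xs @ e # f # ys) v x = dpartial (xs @ f # e # ys) v x"
proof -
  have "Ck 2 \<Omega> (dpartial ys v)" using assms by (intro Ck_dpartial) auto
  hence "dpartial [e, f] (dpartial ys v) y = dpartial [f, e] (dpartial ys v) y" if "y \<in> \<Omega>" for y
    using assms that by (intro dpartial_swap2) auto
  hence "dpartial xs (dpartial [e, f] (dpartial ys v)) x = dpartial xs (dpartial [f, e] (dpartial ys v)) x"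
    using assms by (intro dpartial_cong_open[where \<Omega> = \<Omega>]) auto
  thus ?thesis by (simp add: dpartial_append[symmetric] del: dpartial.simps)
qed

section \<open>Taylor polynomials of symmetric jets\<close>

text \<open>The homogeneous part of degree \<open>j\<close> of the Taylor polynomial with jet \<open>J\<close>, for the derivative \<open>es\<close>.
  No multi-indices are needed: for a jet that is invariant under permutations the derivative of the
  part of degree \<open>j + 1\<close> of \<open>es\<close> in direction \<open>e\<close> is the part of degree \<open>j\<close> of \<open>e # es\<close>.\<close>

primrec hom_taylor :: "nat \<Rightarrow> ('a::euclidean_space list \<Rightarrow> real) \<Rightarrow> 'a list \<Rightarrow> 'a \<Rightarrow> real" where
  "hom_taylor 0 J es = (\<lambda>h. J es)"
| "hom_taylor (Suc j) J es = (\<lambda>h. (\<Sum>e\<in>Basis. (h \<bullet> e) * hom_taylor j J (e # es) h) / (real j + 1))"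

definition taylor :: "nat \<Rightarrow> ('a::euclidean_space list \<Rightarrow> real) \<Rightarrow> 'a list \<Rightarrow> 'a \<Rightarrow> real" where
  "taylor n J es h = (\<Sum>j\<le>n. hom_taylor j J es h)"

text \<open>Adjacent transpositions generate all permutations, and they are what a recursion on
  lists can carry. The bound \<open>m\<close> is the order up to which the derivatives are known to
  be symmetric.\<close>

definition swap_invariant :: "nat \<Rightarrow> ('a::euclidean_space list \<Rightarrow> real) \<Rightarrow> bool" where
  "swap_invariant m J \<longleftrightarrow> (\<forall>xs e f ys. set (xs @ e # f # ys) \<subseteq> Basis \<longrightarrow> length (xs @ e # f # ys) \<le> m \<longrightarrow>
     J (xs @ e # f # ys) = J (xs @ f # e # ys))"

lemma hom_taylor_swap:
  assumes "swap_invariant m J" "set (xs @ e # f # es) \<subseteq> Basis" "length (xs @ e # f # es) + j \<le> m"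
  shows "hom_taylor j J (xs @ e # f # es) h = hom_taylor j J (xs @ f # e # es) h"
  using assms(2,3)
proof (induction j arbitrary: xs)
  case 0
  have "J (xs @ e # f # es) = J (xs @ f # e # es)"
    using assms(1) 0 unfolding swap_invariant_def by (metis add_0_right)
  thus ?case by simp
next
  case (Suc j)
  have "hom_taylor j J (k # xs @ e # f # es) h = hom_taylor j J (k # xs @ f # e # es) h" if "k \<in> Basis" for k
    using Suc.IH[of "k # xs"] Suc.prems that by simp
  thus ?case by simp
qed

text \<open>By the product rule the factors \<open>h \<bullet> e\<close> contribute the claimed term
  once, and the inner parts contribute it \<open>j + 1\<close> times after the two newest directions
  are swapped. The total \<open>j + 2\<close> cancels the denominator of the part of degree
  \<open>j + 2\<close> in the induction step.\<close>

lemma hom_taylor_has_derivative: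
  assumes "swap_invariant m J" "set es \<subseteq> Basis" "length es + Suc j \<le> m"
  shows "(hom_taylor (Suc j) J es has_derivative (\<lambda>k. \<Sum>e\<in>Basis. (k \<bullet> e) * hom_taylor j J (e # es) h)) (at h)"
  using assms(2,3)
proof (induction j arbitrary: es)
  case 0
  show ?case by (auto intro!: derivative_eq_intros)
next
  case (Suc j)
  have IH: "(hom_taylor (Suc j) J (e # es) has_derivative
      (\<lambda>k. \<Sum>f\<in>Basis. (k \<bullet> f) * hom_taylor j J (f # e # es) h)) (at h)" if "e \<in> Basis" for e
    using Suc.IH[of "e # es"] Suc.prems that by simp
  have D: "((\<lambda>h. (\<Sum>e\<in>Basis. (h \<bullet> e) * hom_taylor (Suc j) J (e # es) h) / (real (Suc j) + 1)) has_derivative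
     (\<lambda>k. (\<Sum>e\<in>Basis. (h \<bullet> e) * (\<Sum>f\<in>Basis. (k \<bullet> f) * hom_taylor j J (f # e # es) h)
        + (k \<bullet> e) * hom_taylor (Suc j) J (e # es) h) / (real (Suc j) + 1))) (at h)"
  proof -
    have A: "((\<lambda>h. (h \<bullet> e) * hom_taylor (Suc j) J (e # es) h) has_derivative
        (\<lambda>k. (h \<bullet> e) * (\<Sum>f\<in>Basis. (k \<bullet> f) * hom_taylor j J (f # e # es) h)
        + (k \<bullet> e) * hom_taylor (Suc j) J (e # es) h)) (at h)" if "e \<in> Basis" for e
      by (rule has_derivative_mult[OF _ IH[OF that]]) (auto intro!: derivative_eq_intros)
    show ?thesis
      using has_derivative_mult_left[OF has_derivative_sum[OF A], of Basis "\<lambda>x. x" "1 / (real (Suc j) + 1)"]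
      by (simp add: divide_inverse del: hom_taylor.simps)
  qed
  have eq: "(\<Sum>e\<in>Basis. (h \<bullet> e) * (\<Sum>f\<in>Basis. (k \<bullet> f) * hom_taylor j J (f # e # es) h)
        + (k \<bullet> e) * hom_taylor (Suc j) J (e # es) h) / (real (Suc j) + 1)
      = (\<Sum>e\<in>Basis. (k \<bullet> e) * hom_taylor (Suc j) J (e # es) h)" for k
  proof -
    have sw: "hom_taylor j J (f # e # es) h = hom_taylor j J (e # f # es) h" if "e \<in> Basis" "f \<in> Basis" for e f
      using hom_taylor_swap[OF assms(1), of "[]" f e es j h] that Suc.prems by simp
    have "(\<Sum>e\<in>Basis. (h \<bullet> e) * (\<Sum>f\<in>Basis. (k \<bullet> f) * hom_taylor j J (f # e # es) h))
        = (\<Sum>e\<in>Basis. \<Sum>f\<in>Basis. (k \<bullet> f) * ((h \<bullet> e) * hom_taylor j J (e # f # es) h))"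
      by (auto simp: sum_distrib_left mult_ac sw intro!: sum.cong)
    also have "\<dots> = (\<Sum>f\<in>Basis. (k \<bullet> f) * (\<Sum>e\<in>Basis. (h \<bullet> e) * hom_taylor j J (e # f # es) h))"
      by (subst sum.swap) (simp add: sum_distrib_left)
    also have "\<dots> = (\<Sum>f\<in>Basis. (k \<bullet> f) * ((real j + 1) * hom_taylor (Suc j) J (f # es) h))"
      by simp
    also have "\<dots> = (real j + 1) * (\<Sum>f\<in>Basis. (k \<bullet> f) * hom_taylor (Suc j) J (f # es) h)"
      by (simp only: sum_distrib_left mult.left_commute)
    finally show ?thesis
      by (simp add: sum.distrib field_simps del: hom_taylor.simps)
  qed
  show ?case using D unfolding eq hom_taylor.simps(2)[of "Suc j"] .
qed

lemma taylor_has_derivative: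
  assumes "swap_invariant m J" "set es \<subseteq> Basis" "length es + Suc n \<le> m"
  shows "(taylor (Suc n) J es has_derivative (\<lambda>k. \<Sum>e\<in>Basis. (k \<bullet> e) * taylor n J (e # es) h)) (at h)"
proof -
  have eq: "taylor (Suc n) J es = (\<lambda>h. J es + (\<Sum>j\<le>n. hom_taylor (Suc j) J es h))"
    unfolding taylor_def sum.atMost_Suc_shift by (simp del: hom_taylor.simps(2))
  have "((\<lambda>h. J es + (\<Sum>j\<le>n. hom_taylor (Suc j) J es h)) has_derivative
     (\<lambda>k. 0 + (\<Sum>j\<le>n. \<Sum>e\<in>Basis. (k \<bullet> e) * hom_taylor j J (e # es) h))) (at h)"
    using assms by (intro has_derivative_add has_derivative_const has_derivative_sum
        hom_taylor_has_derivative[OF assms(1)]) auto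
  also have "(\<lambda>k. 0 + (\<Sum>j\<le>n. \<Sum>e\<in>Basis. (k \<bullet> e) * hom_taylor j J (e # es) h)) =
      (\<lambda>k. \<Sum>e\<in>Basis. (k \<bullet> e) * taylor n J (e # es) h)"
    by (rule ext, subst sum.swap) (simp add: taylor_def sum_distrib_left)
  finally show ?thesis unfolding eq .
qed

lemma taylor_0 [simp]: "taylor 0 J es = (\<lambda>h. J es)"
  by (auto simp: taylor_def)

lemma taylor_at_0 [simp]: "taylor n J es 0 = J es"
proof -
  have "hom_taylor (Suc j) J es 0 = 0" for j by simp
  thus ?thesis by (simp add: taylor_def sum.atMost_shift del: hom_taylor.simps(2))
qed

text \<open>Downward induction on the order of differentiation. \<open>R\<close> is any family in
  which \<open>R (e # es)\<close> is the derivative of \<open>R es\<close> along \<open>e\<close>,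
  and \<open>l\<close> is a fixed length scale. Each integration along the segment gains one factor
  \<open>l\<close> and costs the factor \<open>1 + DIM('a) * \<kappa>\<close>, so bounds with the
  right powers of \<open>l\<close> at \<open>a\<close> persist on the whole segment.\<close>

lemma segment_remainder:
  fixes R :: "'a::euclidean_space list \<Rightarrow> 'a \<Rightarrow> real" and A l \<kappa> :: real
  assumes D: "\<And>es y. set es \<subseteq> Basis \<Longrightarrow> length es < m \<Longrightarrow> y \<in> closed_segment a b \<Longrightarrow>
      (R es has_derivative (\<lambda>h. \<Sum>e\<in>Basis. (h \<bullet> e) * R (e # es) y)) (at y)"
    and top: "\<And>es y. set es \<subseteq> Basis \<Longrightarrow> length es = m \<Longrightarrow> y \<in> closed_segment a b \<Longrightarrow> \<bar>R es y\<bar> \<le> A"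
    and start: "\<And>es. set es \<subseteq> Basis \<Longrightarrow> length es \<le> m \<Longrightarrow> \<bar>R es a\<bar> \<le> A * l ^ (m - length es)"
    and ab: "norm (b - a) \<le> \<kappa> * l" and pos: "0 \<le> l" "0 \<le> \<kappa>" "0 \<le> A"
    and es: "set es \<subseteq> Basis" "length es \<le> m" and y: "y \<in> closed_segment a b"
  shows "\<bar>R es y\<bar> \<le> A * (1 + DIM('a) * \<kappa>) ^ m * l ^ (m - length es)"
proof -
  define q where "q = 1 + DIM('a) * \<kappa>"
  have q: "q \<ge> 1" using pos by (simp add: q_def)
  have main: "\<bar>R es y\<bar> \<le> A * q ^ k * l ^ k" if "k = m - length es" "set es \<subseteq> Basis" "length es \<le> m" "y \<in> closed_segment a b" for k es y
    using that
  proof (induction k arbitrary: es y)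
    case 0 thus ?case using top[of es y] by simp
  next
    case (Suc k)
    define B where "B = A * q ^ k * l ^ k"
    have len: "length es < m" "k = m - Suc (length es)" using Suc.prems(1) by linarith+
    have B0: "B \<ge> 0" using pos q by (simp add: B_def)
    have "norm (R es y - R es a) \<le> (DIM('a) * B) * norm (y - a)"
    proof (rule differentiable_bound[where S = "closed_segment a b"])
      fix z assume z: "z \<in> closed_segment a b"
      show "(R es has_derivative (\<lambda>h. \<Sum>e\<in>Basis. (h \<bullet> e) * R (e # es) z)) (at z within closed_segment a b)"
        by (rule has_derivative_at_withinI[OF D[OF Suc.prems(2) len(1) z]])
      show "onorm (\<lambda>h. \<Sum>e\<in>Basis. (h \<bullet> e) * R (e # es) z) \<le> DIM('a) * B"
      proof (rule onorm_le)
        fix h :: 'a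
        have "norm (\<Sum>e\<in>Basis. (h \<bullet> e) * R (e # es) z) \<le> (\<Sum>e\<in>(Basis :: 'a set). norm h * B)"
        proof (rule sum_norm_le)
          fix e :: 'a assume e: "e \<in> Basis"
          have "\<bar>R (e # es) z\<bar> \<le> B" unfolding B_def
            by (rule Suc.IH) (use len Suc.prems(2) e z in simp_all)
          thus "norm (h \<bullet> e * R (e # es) z) \<le> norm h * B"
            using Basis_le_norm[OF e, of h] by (simp add: abs_mult mult_mono)
        qed
        thus "norm (\<Sum>e\<in>Basis. (h \<bullet> e) * R (e # es) z) \<le> DIM('a) * B * norm h" by (simp add: mult_ac)
      qed
    qed (use Suc.prems(4) in simp_all)
    also have "\<dots> \<le> (DIM('a) * B) * (\<kappa> * l)"
    proof (rule mult_left_mono)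
      have "norm (y - a) \<le> norm (b - a)" using segment_bound1[OF Suc.prems(4)] by simp
      thus "norm (y - a) \<le> \<kappa> * l" using ab by simp
    qed (use B0 in auto)
    finally have "\<bar>R es y\<bar> \<le> \<bar>R es a\<bar> + DIM('a) * B * (\<kappa> * l)" by simp
    also have "\<bar>R es a\<bar> \<le> A * l ^ Suc k" using start[OF Suc.prems(2,3)] unfolding Suc.prems(1)[symmetric] .
    also have "A * l ^ Suc k \<le> q ^ k * (A * l ^ Suc k)"
      using pos one_le_power[OF q] mult_right_mono[of 1 "q ^ k" "A * l ^ Suc k"] by simp
    finally show ?case by (simp add: B_def q_def algebra_simps)
  qed
  have "\<bar>R es y\<bar> \<le> A * q ^ (m - length es) * l ^ (m - length es)" using main es y by simp
  also have "\<dots> \<le> A * q ^ m * l ^ (m - length es)"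
    using q pos by (intro mult_right_mono mult_left_mono power_increasing) auto
  finally show ?thesis by (simp add: q_def)
qed

section \<open>Taylor estimates up to the boundary\<close>

text \<open>Base point and increment may both vary, as they do when interior points approach two
  boundary points.\<close>

lemma hom_taylor_tendsto:
  assumes "\<And>fs. set fs \<subseteq> Basis \<Longrightarrow> length fs \<le> m \<Longrightarrow> ((\<lambda>n. J n fs) \<longlongrightarrow> J' fs) F"
    and "(h \<longlongrightarrow> h') F" "set es \<subseteq> Basis" "length es + j \<le> m"
  shows "((\<lambda>n. hom_taylor j (J n) es (h n)) \<longlongrightarrow> hom_taylor j J' es h') F"
  using assms(3,4)
proof (induction j arbitrary: es)
  case 0 thus ?case using assms(1) by simp
next
  case (Suc j)
  have "((\<lambda>n. hom_taylor j (J n) (e # es) (h n)) \<longlongrightarrow> hom_taylor j J' (e # es) h') F" if "e \<in> Basis" for e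
    using that Suc.prems by (intro Suc.IH) auto
  thus ?case using assms(2) by (auto intro!: tendsto_intros)
qed

lemma taylor_tendsto:
  assumes "\<And>fs. set fs \<subseteq> Basis \<Longrightarrow> length fs \<le> m \<Longrightarrow> ((\<lambda>n. J n fs) \<longlongrightarrow> J' fs) F"
    and "(h \<longlongrightarrow> h') F" "set es \<subseteq> Basis" "length es + j \<le> m"
  shows "((\<lambda>n. taylor j (J n) es (h n)) \<longlongrightarrow> taylor j J' es h') F"
  unfolding taylor_def using assms by (intro tendsto_sum hom_taylor_tendsto[where m = m]) auto

lemma cl_partial_inside: "x \<in> \<Omega> \<Longrightarrow> cl_partial \<Omega> es v x = dpartial es v x"
  by (simp add: cl_partial_def)

lemma smooth_closure_Ck:
  assumes "smooth_closure (\<lambda>_. 1) k \<Omega> v"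
  shows "Ck k \<Omega> v"
  unfolding Ck_def
proof (intro allI impI conjI)
  fix es :: "'a list" assume es: "set es \<subseteq> Basis \<and> length es \<le> k"
  have l: "sum_list (map (\<lambda>_. 1) es) = length es" by (induction es) auto
  have "continuous_on (closure \<Omega>) (cl_partial \<Omega> es v)"
    using assms es l unfolding smooth_closure_def by simp
  hence "continuous_on \<Omega> (cl_partial \<Omega> es v)" using closure_subset continuous_on_subset by blast
  thus "continuous_on \<Omega> (dpartial es v)"
    by (rule continuous_on_eq) (simp add: cl_partial_inside)
  show "\<forall>e\<in>Basis. \<forall>x\<in>\<Omega>. (\<lambda>s. dpartial es v (x + s *\<^sub>R e)) field_differentiable at 0" if "length es < k"
    using assms es l that unfolding smooth_closure_def by (auto simp: Suc_le_eq)
qed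

lemma smooth_closure_continuous:
  assumes "smooth_closure (\<lambda>_. 1) k \<Omega> v" "set es \<subseteq> Basis" "length es \<le> k"
  shows "continuous_on (closure \<Omega>) (cl_partial \<Omega> es v)"
proof -
  have "sum_list (map (\<lambda>_. 1) es) = length es" by (induction es) auto
  thus ?thesis using assms unfolding smooth_closure_def by simp
qed

text \<open>Identifies boundary values: any continuous function on the closure that equals the
  derivative inside is its extension. A point of the closure outside the set is a limit point of it,
  so the limit is unique.\<close>

lemma cl_partial_limit:
  assumes "continuous_on (closure \<Omega>) w" "\<And>y. y \<in> \<Omega> \<Longrightarrow> w y = dpartial es v y" "x \<in> closure \<Omega>"
  shows "cl_partial \<Omega> es v x = w x"
proof (cases "x \<in> \<Omega>")
  case True thus ?thesis using assms by (simp add: cl_partial_def)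
next
  case False
  hence nt: "at x within \<Omega> \<noteq> bot"
    using assms(3) by (auto simp: closure_def trivial_limit_within)
  have "(w \<longlongrightarrow> w x) (at x within closure \<Omega>)" using assms(1,3) by (simp add: continuous_on_def)
  hence "(w \<longlongrightarrow> w x) (at x within \<Omega>)" by (rule tendsto_within_subset) (rule closure_subset)
  hence "(dpartial es v \<longlongrightarrow> w x) (at x within \<Omega>)"
    by (rule Lim_transform_eventually) (auto simp: eventually_at_filter assms(2))
  hence "Lim (at x within \<Omega>) (dpartial es v) = w x" using nt by (intro tendsto_Lim) auto
  thus ?thesis using False by (simp add: cl_partial_def)
qed

lemma cl_partial_Nil:
  assumes "continuous_on (closure \<Omega>) v" "x \<in> closure \<Omega>"
  shows "cl_partial \<Omega> [] v x = v x"
  using cl_partial_limit[OF assms(1) _ assms(2), of "[]" v] by simp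

lemma smooth_closure_bounded:
  assumes "smooth_closure (\<lambda>_. 1) k \<Omega> v" "bounded \<Omega>"
  shows "\<exists>M\<ge>0. \<forall>es x. set es \<subseteq> Basis \<and> length es \<le> k \<and> x \<in> closure \<Omega> \<longrightarrow> \<bar>cl_partial \<Omega> es v x\<bar> \<le> M"
proof -
  define E where "E = {es :: 'a list. set es \<subseteq> Basis \<and> length es \<le> k}"
  have fin: "finite E" unfolding E_def by (rule finite_lists_length_le) simp
  have "\<forall>es\<in>E. \<exists>M\<ge>0. \<forall>x\<in>closure \<Omega>. \<bar>cl_partial \<Omega> es v x\<bar> \<le> M"
  proof
    fix es assume "es \<in> E"
    hence "continuous_on (closure \<Omega>) (cl_partial \<Omega> es v)"
      using smooth_closure_continuous[OF assms(1)] by (simp add: E_def)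
    hence "compact (cl_partial \<Omega> es v ` closure \<Omega>)"
      using assms(2) by (intro compact_continuous_image) (auto simp: compact_closure)
    hence "bounded (cl_partial \<Omega> es v ` closure \<Omega>)" by (rule compact_imp_bounded)
    then obtain M where "\<forall>x\<in>closure \<Omega>. \<bar>cl_partial \<Omega> es v x\<bar> \<le> M" unfolding bounded_iff by auto
    thus "\<exists>M\<ge>0. \<forall>x\<in>closure \<Omega>. \<bar>cl_partial \<Omega> es v x\<bar> \<le> M"
      by (intro exI[of _ "\<bar>M\<bar>"]) force
  qed
  then obtain M where M: "\<And>es. es \<in> E \<Longrightarrow> M es \<ge> 0 \<and> (\<forall>x\<in>closure \<Omega>. \<bar>cl_partial \<Omega> es v x\<bar> \<le> M es)" by metis
  have "M es \<le> sum M E" if "es \<in> E" for es using that fin M by (intro member_le_sum) auto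
  hence "\<bar>cl_partial \<Omega> es v x\<bar> \<le> sum M E" if "es \<in> E" "x \<in> closure \<Omega>" for es x
    using M that by (meson order_trans)
  moreover have "sum M E \<ge> 0" using M by (simp add: sum_nonneg)
  ultimately show ?thesis unfolding E_def by blast
qed

text \<open>Both orders of differentiation extend the same interior function continuously.\<close>

lemma cl_partial_swap:
  assumes "open \<Omega>" "smooth_closure (\<lambda>_. 1) k \<Omega> v" "x \<in> closure \<Omega>"
  shows "swap_invariant k (\<lambda>es. cl_partial \<Omega> es v x)"
  unfolding swap_invariant_def
proof (intro allI impI)
  fix xs :: "'a list" and e f ys
  assume es: "set (xs @ e # f # ys) \<subseteq> Basis" "length (xs @ e # f # ys) \<le> k"
  have c: "continuous_on (closure \<Omega>) (cl_partial \<Omega> (xs @ f # e # ys) v)"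
    using es by (intro smooth_closure_continuous[OF assms(2)]) auto
  show "cl_partial \<Omega> (xs @ e # f # ys) v x = cl_partial \<Omega> (xs @ f # e # ys) v x"
    by (rule cl_partial_limit[OF c _ assms(3)])
      (simp add: cl_partial_inside dpartial_swap[OF assms(1) smooth_closure_Ck[OF assms(2)] _ es])
qed

section \<open>Remainder estimates along three segments\<close>

text \<open>One shift \<open>w\<close> serves both end points, so the middle segment is a translate
  of the segment from \<open>p\<close> to \<open>q\<close>, and the whole path has length comparable
  to \<open>dist p q\<close>.\<close>

definition three_segment :: "'a::real_normed_vector set \<Rightarrow> real \<Rightarrow> 'a \<Rightarrow> 'a \<Rightarrow> bool" where
  "three_segment \<Omega> L p q \<longleftrightarrow> (\<exists>w. norm w \<le> L * dist p q \<and> closed_segment p (p + w) \<subseteq> \<Omega> \<and>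
     closed_segment (p + w) (q + w) \<subseteq> \<Omega> \<and> closed_segment (q + w) q \<subseteq> \<Omega>)"

text \<open>The derivatives of the remainder at \<open>p\<close> vanish at \<open>p\<close> up to order \<open>m\<close>; integrating downwards from the
  bounded order \<open>m + 1\<close> along each of the three segments keeps the right powers of \<open>norm (q - p)\<close>.\<close>

lemma taylor_estimate_inside:
  fixes p q :: "'a::euclidean_space" and M L :: real
  assumes "open \<Omega>" and v: "Ck (Suc m) \<Omega> v"
    and M: "\<And>es x. set es \<subseteq> Basis \<Longrightarrow> length es = Suc m \<Longrightarrow> x \<in> \<Omega> \<Longrightarrow> \<bar>dpartial es v x\<bar> \<le> M" "M \<ge> 0"
    and L: "L \<ge> 0"
    and pq: "p \<in> \<Omega>" "q \<in> \<Omega>" "three_segment \<Omega> L p q"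
    and es: "set es \<subseteq> Basis" "length es \<le> m"
  shows "\<bar>dpartial es v q - taylor (m - length es) (\<lambda>fs. dpartial fs v p) es (q - p)\<bar>
    \<le> M * (1 + DIM('a) * L) ^ Suc m * (1 + DIM('a) * (1 :: real)) ^ Suc m * (1 + DIM('a) * L) ^ Suc m
       * norm (q - p) ^ (Suc m - length es)"
proof -
  define J where "J = (\<lambda>fs. dpartial fs v p)"
  \<comment> \<open>A Taylor part of degree \<open>m - length es\<close> remains only up to order
    \<open>m\<close>. Differentiating once more removes it, so at order \<open>m + 1\<close> the
    remainder is the derivative of \<open>v\<close> itself.\<close>
  define R where "R = (\<lambda>es y. if length es \<le> m then dpartial es v y - taylor (m - length es) J es (y - p)
     else dpartial es v y)"
  define l where "l = norm (q - p)"
  obtain w where w: "norm w \<le> L * l" "closed_segment p (p + w) \<subseteq> \<Omega>"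
     "closed_segment (p + w) (q + w) \<subseteq> \<Omega>" "closed_segment (q + w) q \<subseteq> \<Omega>"
    using pq(3) unfolding three_segment_def l_def by (auto simp: dist_norm norm_minus_commute)
  have J: "swap_invariant (Suc m) J"
    unfolding swap_invariant_def J_def using dpartial_swap[OF assms(1) v pq(1)] by blast
  have D: "(R es has_derivative (\<lambda>h. \<Sum>e\<in>Basis. (h \<bullet> e) * R (e # es) y)) (at y)"
    if "set es \<subseteq> Basis" "length es < Suc m" "y \<in> \<Omega>" for es y
  proof (cases "length es = m")
    case True
    hence "R es = (\<lambda>y. dpartial es v y - J es)" "\<And>e. R (e # es) y = dpartial (e # es) v y"
      by (auto simp: R_def)
    thus ?thesis using Ck_has_derivative[OF assms(1) v that]
      by (auto intro!: derivative_eq_intros simp del: dpartial.simps)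
  next
    case False
    define n where "n = m - Suc (length es)"
    have n: "m - length es = Suc n" "Suc (length es) \<le> m" using that False by (auto simp: n_def)
    have R: "R es = (\<lambda>y. dpartial es v y - taylor (Suc n) J es (y - p))"
      "\<And>e. R (e # es) y = dpartial (e # es) v y - taylor n J (e # es) (y - p)"
      using n by (auto simp: R_def n_def)
    have T: "(taylor (Suc n) J es has_derivative (\<lambda>k. \<Sum>e\<in>Basis. (k \<bullet> e) * taylor n J (e # es) (y - p))) (at (y - p))"
      using n that by (intro taylor_has_derivative[OF J]) auto
    have "((\<lambda>y. taylor (Suc n) J es (y - p)) has_derivative
        (\<lambda>k. \<Sum>e\<in>Basis. (k \<bullet> e) * taylor n J (e # es) (y - p))) (at y)"
      by (rule has_derivative_compose[where f = "\<lambda>y. y - p" and f' = "\<lambda>k. k" and g = "taylor (Suc n) J es"])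
        (auto intro!: derivative_eq_intros T)
    from has_derivative_diff[OF Ck_has_derivative[OF assms(1) v that] this]
    show ?thesis unfolding R
      by (simp add: right_diff_distrib sum_subtractf del: dpartial.simps)
  qed
  have top: "\<bar>R es y\<bar> \<le> M" if "set es \<subseteq> Basis" "length es = Suc m" "y \<in> \<Omega>" for es y
    using M(1)[OF that] that by (simp add: R_def)
  have l: "l \<ge> 0" by (simp add: l_def)
  \<comment> \<open>Bounds after the first and the second segment. The middle one has length exactly
    \<open>l\<close>, hence its factor with \<open>\<kappa> = 1\<close>.\<close>
  define A1 where "A1 = M * (1 + DIM('a) * L) ^ Suc m"
  define A2 where "A2 = A1 * (1 + DIM('a) * (1 :: real)) ^ Suc m"
  have q1: "(1 + DIM('a) * L) ^ Suc m \<ge> 1" using L by (intro one_le_power) simp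
  have q2: "(1 + DIM('a) * (1 :: real)) ^ Suc m \<ge> 1" by (intro one_le_power) simp
  have A1: "M \<le> A1" unfolding A1_def using mult_left_mono[OF q1 M(2)] by simp
  have A2: "A1 \<le> A2" unfolding A2_def using mult_left_mono[OF q2, of A1] A1 M(2) by simp
  have R1: "\<bar>R es y\<bar> \<le> A1 * l ^ (Suc m - length es)"
    if "set es \<subseteq> Basis" "length es \<le> Suc m" "y \<in> closed_segment p (p + w)" for es y
    unfolding A1_def
  proof (rule segment_remainder[where a = p and b = "p + w" and m = "Suc m" and R = R])
    fix es :: "'a list" assume e: "set es \<subseteq> Basis" "length es \<le> Suc m"
    show "\<bar>R es p\<bar> \<le> M * l ^ (Suc m - length es)"
    proof (cases "length es \<le> m")
      case True thus ?thesis using l M(2) by (simp add: R_def J_def)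
    next
      case False
      thus ?thesis using top[OF e(1) _ pq(1)] e by simp
    qed
  qed (use w that l L M(2) D top in auto)
  have R2: "\<bar>R es y\<bar> \<le> A2 * l ^ (Suc m - length es)"
    if "set es \<subseteq> Basis" "length es \<le> Suc m" "y \<in> closed_segment (p + w) (q + w)" for es y
    unfolding A2_def
  proof (rule segment_remainder[where a = "p + w" and b = "q + w" and m = "Suc m" and R = R])
    show "norm (q + w - (p + w)) \<le> 1 * l" by (simp add: l_def)
    show "\<bar>R es (p + w)\<bar> \<le> A1 * l ^ (Suc m - length es)" if "set es \<subseteq> Basis" "length es \<le> Suc m" for es
      using R1 that by simp
    show "\<bar>R es y\<bar> \<le> A1" if "set es \<subseteq> Basis" "length es = Suc m" "y \<in> closed_segment (p + w) (q + w)" for es y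
      using top[of es y] that w(3) A1 by auto
  qed (use that w l D A1 M(2) in auto)
  have "\<bar>R es q\<bar> \<le> A2 * (1 + DIM('a) * L) ^ Suc m * l ^ (Suc m - length es)"
  proof (rule segment_remainder[where a = "q + w" and b = "q" and m = "Suc m" and R = R])
    show "norm (q - (q + w)) \<le> L * l" using w by simp
    show "\<bar>R es (q + w)\<bar> \<le> A2 * l ^ (Suc m - length es)" if "set es \<subseteq> Basis" "length es \<le> Suc m" for es
      using R2 that by simp
    show "\<bar>R es y\<bar> \<le> A2" if "set es \<subseteq> Basis" "length es = Suc m" "y \<in> closed_segment (q + w) q" for es y
      using top[of es y] that w(4) A1 A2 by auto
  qed (use es w l L D A1 A2 M(2) in auto)
  thus ?thesis using es by (simp add: R_def J_def A2_def A1_def l_def)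
qed

text \<open>The interior constant involves only \<open>L\<close> and a bound for the derivatives of
  order \<open>Suc m\<close>, so the estimate passes to limits of interior points.\<close>

lemma taylor_estimate_closure:
  fixes \<Omega> :: "'a::euclidean_space set" and L \<delta> :: real
  assumes "open \<Omega>" "bounded \<Omega>" and v: "smooth_closure (\<lambda>_. 1) (Suc m) \<Omega> v"
    and L: "L \<ge> 0"
    and path: "\<And>p q. p \<in> \<Omega> \<Longrightarrow> q \<in> \<Omega> \<Longrightarrow> dist p q < \<delta> \<Longrightarrow> three_segment \<Omega> L p q"
  shows "\<exists>K\<ge>0. \<forall>p\<in>closure \<Omega>. \<forall>q\<in>closure \<Omega>. \<forall>es. dist p q < \<delta> \<and> set es \<subseteq> Basis \<and> length es \<le> m \<longrightarrow>
     \<bar>cl_partial \<Omega> es v q - taylor (m - length es) (\<lambda>fs. cl_partial \<Omega> fs v p) es (q - p)\<bar>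
       \<le> K * norm (q - p) ^ (Suc m - length es)"
proof -
  obtain M where M: "M \<ge> 0" "\<And>es x. set es \<subseteq> Basis \<Longrightarrow> length es \<le> Suc m \<Longrightarrow> x \<in> closure \<Omega> \<Longrightarrow> \<bar>cl_partial \<Omega> es v x\<bar> \<le> M"
    using smooth_closure_bounded[OF v assms(2)] by blast
  have M': "\<bar>dpartial es v x\<bar> \<le> M" if "set es \<subseteq> Basis" "length es = Suc m" "x \<in> \<Omega>" for es x
    using M(2)[of es x] that closure_subset[of \<Omega>] by (auto simp: cl_partial_inside)
  define K where "K = M * (1 + DIM('a) * L) ^ Suc m * (1 + DIM('a) * (1 :: real)) ^ Suc m * (1 + DIM('a) * L) ^ Suc m"
  have K: "K \<ge> 0" using M L by (simp add: K_def)
  show ?thesis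
  proof (intro exI[of _ K] conjI K ballI allI impI; elim conjE)
    fix p q and es :: "'a list" assume p: "p \<in> closure \<Omega>" and q: "q \<in> closure \<Omega>" and d: "dist p q < \<delta>"
      and es: "set es \<subseteq> Basis" "length es \<le> m"
    obtain P where P: "\<And>n. P n \<in> \<Omega>" "P \<longlonglongrightarrow> p" using p unfolding closure_sequential by blast
    obtain Q where Q: "\<And>n. Q n \<in> \<Omega>" "Q \<longlonglongrightarrow> q" using q unfolding closure_sequential by blast
    have "(\<lambda>n. dist (P n) (Q n)) \<longlonglongrightarrow> dist p q" using P Q by (intro tendsto_intros)
    hence ev: "eventually (\<lambda>n. dist (P n) (Q n) < \<delta>) sequentially" using d order_tendstoD(2) by blast
    have lim: "(\<lambda>n. dpartial fs v (X n)) \<longlonglongrightarrow> cl_partial \<Omega> fs v x"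
      if "set fs \<subseteq> Basis" "length fs \<le> m" "\<And>n. X n \<in> \<Omega>" "X \<longlonglongrightarrow> x" "x \<in> closure \<Omega>" for fs X x
    proof -
      have c: "continuous_on (closure \<Omega>) (cl_partial \<Omega> fs v)"
        using that by (intro smooth_closure_continuous[OF v]) auto
      have "X n \<in> closure \<Omega>" for n using that(3) closure_subset by blast
      hence "(\<lambda>n. cl_partial \<Omega> fs v (X n)) \<longlonglongrightarrow> cl_partial \<Omega> fs v x"
        by (intro continuous_on_tendsto_compose[OF c that(4,5)] always_eventually) blast
      thus ?thesis using that(3) by (simp add: cl_partial_inside)
    qed
    show "\<bar>cl_partial \<Omega> es v q - taylor (m - length es) (\<lambda>fs. cl_partial \<Omega> fs v p) es (q - p)\<bar>
       \<le> K * norm (q - p) ^ (Suc m - length es)"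
    proof (rule tendsto_le[OF sequentially_bot])
      show "(\<lambda>n. \<bar>dpartial es v (Q n) - taylor (m - length es) (\<lambda>fs. dpartial fs v (P n)) es (Q n - P n)\<bar>)
        \<longlonglongrightarrow> \<bar>cl_partial \<Omega> es v q - taylor (m - length es) (\<lambda>fs. cl_partial \<Omega> fs v p) es (q - p)\<bar>"
        using lim[OF es Q q] lim[OF _ _ P p] P(2) Q(2) es
        by (intro tendsto_rabs tendsto_diff taylor_tendsto[where m = m]) auto
      show "(\<lambda>n. K * norm (Q n - P n) ^ (Suc m - length es)) \<longlonglongrightarrow> K * norm (q - p) ^ (Suc m - length es)"
        using P(2) Q(2) by (intro tendsto_intros)
      show "\<forall>\<^sub>F n in sequentially. \<bar>dpartial es v (Q n) - taylor (m - length es) (\<lambda>fs. dpartial fs v (P n)) es (Q n - P n)\<bar>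
         \<le> K * norm (Q n - P n) ^ (Suc m - length es)"
        using ev
      proof eventually_elim
        case (elim n)
        show ?case unfolding K_def
          using taylor_estimate_inside[OF assms(1) smooth_closure_Ck[OF v] M' M(1) L P(1) Q(1) path[OF P(1) Q(1) elim] es] .
      qed
    qed
  qed
qed

section \<open>From local constants to uniform ones\<close>

text \<open>A Lebesgue number argument: half balls cover the compact set, and
  \<open>\<delta>\<close> is at most half of each selected radius, so two close points share one of
  the full balls. The sum of the local constants dominates each of them, and monotonicity in the
  constant does the rest. With \<open>q = p\<close> this also yields uniform bounds at single
  points.\<close>

lemma compact_local_to_global:
  fixes P :: "real \<Rightarrow> 'a::metric_space \<Rightarrow> 'a \<Rightarrow> bool"
  assumes "compact K" "S \<subseteq> K"
    and mono: "\<And>C C' p q. p \<in> S \<Longrightarrow> q \<in> S \<Longrightarrow> P C p q \<Longrightarrow> 0 < C \<Longrightarrow> C \<le> C' \<Longrightarrow> P C' p q"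
    and loc: "\<And>z. z \<in> K \<Longrightarrow> \<exists>\<rho>>0. \<exists>C>0. \<forall>p\<in>S \<inter> ball z \<rho>. \<forall>q\<in>S \<inter> ball z \<rho>. P C p q"
  shows "\<exists>\<delta>>0. \<exists>C>0. \<forall>p\<in>S. \<forall>q\<in>S. dist p q < \<delta> \<longrightarrow> P C p q"
proof -
  obtain \<rho> c where rc: "\<And>z. z \<in> K \<Longrightarrow> \<rho> z > 0 \<and> c z > 0 \<and>
      (\<forall>p\<in>S \<inter> ball z (\<rho> z). \<forall>q\<in>S \<inter> ball z (\<rho> z). P (c z) p q)"
    using loc by metis
  have "K \<subseteq> (\<Union>z\<in>K. ball z (\<rho> z / 2))" using rc by force
  then obtain D where D: "D \<subseteq> K" "finite D" "K \<subseteq> (\<Union>z\<in>D. ball z (\<rho> z / 2))"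
    using compactE_image[OF assms(1), of K "\<lambda>z. ball z (\<rho> z / 2)"] by auto
  define C where "C = 1 + sum c D"
  have cC: "c z \<le> C" if "z \<in> D" for z
    using member_le_sum[of z D c] D rc that by (force simp: C_def less_imp_le)
  have "sum c D \<ge> 0" using rc D by (intro sum_nonneg) (auto simp: less_imp_le subset_iff)
  hence C: "C > 0" by (simp add: C_def)
  \<comment> \<open>The inserted \<open>1\<close> keeps the set nonempty when the finite cover is
    empty.\<close>
  define \<delta> where "\<delta> = Min (insert 1 (\<rho> ` D)) / 2"
  have \<delta>: "\<delta> > 0" using D rc by (auto simp: \<delta>_def)
  have \<delta>': "\<delta> \<le> \<rho> z / 2" if "z \<in> D" for z using that D(2) by (simp add: \<delta>_def)
  have "\<forall>p\<in>S. \<forall>q\<in>S. dist p q < \<delta> \<longrightarrow> P C p q"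
  proof (intro ballI impI)
    fix p q assume p: "p \<in> S" and q: "q \<in> S" and d: "dist p q < \<delta>"
    obtain z where z: "z \<in> D" "dist z p < \<rho> z / 2" using D(3) p assms(2) by force
    have "dist z q \<le> dist z p + dist p q" by (rule dist_triangle)
    hence "dist z q < \<rho> z" using z d \<delta>'[OF z(1)] by linarith
    moreover have "dist z p < \<rho> z" using z zero_le_dist[of z p] by linarith
    ultimately have "P (c z) p q" using rc[of z] z D p q by auto
    thus "P C p q" using mono[OF p q _ _ cC[OF z(1)]] rc z D by blast
  qed
  with \<delta> C show ?thesis by blast
qed

section \<open>Geometry of the boundary\<close>

lemma Ck_Lipschitz:
  fixes M :: real
  assumes "open \<Omega>" "convex \<Omega>" "Ck k \<Omega> v" "set es \<subseteq> Basis" "length es < k"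
    and M: "\<And>e y. e \<in> Basis \<Longrightarrow> y \<in> \<Omega> \<Longrightarrow> \<bar>dpartial (e # es) v y\<bar> \<le> M"
    and "x \<in> \<Omega>" "y \<in> \<Omega>"
  shows "\<bar>dpartial es v x - dpartial es v y\<bar> \<le> DIM('a) * M * norm (x - y :: 'a::euclidean_space)"
proof -
  have "norm (dpartial es v x - dpartial es v y) \<le> DIM('a) * M * norm (x - y)"
  proof (rule differentiable_bound[OF assms(2) _ _ assms(7,8)])
    fix z assume z: "z \<in> \<Omega>"
    show "(dpartial es v has_derivative (\<lambda>h. \<Sum>e\<in>Basis. (h \<bullet> e) * dpartial (e # es) v z)) (at z within \<Omega>)"
      by (rule has_derivative_at_withinI[OF Ck_has_derivative[OF assms(1,3,4,5) z]])
    show "onorm (\<lambda>h. \<Sum>e\<in>Basis. (h \<bullet> e) * dpartial (e # es) v z) \<le> DIM('a) * M"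
    proof (rule onorm_le)
      fix h :: 'a
      have "norm (\<Sum>e\<in>Basis. (h \<bullet> e) * dpartial (e # es) v z) \<le> (\<Sum>e\<in>(Basis :: 'a set). norm h * M)"
        using M[OF _ z] Basis_le_norm[of _ h]
        by (intro sum_norm_le) (auto simp: abs_mult mult_mono simp del: dpartial.simps)
      thus "norm (\<Sum>e\<in>Basis. (h \<bullet> e) * dpartial (e # es) v z) \<le> DIM('a) * M * norm h" by (simp add: mult_ac)
    qed
  qed
  thus ?thesis by simp
qed

lemma graph_chart_gradient:
  fixes G :: "'a::euclidean_space set"
  assumes "graph_chart k \<epsilon> G z e f r" "2 \<le> k"
  obtains g K where "K > 0"
    "\<And>y. y \<in> ball z r \<Longrightarrow> (f has_derivative (\<lambda>h. h \<bullet> g y)) (at y)"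
    "\<And>y y'. y \<in> ball z r \<Longrightarrow> y' \<in> ball z r \<Longrightarrow> norm (g y - g y') \<le> K * norm (y - y')"
    "\<And>y y'. y \<in> ball z r \<Longrightarrow> y' \<in> ball z r \<Longrightarrow> \<bar>f y - f y'\<bar> \<le> K * norm (y - y')"
    "\<And>y. y \<in> ball z r \<Longrightarrow> g y \<bullet> e = 0"
proof -
  have s: "smooth_closure (\<lambda>_. 1) k (ball z r) f" and inv: "\<And>y s. f (y + s *\<^sub>R e) = f y"
    using assms(1) unfolding graph_chart_def holder_space_def by auto
  note C = smooth_closure_Ck[OF s]
  obtain M where M: "M \<ge> 0"
    "\<And>es x. set es \<subseteq> Basis \<Longrightarrow> length es \<le> k \<Longrightarrow> x \<in> closure (ball z r) \<Longrightarrow> \<bar>cl_partial (ball z r) es f x\<bar> \<le> M"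
    using smooth_closure_bounded[OF s] by blast
  have M': "\<bar>dpartial es f x\<bar> \<le> M" if "set es \<subseteq> Basis" "length es \<le> k" "x \<in> ball z r" for es x
    using M(2)[OF that(1,2), of x] that(3) closure_subset[of "ball z r"] by (auto simp: cl_partial_inside)
  define g where "g = (\<lambda>y. \<Sum>i\<in>Basis. dpartial [i] f y *\<^sub>R i)"
  define N where "N = real DIM('a)"
  have N: "N \<ge> 1" using DIM_positive[where 'a='a] by (simp add: N_def Suc_leI)
  \<comment> \<open>The first summand serves the gradient, the second \<open>f\<close> itself, and
    \<open>1\<close> makes the constant positive.\<close>
  define K where "K = N * (N * M) + N * M + 1"
  have D: "(f has_derivative (\<lambda>h. h \<bullet> g y)) (at y)" if "y \<in> ball z r" for y
    using Ck_has_derivative[OF _ C _ _ that, of "[]"] assms(2)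
    by (simp add: g_def inner_sum_right mult_ac del: dpartial.simps(2))
  show ?thesis
  proof (rule that[of K g])
    show "K > 0" using N M by (simp add: K_def add_nonneg_pos)
    show "(f has_derivative (\<lambda>h. h \<bullet> g y)) (at y)" if "y \<in> ball z r" for y using D that .
    show "norm (g y - g y') \<le> K * norm (y - y')" if "y \<in> ball z r" "y' \<in> ball z r" for y y'
    proof -
      have "norm (g y - g y') \<le> (\<Sum>i\<in>(Basis::'a set). N * M * norm (y - y'))"
        unfolding g_def sum_subtractf[symmetric] scaleR_diff_left[symmetric]
      proof (rule sum_norm_le)
        fix i :: 'a assume i: "i \<in> Basis"
        have "\<bar>dpartial [i] f y - dpartial [i] f y'\<bar> \<le> N * M * norm (y - y')"
          unfolding N_def using that i assms(2) by (intro Ck_Lipschitz[OF _ _ C] M') auto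
        thus "norm ((dpartial [i] f y - dpartial [i] f y') *\<^sub>R i) \<le> N * M * norm (y - y')"
          using i by simp
      qed
      also have "\<dots> = N * (N * M) * norm (y - y')" by (simp add: N_def)
      also have "\<dots> \<le> K * norm (y - y')" using N M by (intro mult_right_mono) (auto simp: K_def)
      finally show ?thesis .
    qed
    show "\<bar>f y - f y'\<bar> \<le> K * norm (y - y')" if "y \<in> ball z r" "y' \<in> ball z r" for y y'
    proof -
      have "\<bar>dpartial [] f y - dpartial [] f y'\<bar> \<le> N * M * norm (y - y')"
        unfolding N_def using that assms(2) by (intro Ck_Lipschitz[OF _ _ C] M') auto
      also have "\<dots> \<le> K * norm (y - y')" using N M by (intro mult_right_mono) (auto simp: K_def)
      finally show ?thesis by simp
    qed
    show "g y \<bullet> e = 0" if "y \<in> ball z r" for y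
    proof -
      have "((\<lambda>s. f (y + s *\<^sub>R e)) has_derivative (\<lambda>s. (s *\<^sub>R e) \<bullet> g y)) (at (0::real))"
        using D[OF that] by (intro has_derivative_compose[where g = f and f' = "\<lambda>s. s *\<^sub>R e"])
          (auto intro!: derivative_eq_intros)
      moreover have "((\<lambda>s. f (y + s *\<^sub>R e)) has_derivative (\<lambda>s. 0)) (at (0::real))"
        unfolding inv by simp
      ultimately have "(\<lambda>s. (s *\<^sub>R e) \<bullet> g y) = (\<lambda>s. 0 :: real)" by (rule has_derivative_unique)
      from fun_cong[OF this, of 1] show ?thesis by (simp add: inner_commute)
    qed
  qed
qed

section \<open>Geometry of a single chart\<close>

text \<open>The first-order content of a graph chart: \<open>g\<close> is the gradient of
  \<open>f\<close>, orthogonal to the axis \<open>e\<close> because \<open>f\<close> is constant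
  along \<open>e\<close>, and one constant \<open>K\<close> is a Lipschitz constant of both.\<close>

locale chart =
  fixes G :: "'a::euclidean_space set" and z e :: 'a and f :: "'a \<Rightarrow> real" and g :: "'a \<Rightarrow> 'a" and r K :: real
  assumes G: "open G"
    and e: "norm e = 1" and r: "r > 0" and inv: "\<And>y s. f (y + s *\<^sub>R e) = f y"
    and above: "\<And>y. y \<in> ball z r \<Longrightarrow> y \<in> G \<longleftrightarrow> f y < y \<bullet> e"
    and K: "K > 0"
    and D: "\<And>y. y \<in> ball z r \<Longrightarrow> (f has_derivative (\<lambda>h. h \<bullet> g y)) (at y)"
    and Lg: "\<And>y y'. y \<in> ball z r \<Longrightarrow> y' \<in> ball z r \<Longrightarrow> norm (g y - g y') \<le> K * norm (y - y')"
    and Lf: "\<And>y y'. y \<in> ball z r \<Longrightarrow> y' \<in> ball z r \<Longrightarrow> \<bar>f y - f y'\<bar> \<le> K * norm (y - y')"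
    and ge: "\<And>y. y \<in> ball z r \<Longrightarrow> g y \<bullet> e = 0"
begin

lemma ee: "e \<bullet> e = 1"
  using e by (simp add: dot_square_norm)

lemma quadratic_bound:
  assumes "y \<in> ball z r" "y + h \<in> ball z r"
  shows "\<bar>f (y + h) - f y - h \<bullet> g y\<bar> \<le> K * (norm h)\<^sup>2"
proof -
  have "\<bar>f (y + 1 *\<^sub>R h) - f (y + 0 *\<^sub>R h) - 1 * (h \<bullet> g y)\<bar> \<le> K * (norm h)\<^sup>2 * \<bar>1\<bar>"
  proof (rule line_bound[where g = "\<lambda>s. f (y + s *\<^sub>R h)" and g' = "\<lambda>s. h \<bullet> g (y + s *\<^sub>R h)"])
    fix s :: real assume "s \<in> closed_segment 0 1"
    hence s: "0 \<le> s" "s \<le> 1" by (auto simp: closed_segment_eq_real_ivl)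
    have "(1 - s) *\<^sub>R y + s *\<^sub>R (y + h) \<in> ball z r"
      using assms s by (intro convexD[OF convex_ball]) auto
    hence b: "y + s *\<^sub>R h \<in> ball z r" by (simp add: algebra_simps)
    have "((\<lambda>s. f (y + s *\<^sub>R h)) has_derivative (\<lambda>t. (t *\<^sub>R h) \<bullet> g (y + s *\<^sub>R h))) (at s)"
      using D[OF b] by (intro has_derivative_compose[where g = f and f' = "\<lambda>s. s *\<^sub>R h"])
          (auto intro!: derivative_eq_intros)
    thus "((\<lambda>s. f (y + s *\<^sub>R h)) has_real_derivative h \<bullet> g (y + s *\<^sub>R h)) (at s)"
      by (simp add: has_field_derivative_def mult_commute_abs)
    have "\<bar>h \<bullet> g (y + s *\<^sub>R h) - h \<bullet> g y\<bar> \<le> norm h * norm (g (y + s *\<^sub>R h) - g y)"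
      unfolding inner_diff_right[symmetric] by (rule Cauchy_Schwarz_ineq2)
    also have "\<dots> \<le> norm h * (K * norm (s *\<^sub>R h))"
      using Lg[OF b assms(1)] by (intro mult_left_mono) auto
    also have "\<dots> = s * (K * (norm h)\<^sup>2)" using s by (simp add: power2_eq_square)
    also have "\<dots> \<le> 1 * (K * (norm h)\<^sup>2)" using s K by (intro mult_right_mono) auto
    finally show "\<bar>h \<bullet> g (y + s *\<^sub>R h) - h \<bullet> g y\<bar> \<le> K * (norm h)\<^sup>2" by simp
  qed
  thus ?thesis by simp
qed

lemma f_continuous: "continuous_on (ball z r) f"
  using D by (meson continuous_on_eq_continuous_at has_derivative_continuous open_ball)

text \<open>Points strictly below the graph have a neighbourhood that misses \<open>G\<close>;
  points on the graph are approached from \<open>G\<close> by moving up along \<open>e\<close>,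
  which leaves \<open>f\<close> unchanged.\<close>

lemma frontier_iff:
  assumes y: "y \<in> ball z r"
  shows "y \<in> frontier G \<longleftrightarrow> f y = y \<bullet> e"
proof -
  have fr: "y \<in> frontier G \<longleftrightarrow> y \<in> closure G \<and> y \<notin> G"
    using G by (simp add: frontier_def interior_open)
  have o: "open {y \<in> ball z r. y \<bullet> e < f y}"
  proof -
    have "continuous_on (ball z r) (\<lambda>y. f y - y \<bullet> e)" by (intro continuous_intros f_continuous)
    hence "open (ball z r \<inter> (\<lambda>y. f y - y \<bullet> e) -` {0<..})"
      by (rule continuous_open_preimage) auto
    moreover have "ball z r \<inter> (\<lambda>y. f y - y \<bullet> e) -` {0<..} = {y \<in> ball z r. y \<bullet> e < f y}" by auto
    ultimately show ?thesis by simp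
  qed
  show ?thesis
  proof
    assume L: "y \<in> frontier G"
    hence "\<not> f y < y \<bullet> e" using fr above[OF y] by simp
    moreover have "\<not> y \<bullet> e < f y"
    proof
      assume "y \<bullet> e < f y"
      hence "y \<in> {y \<in> ball z r. y \<bullet> e < f y}" using y by simp
      moreover have "{y \<in> ball z r. y \<bullet> e < f y} \<inter> G = {}" using above by force
      ultimately have "y \<notin> closure G" using o open_Int_closure_eq_empty by blast
      thus False using L fr by simp
    qed
    ultimately show "f y = y \<bullet> e" by simp
  next
    assume R: "f y = y \<bullet> e"
    have "y \<in> closure G"
    proof (rule closure_approachable[THEN iffD2], intro allI impI)
      fix \<eta> :: real assume \<eta>: "\<eta> > 0"
      define s where "s = min \<eta> (r - dist z y) / 2"
      have s: "0 < s" "s < \<eta>" "s < r - dist z y" using \<eta> y by (auto simp: s_def)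
      have d: "dist (y + s *\<^sub>R e) y = s" using s e by (simp add: dist_norm)
      have "dist z (y + s *\<^sub>R e) \<le> dist z y + dist (y + s *\<^sub>R e) y"
        by (metis dist_triangle dist_commute)
      hence "y + s *\<^sub>R e \<in> ball z r" using d s by simp
      hence "y + s *\<^sub>R e \<in> G" using above inv R s ee by (simp add: inner_add_left)
      thus "\<exists>x\<in>G. dist x y < \<eta>" using d s by metis
    qed
    moreover have "y \<notin> G" using above[OF y] R by simp
    ultimately show "y \<in> frontier G" using fr by simp
  qed
qed

text \<open>Testing with the curves obtained by lifting lines orthogonal to \<open>e\<close> to the graph; outside a small
  interval the curve is set to the constant \<open>y\<close>, since it has to stay in the boundary for all times.\<close>

lemma orthogonal_to_curves:
  assumes y: "y \<in> ball z r" "y \<in> frontier G"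
    and v: "\<And>p w. p 0 = y \<Longrightarrow> (\<And>s. p s \<in> frontier G) \<Longrightarrow> (p has_vector_derivative w) (at (0::real)) \<Longrightarrow> v \<bullet> w = 0"
  shows "v = (v \<bullet> e) *\<^sub>R (e - g y)"
proof -
  have fy: "f y = y \<bullet> e" using frontier_iff y by simp
  \<comment> \<open>The vectors \<open>a + (a \<bullet> g y) *\<^sub>R e\<close> with
    \<open>a\<close> orthogonal to \<open>e\<close> are the tangent vectors of the graph at
    \<open>y\<close>.\<close>
  have tan: "v \<bullet> (a + (a \<bullet> g y) *\<^sub>R e) = 0" if a: "a \<bullet> e = 0" for a
  proof -
    define q where "q = (\<lambda>s. y + s *\<^sub>R a + (f (y + s *\<^sub>R a) - f y) *\<^sub>R e)"
    define B where "B = ball z r"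
    have fq: "((\<lambda>s. f (y + s *\<^sub>R a)) has_derivative (\<lambda>t. (t *\<^sub>R a) \<bullet> g y)) (at 0)"
      using D[OF y(1)] by (intro has_derivative_compose[where g = f and f' = "\<lambda>s. s *\<^sub>R a"])
          (auto intro!: derivative_eq_intros)
    have dq: "(q has_vector_derivative (a + (a \<bullet> g y) *\<^sub>R e)) (at 0)"
      unfolding has_vector_derivative_def q_def
      by (rule has_derivative_eq_rhs, (rule derivative_intros fq)+) (auto simp: algebra_simps)
    have "isCont q 0" using dq has_vector_derivative_continuous by blast
    hence "q \<midarrow>0\<rightarrow> q 0" by (simp add: isCont_def)
    moreover have "q 0 = y" by (simp add: q_def)
    ultimately have ev1: "eventually (\<lambda>s. q s \<in> B) (at 0)"
      using y(1) B_def topological_tendstoD open_ball by metis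
    have "((\<lambda>s. y + s *\<^sub>R a) \<longlongrightarrow> y + 0 *\<^sub>R a) (at (0::real))" by (intro tendsto_intros)
    hence "(\<lambda>s. y + s *\<^sub>R a) \<midarrow>0\<rightarrow> y" by simp
    hence ev2: "eventually (\<lambda>s. y + s *\<^sub>R a \<in> B) (at (0::real))"
      by (rule topological_tendstoD) (use y(1) in \<open>simp_all add: B_def\<close>)
    from eventually_conj[OF ev1 ev2] obtain d where d: "d > 0"
      "\<And>s. s \<noteq> 0 \<Longrightarrow> dist s 0 < d \<Longrightarrow> q s \<in> B \<and> y + s *\<^sub>R a \<in> B"
      unfolding eventually_at by blast
    define p where "p = (\<lambda>s. if \<bar>s\<bar> < d then q s else y)"
    have "p s \<in> frontier G" for s
    proof (cases "\<bar>s\<bar> < d \<and> s \<noteq> 0")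
      case True
      hence qs: "q s \<in> ball z r" using d(2)[of s] by (simp add: B_def dist_real_def)
      have "f (q s) = f (y + s *\<^sub>R a)" unfolding q_def using inv by simp
      also have "\<dots> = q s \<bullet> e" using a fy ee by (simp add: q_def inner_add_left)
      finally show ?thesis using frontier_iff[OF qs] True by (simp add: p_def)
    next
      case False thus ?thesis using y \<open>q 0 = y\<close> by (auto simp: p_def)
    qed
    moreover have "p 0 = y" using \<open>q 0 = y\<close> d by (simp add: p_def)
    moreover have "(p has_vector_derivative (a + (a \<bullet> g y) *\<^sub>R e)) (at 0)"
    proof (rule has_vector_derivative_transform_within_open[OF dq, of "ball 0 d"])
      show "\<And>s. s \<in> ball 0 d \<Longrightarrow> q s = p s" by (simp add: p_def)
    qed (use d in auto)
    ultimately show ?thesis using v by blast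
  qed
  \<comment> \<open>For \<open>a\<close> orthogonal to \<open>e\<close>, the relation
    \<open>tan\<close> says that \<open>m \<bullet> a = 0\<close>. Hence \<open>m\<close> is a
    multiple of \<open>e\<close>, and solving for \<open>v\<close> gives the claim.\<close>
  define m where "m = v + (v \<bullet> e) *\<^sub>R g y"
  define a where "a = m - (m \<bullet> e) *\<^sub>R e"
  have ae: "a \<bullet> e = 0" using ee by (simp add: a_def inner_diff_left)
  have me: "m \<bullet> e = v \<bullet> e" using ge[OF y(1)] by (simp add: m_def inner_add_left)
  have "m \<bullet> a = 0" using tan[OF ae] by (simp add: m_def algebra_simps inner_commute)
  moreover have "e \<bullet> a = 0" using ae by (simp add: inner_commute)
  moreover have "a \<bullet> a = (m - (m \<bullet> e) *\<^sub>R e) \<bullet> a" by (simp only: a_def)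
  ultimately have "a \<bullet> a = 0" by (simp add: inner_diff_left)
  hence "m = (v \<bullet> e) *\<^sub>R e" using me by (simp add: a_def)
  thus ?thesis by (simp add: m_def algebra_simps)
qed

lemma gradient_norm: "y \<in> ball z r \<Longrightarrow> norm (e - g y) \<ge> 1"
proof -
  assume y: "y \<in> ball z r"
  have "(e - g y) \<bullet> e = 1" using ge[OF y] ee by (simp add: inner_diff_left)
  moreover have "\<bar>(e - g y) \<bullet> e\<bar> \<le> norm (e - g y) * norm e" by (rule Cauchy_Schwarz_ineq2)
  ultimately show ?thesis using e by simp
qed

text \<open>Orthogonality to boundary curves determines \<open>n\<close> up to a factor
  \<open>c\<close>. A negative \<open>c\<close> would take short steps along \<open>n\<close> below
  the graph, against the requirement that \<open>n\<close> points into \<open>G\<close>.\<close>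

lemma normal_eq:
  assumes y: "y \<in> ball z r" "y \<in> frontier G" and n: "inward_unit_normal G y n"
  shows "n = (e - g y) /\<^sub>R norm (e - g y)"
proof -
  have n1: "norm n = 1" using n unfolding inward_unit_normal_def by blast
  define c where "c = n \<bullet> e"
  have nc: "n = c *\<^sub>R (e - g y)" unfolding c_def
    using n unfolding inward_unit_normal_def by (intro orthogonal_to_curves[OF y]) blast
  obtain d where d: "d > 0" "\<And>s. 0 < s \<Longrightarrow> s < d \<Longrightarrow> y + s *\<^sub>R n \<in> G"
    using n unfolding inward_unit_normal_def by auto
  have fy: "f y = y \<bullet> e" using frontier_iff y by simp
  have "c \<ge> 0"
  proof (rule ccontr)
    assume "\<not> c \<ge> 0"
    \<comment> \<open>For \<open>s\<close> below this bound the quadratic error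
      \<open>K s\<^sup>2\<close> is too small to compensate the descent
      \<open>- c s\<close>.\<close>
    define \<kappa> where "\<kappa> = - c / K"
    have \<kappa>: "\<kappa> > 0" using K \<open>\<not> c \<ge> 0\<close> by (simp add: \<kappa>_def divide_neg_pos)
    define s where "s = min (min d (r - dist z y)) \<kappa> / 2"
    have s: "0 < s" "s < d" "s < r - dist z y" "s < \<kappa>"
      using d y \<kappa> by (auto simp: s_def)
    have "dist z (y + s *\<^sub>R n) \<le> dist z y + dist y (y + s *\<^sub>R n)" by (rule dist_triangle)
    hence b: "y + s *\<^sub>R n \<in> ball z r" using s n1 by (simp add: dist_norm)
    have "f (y + s *\<^sub>R n) < (y + s *\<^sub>R n) \<bullet> e" using above[OF b] d(2) s by simp
    moreover have "\<bar>f (y + s *\<^sub>R n) - f y - (s *\<^sub>R n) \<bullet> g y\<bar> \<le> K * (norm (s *\<^sub>R n))\<^sup>2"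
      by (rule quadratic_bound[OF y(1) b])
    ultimately have "s * (n \<bullet> g y) - K * s\<^sup>2 < s * (n \<bullet> e)"
      using n1 s fy by (simp add: inner_add_left)
    hence "s * (n \<bullet> (e - g y)) > - (K * s) * s" by (simp add: power2_eq_square inner_diff_right algebra_simps)
    hence "s * (- (n \<bullet> (e - g y))) < s * (K * s)" by (simp add: mult_ac)
    hence "- (n \<bullet> (e - g y)) < K * s" using s by (simp only: mult_less_cancel_left_pos)
    also have "K * s < - c" using s(4) K by (simp add: \<kappa>_def pos_less_minus_divide_eq mult.commute)
    finally have "c * 1 < c * (norm (e - g y))\<^sup>2"
      unfolding nc inner_scaleR_left power2_norm_eq_inner by simp
    moreover have "(norm (e - g y))\<^sup>2 \<ge> 1" using gradient_norm[OF y(1)] by simp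
    ultimately show False using \<open>\<not> c \<ge> 0\<close> mult_left_mono_neg[of 1 "(norm (e - g y))\<^sup>2" c] by linarith
  qed
  moreover have "\<bar>c\<bar> * norm (e - g y) = 1" using n1 nc by (metis norm_scaleR)
  ultimately have "c = inverse (norm (e - g y))"
    by (metis abs_of_nonneg inverse_unique mult.commute)
  thus ?thesis using nc by simp
qed

text \<open>Normalising vectors of norm at least 1 at most doubles their distance, by \<open>norm a
  *\<^sub>R (n - n') = (a - b) + (norm b - norm a) *\<^sub>R n'\<close>.\<close>

lemma normal_Lipschitz:
  assumes "y \<in> ball z r" "y \<in> frontier G" "inward_unit_normal G y n"
    and "y' \<in> ball z r" "y' \<in> frontier G" "inward_unit_normal G y' n'"
  shows "norm (n - n') \<le> 2 * K * norm (y - y')"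
proof -
  define a where "a = e - g y"
  define b where "b = e - g y'"
  have a: "norm a \<ge> 1" "n = a /\<^sub>R norm a"
    using gradient_norm normal_eq assms by (auto simp: a_def)
  have b: "norm b \<ge> 1" "n' = b /\<^sub>R norm b"
    using gradient_norm normal_eq assms by (auto simp: b_def)
  have ab: "norm (a - b) \<le> K * norm (y - y')" using Lg[OF assms(4,1)]
    by (simp add: a_def b_def norm_minus_commute)
  have an: "norm a *\<^sub>R n = a" "norm b *\<^sub>R n' = b"
  proof -
    have "norm a \<noteq> 0" "norm b \<noteq> 0" using a(1) b(1) by linarith+
    thus "norm a *\<^sub>R n = a" "norm b *\<^sub>R n' = b" unfolding a(2) b(2) by simp_all
  qed
  have "norm a *\<^sub>R (n - n') = (a - b) + (norm b - norm a) *\<^sub>R n'"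
    by (simp only: scaleR_diff_right scaleR_diff_left an) simp
  hence "norm a * norm (n - n') \<le> norm (a - b) + \<bar>norm b - norm a\<bar> * norm n'"
    by (metis norm_triangle_ineq norm_scaleR abs_norm_cancel)
  also have "norm n' = 1" using assms(6) unfolding inward_unit_normal_def by blast
  also have "\<bar>norm b - norm a\<bar> \<le> norm (a - b)" by (metis norm_minus_commute norm_triangle_ineq3)
  finally have "norm a * norm (n - n') \<le> 2 * norm (a - b)" by simp
  moreover have "1 * norm (n - n') \<le> norm a * norm (n - n')" using a by (intro mult_right_mono) auto
  ultimately show ?thesis using ab by simp
qed

text \<open>Along the normal the height above the graph grows at least like \<open>s\<close>, since
  \<open>n \<bullet> (e - g y) = norm (e - g y)\<close>, and the quadratic error is smaller than
  \<open>s\<close> when \<open>s * K < 1\<close>.\<close>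

lemma normal_points_inside:
  assumes "y \<in> ball z (r / 2)" "y \<in> frontier G" "inward_unit_normal G y n" "0 < s" "s < r / 2" "s * K < 1"
  shows "y + s *\<^sub>R n \<in> G"
proof -
  have y: "y \<in> ball z r" using assms(1) r by simp
  have n1: "norm n = 1" using assms(3) unfolding inward_unit_normal_def by blast
  have "dist z (y + s *\<^sub>R n) \<le> dist z y + dist y (y + s *\<^sub>R n)" by (rule dist_triangle)
  hence b: "y + s *\<^sub>R n \<in> ball z r" using assms n1 by (simp add: dist_norm)
  have fy: "f y = y \<bullet> e" using frontier_iff y assms by simp
  have "n \<bullet> (e - g y) = norm (e - g y)"
    unfolding normal_eq[OF y assms(2,3)]
    by (cases "e = g y") (simp_all add: dot_square_norm power2_eq_square)
  hence "n \<bullet> e - n \<bullet> g y \<ge> 1" using gradient_norm[OF y] by (simp add: inner_diff_right)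
  hence "s * (n \<bullet> e - n \<bullet> g y) \<ge> s * 1" using assms by (intro mult_left_mono) auto
  hence 1: "s \<le> s * (n \<bullet> e) - s * (n \<bullet> g y)" by (simp add: right_diff_distrib)
  have "s * (K * s) < s * 1" using assms by (intro mult_strict_left_mono) (auto simp: mult.commute)
  hence 2: "s * (K * s) < s" by simp
  have "\<bar>f (y + s *\<^sub>R n) - f y - (s *\<^sub>R n) \<bullet> g y\<bar> \<le> K * (norm (s *\<^sub>R n))\<^sup>2"
    by (rule quadratic_bound[OF y b])
  hence 3: "\<bar>f (y + s *\<^sub>R n) - f y - s * (n \<bullet> g y)\<bar> \<le> s * (K * s)"
    using n1 assms(4) by (simp add: power2_eq_square mult_ac)
  have "f (y + s *\<^sub>R n) < y \<bullet> e + s * (n \<bullet> e)" using 1 2 3 fy by linarith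
  hence "f (y + s *\<^sub>R n) < (y + s *\<^sub>R n) \<bullet> e" by (simp add: inner_add_left)
  thus ?thesis using above[OF b] by simp
qed

text \<open>The shift is \<open>K * d\<close> along \<open>e\<close>, with \<open>d\<close> the
  distance of the points. Vertical segments stay above the graph because \<open>f\<close> is
  constant along \<open>e\<close>; the lifted chord stays above it because \<open>f\<close> exceeds
  its linear interpolation by at most \<open>K * d\<close>.\<close>

lemma three_segment_near:
  assumes p: "p \<in> G" "p \<in> ball z (r / (2 + 2 * K))" and q: "q \<in> G" "q \<in> ball z (r / (2 + 2 * K))"
  shows "three_segment G K p q"
proof -
  define \<rho> where "\<rho> = r / (2 + 2 * K)"
  \<comment> \<open>The small radius leaves room to lift its points by \<open>K * d\<close>, where
    \<open>d < 2 * \<rho>\<close>, without leaving the chart.\<close>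
  have \<rho>0: "\<rho> > 0" and "\<rho> * (2 + 2 * K) = r" using r K by (auto simp: \<rho>_def add_pos_pos)
  hence "r = 2 * \<rho> + 2 * K * \<rho>" by (simp add: algebra_simps)
  moreover have "K * \<rho> > 0" using \<rho>0 K by simp
  ultimately have \<rho>: "\<rho> + 2 * K * \<rho> < r" "\<rho> < r" using \<rho>0 by simp_all
  have pr: "dist z p < \<rho>" "dist z q < \<rho>" using p q by (auto simp: \<rho>_def)
  define d where "d = norm (p - q)"
  have "d \<le> dist z p + dist z q" by (metis d_def dist_norm dist_triangle3 dist_commute)
  hence d: "d < 2 * \<rho>" "d \<ge> 0" using pr by (auto simp: d_def)
  have in_ball: "y + t *\<^sub>R e \<in> ball z r" if "dist z y < \<rho>" "0 \<le> t" "t \<le> K * d" for y t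
  proof -
    have "dist z (y + t *\<^sub>R e) \<le> dist z y + dist y (y + t *\<^sub>R e)" by (rule dist_triangle)
    also have "dist y (y + t *\<^sub>R e) = t" using that e by (simp add: dist_norm)
    also have "t \<le> K * (2 * \<rho>)" using that d K by (intro order_trans[OF that(3)] mult_left_mono) auto
    finally show ?thesis using \<rho> that by simp
  qed
  have up: "closed_segment y (y + (K * d) *\<^sub>R e) \<subseteq> G" if y: "y \<in> G" "dist z y < \<rho>" for y
  proof
    fix x assume "x \<in> closed_segment y (y + (K * d) *\<^sub>R e)"
    then obtain t where t: "0 \<le> t" "t \<le> 1" "x = (1 - t) *\<^sub>R y + t *\<^sub>R (y + (K * d) *\<^sub>R e)"
      unfolding in_segment by blast
    hence x: "x = y + (t * (K * d)) *\<^sub>R e" by (simp add: algebra_simps)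
    have t': "0 \<le> t * (K * d)" "t * (K * d) \<le> K * d"
      using t d K mult_right_mono[of t 1 "K * d"] by auto
    have b: "x \<in> ball z r" unfolding x using y t' by (intro in_ball) auto
    have "f y < y \<bullet> e" using above[of y] y \<rho> by simp
    hence "f x < x \<bullet> e" unfolding x using inv t' ee by (simp add: inner_add_left)
    thus "x \<in> G" using above[OF b] by simp
  qed
  have mid: "closed_segment (p + (K * d) *\<^sub>R e) (q + (K * d) *\<^sub>R e) \<subseteq> G"
  proof
    fix x assume "x \<in> closed_segment (p + (K * d) *\<^sub>R e) (q + (K * d) *\<^sub>R e)"
    then obtain t where t: "0 \<le> t" "t \<le> 1" "x = (1 - t) *\<^sub>R (p + (K * d) *\<^sub>R e) + t *\<^sub>R (q + (K * d) *\<^sub>R e)"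
      unfolding in_segment by blast
    define y where "y = (1 - t) *\<^sub>R p + t *\<^sub>R q"
    have x: "x = y + (K * d) *\<^sub>R e" using t by (simp add: y_def algebra_simps)
    have "y \<in> ball z \<rho>" unfolding y_def using t pr by (intro convexD[OF convex_ball]) auto
    hence y: "dist z y < \<rho>" by simp
    have b: "x \<in> ball z r" unfolding x using y d K by (intro in_ball) auto
    have fp: "f p < p \<bullet> e" "f q < q \<bullet> e" using above[of p] above[of q] p q pr \<rho> by auto
    have yp: "y - p = t *\<^sub>R (q - p)" "y - q = (1 - t) *\<^sub>R (p - q)" by (simp_all add: y_def algebra_simps)
    \<comment> \<open>The Lipschitz bound is used from both ends, weighted with \<open>1 - t\<close>
      and \<open>t\<close>; the excess of \<open>f\<close> over the interpolated values is then
      \<open>2 * t * (1 - t) * K * d\<close>.\<close>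
    have "f y \<le> f p + K * (t * d)"
      using Lf[of y p] y pr \<rho> t unfolding yp by (simp add: d_def norm_minus_commute)
    hence 1: "(1 - t) * f y \<le> (1 - t) * (f p + K * (t * d))" using t by (intro mult_left_mono) auto
    have "f y \<le> f q + K * ((1 - t) * d)"
      using Lf[of y q] y pr \<rho> t unfolding yp by (simp add: d_def norm_minus_commute)
    hence 2: "t * f y \<le> t * (f q + K * ((1 - t) * d))" using t by (intro mult_left_mono) auto
    have 3: "(1 - t) * f p + t * f q < (1 - t) * (p \<bullet> e) + t * (q \<bullet> e)"
    proof (cases "t = 0")
      case False
      hence "t * f q < t * (q \<bullet> e)" using t fp by simp
      moreover have "(1 - t) * f p \<le> (1 - t) * (p \<bullet> e)" using t fp by (intro mult_left_mono) auto
      ultimately show ?thesis by linarith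
    qed (use fp in simp)
    have "0 \<le> (2 * t - 1) * (2 * t - 1)" by simp
    hence "2 * (t * (1 - t)) \<le> 1" by (simp add: algebra_simps)
    hence 4: "2 * (t * (1 - t)) * (K * d) \<le> 1 * (K * d)" using K d by (intro mult_right_mono) auto
    have "f y = (1 - t) * f y + t * f y" by (simp add: algebra_simps)
    also have "\<dots> \<le> (1 - t) * f p + t * f q + 2 * (t * (1 - t)) * (K * d)"
      using 1 2 by (simp add: algebra_simps)
    also have "\<dots> < x \<bullet> e" using 3 4 ee by (simp add: x y_def inner_add_left)
    finally have "f x < x \<bullet> e" unfolding x using inv by simp
    thus "x \<in> G" using above[OF b] by simp
  qed
  show ?thesis unfolding three_segment_def
  proof (intro exI[of _ "(K * d) *\<^sub>R e"] conjI mid)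
    show "norm ((K * d) *\<^sub>R e) \<le> K * dist p q" using K d e by (simp add: d_def dist_norm)
    show "closed_segment p (p + (K * d) *\<^sub>R e) \<subseteq> G" using up p pr by simp
    show "closed_segment (q + (K * d) *\<^sub>R e) q \<subseteq> G" using up[of q] q pr by (simp add: closed_segment_commute)
  qed
qed

end

section \<open>Patching the charts together\<close>

lemma graph_chart_locale:
  assumes "graph_chart 4 \<epsilon> G z e f r" "open G"
  obtains g K where "chart G z e f g r K"
proof (rule graph_chart_gradient[OF assms(1)])
  show "2 \<le> (4 :: nat)" by simp
next
  fix g K
  assume gK: "K > 0"
    "\<And>y. y \<in> ball z r \<Longrightarrow> (f has_derivative (\<lambda>h. h \<bullet> g y)) (at y)"
    "\<And>y y'. y \<in> ball z r \<Longrightarrow> y' \<in> ball z r \<Longrightarrow> norm (g y - g y') \<le> K * norm (y - y')"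
    "\<And>y y'. y \<in> ball z r \<Longrightarrow> y' \<in> ball z r \<Longrightarrow> \<bar>f y - f y'\<bar> \<le> K * norm (y - y')"
    "\<And>y. y \<in> ball z r \<Longrightarrow> g y \<bullet> e = 0"
  have "chart G z e f g r K"
  proof (standard)
    show "(y \<in> G) = (f y < y \<bullet> e)" if "y \<in> ball z r" for y
      using assms(1) that unfolding graph_chart_def by blast
  qed (use assms gK in \<open>auto simp: graph_chart_def\<close>)
  thus thesis by (rule that)
qed

lemma three_segment_mono:
  assumes "three_segment \<Omega> L p q" "L \<le> L'"
  shows "three_segment \<Omega> L' p q"
proof -
  have "L * dist p q \<le> L' * dist p q" using assms by (intro mult_right_mono) auto
  thus ?thesis using assms unfolding three_segment_def by (meson order_trans)
qed

lemma holder_boundary_chart: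
  assumes "holder_boundary 4 \<epsilon> G" "open G" "z \<in> frontier G"
  obtains e f g r K where "graph_chart 4 \<epsilon> G z e f r" "chart G z e f g r K"
proof -
  obtain e f r where gc: "graph_chart 4 \<epsilon> G z e f r" using assms unfolding holder_boundary_def by blast
  show thesis by (rule graph_chart_locale[OF gc assms(2)]) (rule that[OF gc])
qed

text \<open>Near an interior point a ball is convex and the shift 0 works; near a boundary point a
  chart provides the path.\<close>

lemma three_segment_domain:
  fixes G :: "'a::euclidean_space set"
  assumes "open G" "bounded G" "holder_boundary 4 \<epsilon> G"
  shows "\<exists>\<delta>>0. \<exists>L>0. \<forall>p\<in>G. \<forall>q\<in>G. dist p q < \<delta> \<longrightarrow> three_segment G L p q"
proof (rule compact_local_to_global[where K = "closure G"])
  show "compact (closure G)" using assms(2) by simp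
  show "G \<subseteq> closure G" by (rule closure_subset)
  show "three_segment G C' p q" if "three_segment G C p q" "C \<le> C'" for C C' p q
    using three_segment_mono that by blast
  fix z assume z: "z \<in> closure G"
  show "\<exists>\<rho>>0. \<exists>C>0. \<forall>p\<in>G \<inter> ball z \<rho>. \<forall>q\<in>G \<inter> ball z \<rho>. three_segment G C p q"
  proof (cases "z \<in> G")
    case True
    then obtain \<rho> where \<rho>: "\<rho> > 0" "ball z \<rho> \<subseteq> G" using assms(1) open_contains_ball by blast
    have "three_segment G 1 p q" if "p \<in> ball z \<rho>" "q \<in> ball z \<rho>" for p q
      unfolding three_segment_def
    proof (intro exI[of _ 0] conjI)
      have "closed_segment p q \<subseteq> G" using closed_segment_subset[OF that convex_ball] \<rho> by blast
      thus "closed_segment (p + 0) (q + 0) \<subseteq> G" by simp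
    qed (use that \<rho> in auto)
    thus ?thesis using \<rho> by (metis Int_iff zero_less_one)
  next
    case False
    hence "z \<in> frontier G" using z assms(1) by (simp add: frontier_def interior_open)
    then obtain e f g r K where "chart G z e f g r K" using holder_boundary_chart assms by metis
    then interpret chart G z e f g r K .
    have "r / (2 + 2 * K) > 0" using r K by simp
    thus ?thesis using three_segment_near K by (metis Int_iff)
  qed
qed

lemma closure_cyl: "T > 0 \<Longrightarrow> closure (cyl T G) = {0..T} \<times> closure G"
  by (simp add: cyl_def closure_Times)

text \<open>The shift is purely spatial; the times interpolate inside a convex interval.\<close>

lemma three_segment_cyl:
  assumes "three_segment G L (snd p) (snd q)" "L \<ge> 0" "p \<in> cyl T G" "q \<in> cyl T G"
  shows "three_segment (cyl T G) L p q"
proof -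
  obtain w where w: "norm w \<le> L * dist (snd p) (snd q)" "closed_segment (snd p) (snd p + w) \<subseteq> G"
     "closed_segment (snd p + w) (snd q + w) \<subseteq> G" "closed_segment (snd q + w) (snd q) \<subseteq> G"
    using assms(1) unfolding three_segment_def by blast
  have seg: "closed_segment x y \<subseteq> cyl T G"
    if "fst x \<in> {0<..<T}" "fst y \<in> {0<..<T}" "closed_segment (snd x) (snd y) \<subseteq> G" for x y
  proof
    fix v assume "v \<in> closed_segment x y"
    then obtain u where u: "0 \<le> u" "u \<le> 1" "v = (1 - u) *\<^sub>R x + u *\<^sub>R y" unfolding in_segment by blast
    hence "fst v = (1 - u) *\<^sub>R fst x + u *\<^sub>R fst y" "snd v = (1 - u) *\<^sub>R snd x + u *\<^sub>R snd y" by simp_all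
    hence v: "fst v \<in> closed_segment (fst x) (fst y)" "snd v \<in> closed_segment (snd x) (snd y)"
      unfolding in_segment using u by blast+
    have "closed_segment (fst x) (fst y) \<subseteq> {0<..<T}"
      using that by (intro closed_segment_subset) auto
    thus "v \<in> cyl T G" using v that unfolding cyl_def by (auto simp: mem_Times_iff)
  qed
  have pq: "fst p \<in> {0<..<T}" "fst q \<in> {0<..<T}" using assms by (auto simp: cyl_def)
  have "L * dist (snd p) (snd q) \<le> L * dist p q"
    using assms(2) by (intro mult_left_mono dist_snd_le) auto
  thus ?thesis unfolding three_segment_def
    using w pq by (intro exI[of _ "(0, w)"] conjI seg) auto
qed

lemma normal_field_local:
  fixes G :: "'a::euclidean_space set"
  assumes "open G" "bounded G" "holder_boundary 4 \<epsilon> G"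
    and \<nu>: "\<And>z. z \<in> frontier G \<Longrightarrow> inward_unit_normal G z (\<nu> z)"
  shows "\<exists>\<delta>>0. \<exists>K>0. \<forall>p\<in>frontier G. \<forall>q\<in>frontier G. dist p q < \<delta> \<longrightarrow>
     norm (\<nu> p - \<nu> q) \<le> K * norm (p - q) \<and> (\<forall>s>0. s * K < 1 \<longrightarrow> p + s *\<^sub>R \<nu> p \<in> G)"
proof (rule compact_local_to_global[where K = "frontier G"])
  show "compact (frontier G)" using assms(2) by (simp add: compact_frontier_bounded)
  fix C C' :: real and p q
  assume *: "norm (\<nu> p - \<nu> q) \<le> C * norm (p - q) \<and> (\<forall>s>0. s * C < 1 \<longrightarrow> p + s *\<^sub>R \<nu> p \<in> G)" "0 < C" "C \<le> C'"
  have "C * norm (p - q) \<le> C' * norm (p - q)" using * by (intro mult_right_mono) auto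
  moreover have "s * C < 1" if "s > 0" "s * C' < 1" for s
    using mult_left_mono[OF *(3) less_imp_le[OF that(1)]] that(2) by linarith
  ultimately show "norm (\<nu> p - \<nu> q) \<le> C' * norm (p - q) \<and> (\<forall>s>0. s * C' < 1 \<longrightarrow> p + s *\<^sub>R \<nu> p \<in> G)"
    using *(1) by (meson order_trans)
next
  fix z assume "z \<in> frontier G"
  then obtain e f g r K where "chart G z e f g r K" using holder_boundary_chart assms by metis
  then interpret chart G z e f g r K .
  \<comment> \<open>The single condition \<open>s * C < 1\<close> thereby implies both
    \<open>s < r / 2\<close>, which keeps the point in the chart, and
    \<open>s * K < 1\<close>.\<close>
  define C where "C = 2 * K + 2 / r"
  have C: "C > 0" "2 * K \<le> C" "2 / r \<le> C" using K r by (auto simp: C_def add_pos_pos)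
  have "norm (\<nu> p - \<nu> q) \<le> C * norm (p - q) \<and> (\<forall>s>0. s * C < 1 \<longrightarrow> p + s *\<^sub>R \<nu> p \<in> G)"
    if "p \<in> frontier G" "q \<in> frontier G" "p \<in> ball z (r / 2)" "q \<in> ball z (r / 2)" for p q
  proof (intro conjI allI impI)
    have "norm (\<nu> p - \<nu> q) \<le> 2 * K * norm (p - q)"
      using that r by (intro normal_Lipschitz \<nu>) auto
    also have "\<dots> \<le> C * norm (p - q)" using C by (intro mult_right_mono) auto
    finally show "norm (\<nu> p - \<nu> q) \<le> C * norm (p - q)" .
    fix s :: real assume s: "s > 0" "s * C < 1"
    have "s * (2 / r) < 1" using mult_left_mono[OF C(3) less_imp_le[OF s(1)]] s(2) by linarith
    hence "s < r / 2" using r by (simp add: field_simps)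
    moreover have "s * K \<le> s * C" using s C K by (intro mult_left_mono) auto
    hence "s * K < 1" using s by linarith
    ultimately show "p + s *\<^sub>R \<nu> p \<in> G" using that s by (intro normal_points_inside \<nu>) auto
  qed
  thus "\<exists>\<rho>>0. \<exists>C>0. \<forall>p\<in>frontier G \<inter> ball z \<rho>. \<forall>q\<in>frontier G \<inter> ball z \<rho>.
     norm (\<nu> p - \<nu> q) \<le> C * norm (p - q) \<and> (\<forall>s>0. s * C < 1 \<longrightarrow> p + s *\<^sub>R \<nu> p \<in> G)"
    using C(1) r by (intro exI[of _ "r / 2"] conjI exI[of _ C]) auto
qed simp

section \<open>Projection on the boundary\<close>

lemma frontier_crossing:
  fixes G :: "'a::euclidean_space set"
  assumes "a \<in> closure G" "b \<notin> closure G"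
  shows "\<exists>y\<in>closed_segment a b. y \<in> frontier G"
proof (cases "a \<in> G")
  case True
  have "b \<notin> G" using assms(2) closure_subset by blast
  hence "closed_segment a b \<inter> frontier G \<noteq> {}"
    using True by (intro connected_Int_frontier) (auto intro: convex_connected)
  thus ?thesis by blast
next
  case False
  hence "a \<in> frontier G" using assms(1) interior_subset by (auto simp: frontier_def)
  thus ?thesis by (intro bexI[of _ a]) auto
qed

text \<open>The segment from \<open>a\<close> to \<open>b\<close> meets the boundary. This bounds
  the overshoot of a step by the length of the step.\<close>

lemma infdist_crossing:
  fixes G :: "'a::euclidean_space set"
  assumes "a \<in> closure G" "b \<notin> closure G"
  shows "infdist b (frontier G) \<le> norm (b - a)"
proof -
  obtain y where y: "y \<in> closed_segment a b" "y \<in> frontier G" using frontier_crossing[OF assms] by blast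
  have "infdist b (frontier G) \<le> dist b y" using y by (intro infdist_le)
  also have "\<dots> \<le> norm (b - a)" using segment_bound(2)[OF y(1)] by (simp add: dist_norm norm_minus_commute)
  finally show ?thesis .
qed

text \<open>First-order condition at a nearest point: the squared distance to \<open>x\<close> along
  any boundary curve through \<open>z\<close> is minimal at \<open>z\<close>, so
  \<open>x - z\<close> is orthogonal to the boundary and thus a multiple of \<open>n\<close>. The
  sign of the multiple follows from \<open>x\<close> being outside.\<close>

lemma nearest_point_normal:
  fixes G :: "'a::euclidean_space set"
  assumes "chart G z e f g \<rho> K" and z: "z \<in> frontier G" and n: "inward_unit_normal G z n"
    and x: "x \<notin> closure G" and near: "infdist x (frontier G) = dist x z"
  shows "z = x + infdist x (frontier G) *\<^sub>R n"
proof -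
  interpret chart G z e f g \<rho> K by fact
  define d where "d = dist x z"
  have n1: "norm n = 1" using n unfolding inward_unit_normal_def by blast
  have zb: "z \<in> ball z \<rho>" using r by simp
  have "x - z = ((x - z) \<bullet> e) *\<^sub>R (e - g z)"
  proof (rule orthogonal_to_curves[OF zb z])
    fix p w assume p: "p 0 = z" "\<And>s. p s \<in> frontier G" "(p has_vector_derivative w) (at (0::real))"
    have "((\<lambda>s. (x - p s) \<bullet> (x - p s)) has_real_derivative - 2 * ((x - z) \<bullet> w)) (at 0)"
      unfolding has_field_derivative_def
      by (rule has_derivative_eq_rhs, (rule derivative_intros p(3)[unfolded has_vector_derivative_def])+)
        (auto simp: p(1) inner_commute algebra_simps)
    moreover have "(x - p 0) \<bullet> (x - p 0) \<le> (x - p s) \<bullet> (x - p s)" for s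
    proof -
      have "dist x z \<le> dist x (p s)" using infdist_le[OF p(2), of x s] near by simp
      hence "(norm (x - z))\<^sup>2 \<le> (norm (x - p s))\<^sup>2" by (intro power_mono) (auto simp: dist_norm)
      thus ?thesis by (simp add: p(1) power2_norm_eq_inner)
    qed
    ultimately have "- 2 * ((x - z) \<bullet> w) = 0" by (intro DERIV_local_min[where d = 1]) auto
    thus "(x - z) \<bullet> w = 0" by simp
  qed
  moreover have "norm (e - g z) *\<^sub>R n = e - g z"
    using normal_eq[OF zb z n] gradient_norm[OF zb] by (cases "e = g z") simp_all
  ultimately obtain \<kappa> where \<kappa>: "x - z = \<kappa> *\<^sub>R n" by (metis scaleR_scaleR)
  have d: "d > 0" using x z unfolding d_def frontier_def by auto
  have k: "\<bar>\<kappa>\<bar> = d" using \<kappa> n1 by (metis d_def dist_norm mult.right_neutral norm_scaleR)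
  \<comment> \<open>Otherwise points \<open>z + s *\<^sub>R n\<close> of \<open>G\<close> lie
    between \<open>z\<close> and \<open>x\<close>, and the boundary crossed on the way from such a
    point to \<open>x\<close> is closer to \<open>x\<close> than \<open>z\<close> is.\<close>
  have "\<not> \<kappa> > 0"
  proof
    assume pos: "\<kappa> > 0"
    obtain \<delta> where \<delta>: "\<delta> > 0" "\<And>s. 0 < s \<Longrightarrow> s < \<delta> \<Longrightarrow> z + s *\<^sub>R n \<in> G"
      using n unfolding inward_unit_normal_def by auto
    define s where "s = min \<delta> \<kappa> / 2"
    have s: "0 < s" "s < \<delta>" "s < \<kappa>" using \<delta> pos by (auto simp: s_def)
    have "z + s *\<^sub>R n \<in> closure G" using \<delta> s closure_subset by blast
    hence "infdist x (frontier G) \<le> norm (x - (z + s *\<^sub>R n))" by (rule infdist_crossing[OF _ x])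
    also have "x - (z + s *\<^sub>R n) = (\<kappa> - s) *\<^sub>R n" using \<kappa> by (simp add: algebra_simps)
    also have "norm \<dots> = \<kappa> - s" using s n1 by simp
    finally show False using near k pos s by (simp add: d_def)
  qed
  hence "\<kappa> = - d" using k by simp
  thus ?thesis using \<kappa> near by (simp add: d_def algebra_simps)
qed

text \<open>A nearest boundary point satisfies the equation that defines the projection. It is the
  only solution because \<open>z \<mapsto> x + r *\<^sub>R \<nu> z\<close> contracts distances of
  close boundary points when \<open>r * K < 1\<close>.\<close>

lemma boundary_projection:
  fixes G :: "(real ^ 'n) set"
  assumes G: "open G" "bounded G" "holder_boundary 4 \<epsilon> G" and ne: "frontier G \<noteq> {}"
    and \<nu>: "\<And>z. z \<in> frontier G \<Longrightarrow> inward_unit_normal G z (\<nu> z)"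
  shows "\<exists>\<delta>>0. \<forall>x. x \<notin> closure G \<and> infdist x (frontier G) < \<delta> \<longrightarrow>
     infdist x (frontier G) > 0 \<and> boundary_proj G \<nu> x \<in> frontier G \<and>
     boundary_proj G \<nu> x = x + infdist x (frontier G) *\<^sub>R \<nu> (boundary_proj G \<nu> x) \<and>
     boundary_proj G \<nu> x + infdist x (frontier G) *\<^sub>R \<nu> (boundary_proj G \<nu> x) \<in> G"
proof -
  obtain \<delta>0 K where \<delta>0: "\<delta>0 > 0" "K > 0"
    and \<nu>K: "\<And>p q. p \<in> frontier G \<Longrightarrow> q \<in> frontier G \<Longrightarrow> dist p q < \<delta>0 \<Longrightarrow>
     norm (\<nu> p - \<nu> q) \<le> K * norm (p - q) \<and> (\<forall>s>0. s * K < 1 \<longrightarrow> p + s *\<^sub>R \<nu> p \<in> G)"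
    using normal_field_local[OF G \<nu>] by blast
  \<comment> \<open>Two candidates for the projection differ by at most \<open>2 * r\<close>; the
    first bound brings them into the range of the Lipschitz estimate. The second gives the
    contraction and puts the reflected point into \<open>G\<close>.\<close>
  define \<delta> where "\<delta> = min (\<delta>0 / 2) (1 / K)"
  have \<delta>: "\<delta> > 0" using \<delta>0 by (simp add: \<delta>_def)
  have "infdist x (frontier G) > 0 \<and> boundary_proj G \<nu> x \<in> frontier G \<and>
     boundary_proj G \<nu> x = x + infdist x (frontier G) *\<^sub>R \<nu> (boundary_proj G \<nu> x) \<and>
     boundary_proj G \<nu> x + infdist x (frontier G) *\<^sub>R \<nu> (boundary_proj G \<nu> x) \<in> G"
    if x: "x \<notin> closure G" and d: "infdist x (frontier G) < \<delta>" for x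
  proof -
    define r where "r = infdist x (frontier G)"
    have "x \<notin> frontier G" using x by (simp add: frontier_def)
    hence r: "r > 0" unfolding r_def using ne by (intro infdist_pos_not_in_closed) auto
    have rK: "r * K < 1" "2 * r < \<delta>0" using d \<delta>0 by (auto simp: r_def \<delta>_def field_simps)
    obtain z where z: "z \<in> frontier G" "infdist x (frontier G) = dist x z"
      using infdist_attains_inf[OF _ ne] by (metis frontier_closed)
    obtain e f g \<rho> K' where "chart G z e f g \<rho> K'" using holder_boundary_chart[OF G(3,1) z(1)] by metis
    from nearest_point_normal[OF this z(1) \<nu>[OF z(1)] x z(2)]
    have zr: "z = x + r *\<^sub>R \<nu> z" by (simp add: r_def)
    have uniq: "z' = z" if z': "z' \<in> frontier G" "z' = x + r *\<^sub>R \<nu> z'" for z'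
    proof (rule ccontr)
      assume "z' \<noteq> z"
      have n1: "norm (\<nu> y) = 1" if "y \<in> frontier G" for y
        using \<nu>[OF that] unfolding inward_unit_normal_def by blast
      have "z' - z = (x + r *\<^sub>R \<nu> z') - (x + r *\<^sub>R \<nu> z)" using z' zr by simp
      hence zz: "z' - z = r *\<^sub>R (\<nu> z' - \<nu> z)" by (simp add: scaleR_diff_right)
      have "norm (\<nu> z' - \<nu> z) \<le> 2" using norm_triangle_ineq4[of "\<nu> z'" "\<nu> z"] n1 z' z by simp
      hence "r * norm (\<nu> z' - \<nu> z) \<le> r * 2" using r by (intro mult_left_mono) auto
      moreover have nz: "norm (z' - z) = r * norm (\<nu> z' - \<nu> z)" unfolding zz using r by simp
      ultimately have "dist z' z < \<delta>0" using rK unfolding dist_norm by linarith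
      hence "norm (\<nu> z' - \<nu> z) \<le> K * norm (z' - z)" using \<nu>K z' z by blast
      hence "r * norm (\<nu> z' - \<nu> z) \<le> r * (K * norm (z' - z))" using r by (intro mult_left_mono) auto
      hence "norm (z' - z) \<le> (r * K) * norm (z' - z)" unfolding nz[symmetric] by (simp add: mult.assoc)
      also have "\<dots> < 1 * norm (z' - z)" using rK \<open>z' \<noteq> z\<close> by (intro mult_strict_right_mono) auto
      finally show False by simp
    qed
    have P: "boundary_proj G \<nu> x = z" unfolding boundary_proj_def r_def[symmetric]
      by (rule the_equality) (use zr z(1) uniq in blast)+
    have "z + r *\<^sub>R \<nu> z \<in> G" using \<nu>K[OF z(1) z(1)] rK(1) r \<delta>0(1) by simp
    thus ?thesis unfolding P r_def[symmetric] using zr z(1) r by blast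
  qed
  thus ?thesis using \<delta> by blast
qed

section \<open>Uniform bounds for the data\<close>

lemma cyl_continuous_bounded:
  fixes v :: "real \<times> 'a::euclidean_space \<Rightarrow> real"
  assumes "continuous_on (closure (cyl T G)) v" "bounded G" "T > 0"
  shows "\<exists>C>0. \<forall>t\<in>{0..T}. \<forall>z\<in>closure G. \<bar>v (t, z)\<bar> \<le> C"
proof -
  have "compact (closure (cyl T G))" unfolding closure_cyl[OF assms(3)]
    using assms(2) by (intro compact_Times) auto
  hence "bounded (v ` closure (cyl T G))"
    using assms(1) compact_continuous_image compact_imp_bounded by blast
  thus ?thesis unfolding closure_cyl[OF assms(3)] bounded_pos by force
qed

lemma parabolic_holder_continuous:
  "parabolic_holder \<epsilon> T G v \<Longrightarrow> continuous_on (closure (cyl T G)) v"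
  unfolding parabolic_holder_def C12_def smooth_closure_def by blast

lemma chart_graph_point:
  assumes "chart G z e f g r K" "p \<in> frontier G" "p \<in> ball z r"
  shows "graph_point e f p = p"
  using chart.frontier_iff[OF assms(1,3)] assms(2) by (simp add: graph_point_def)

text \<open>Regularity is given only in graph coordinates, but \<open>graph_point\<close> fixes the
  boundary points of its chart, so the chart functions take the values of \<open>w\<close>
  there.\<close>

lemma lateral_data_bounded:
  fixes G :: "'a::euclidean_space set"
  assumes G: "open G" "bounded G" "holder_boundary 4 \<epsilon> G" and T: "T > 0"
    and w: "parabolic_holder_on_boundary \<epsilon> T G w"
  shows "\<exists>C>0. \<forall>t\<in>{0..T}. \<forall>z\<in>frontier G. \<bar>w (t, z)\<bar> \<le> C"
proof -
  have "\<exists>\<delta>>0. \<exists>C>0. \<forall>p\<in>frontier G. \<forall>q\<in>frontier G. dist p q < \<delta> \<longrightarrow> (\<forall>t\<in>{0..T}. \<bar>w (t, p)\<bar> \<le> C)"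
  proof (rule compact_local_to_global[where K = "frontier G"])
    show "compact (frontier G)" using G(2) by (simp add: compact_frontier_bounded)
    fix z assume z: "z \<in> frontier G"
    obtain e f g r K where gc: "graph_chart 4 \<epsilon> G z e f r" and c: "chart G z e f g r K"
      using holder_boundary_chart[OF G(3,1) z] by metis
    obtain \<rho> where \<rho>: "\<rho> > 0" "parabolic_holder \<epsilon> T (ball z \<rho>) (\<lambda>(t, y). w (t, graph_point e f y))"
      using w gc unfolding parabolic_holder_on_boundary_def by blast
    obtain C where C: "C > 0" "\<forall>t\<in>{0..T}. \<forall>y\<in>closure (ball z \<rho>). \<bar>w (t, graph_point e f y)\<bar> \<le> C"
      using cyl_continuous_bounded[OF parabolic_holder_continuous[OF \<rho>(2)] _ T] by auto
    have "\<bar>w (t, p)\<bar> \<le> C" if "p \<in> frontier G \<inter> ball z (min \<rho> r)" "t \<in> {0..T}" for t p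
      using C(2) that chart_graph_point[OF c, of p] closure_subset[of "ball z \<rho>"] by force
    moreover have "min \<rho> r > 0" using \<rho> chart.r[OF c] by simp
    ultimately show "\<exists>\<rho>>0. \<exists>C>0. \<forall>p\<in>frontier G \<inter> ball z \<rho>. \<forall>q\<in>frontier G \<inter> ball z \<rho>. \<forall>t\<in>{0..T}. \<bar>w (t, p)\<bar> \<le> C"
      using C(1) by blast
  qed (auto intro: order_trans)
  thus ?thesis by (metis dist_self)
qed

text \<open>The lower bound on \<open>\<mu>\<close> is written \<open>1 \<le> C * \<mu> z\<close> so
  that, like the upper bound, it is preserved when \<open>C\<close> grows.\<close>

lemma boundary_data_bounded:
  fixes G :: "'a::euclidean_space set"
  assumes G: "open G" "bounded G" "holder_boundary 4 \<epsilon> G"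
    and w: "holder_on_boundary \<epsilon> G \<mu>" and pos: "\<And>z. z \<in> frontier G \<Longrightarrow> \<mu> z > 0"
  shows "\<exists>C>0. \<forall>z\<in>frontier G. \<mu> z \<le> C \<and> 1 \<le> C * \<mu> z"
proof -
  have "\<exists>\<delta>>0. \<exists>C>0. \<forall>p\<in>frontier G. \<forall>q\<in>frontier G. dist p q < \<delta> \<longrightarrow> \<mu> p \<le> C \<and> 1 \<le> C * \<mu> p"
  proof (rule compact_local_to_global[where K = "frontier G"])
    show "compact (frontier G)" using G(2) by (simp add: compact_frontier_bounded)
    show "\<mu> p \<le> C' \<and> 1 \<le> C' * \<mu> p" if "p \<in> frontier G" "\<mu> p \<le> C \<and> 1 \<le> C * \<mu> p" "C \<le> C'" for C C' p
    proof -
      have "C * \<mu> p \<le> C' * \<mu> p" using that pos[of p] by (intro mult_right_mono) auto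
      thus ?thesis using that by simp
    qed
    fix z assume z: "z \<in> frontier G"
    obtain e f g r K where gc: "graph_chart 4 \<epsilon> G z e f r" and c: "chart G z e f g r K"
      using holder_boundary_chart[OF G(3,1) z] by metis
    have r: "r > 0" using chart.r[OF c] .
    obtain \<rho> where \<rho>: "\<rho> > 0" "holder_space 2 \<epsilon> (ball z \<rho>) (\<lambda>y. \<mu> (graph_point e f y))"
      using w gc unfolding holder_on_boundary_def by blast
    hence "continuous_on (closure (ball z \<rho>)) (\<lambda>y. \<mu> (graph_point e f y))"
      unfolding holder_space_def smooth_closure_def by blast
    hence "continuous_on (ball z \<rho>) (\<lambda>y. \<mu> (graph_point e f y))"
      using closure_subset continuous_on_subset by blast
    hence "isCont (\<lambda>y. \<mu> (graph_point e f y)) z"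
      using \<rho>(1) by (simp add: continuous_on_eq_continuous_at)
    moreover have z': "graph_point e f z = z" using chart_graph_point[OF c z] r by simp
    ultimately obtain d where d: "d > 0" "\<And>y. dist y z < d \<Longrightarrow> dist (\<mu> (graph_point e f y)) (\<mu> z) < \<mu> z / 2"
      unfolding continuous_at_eps_delta using pos[OF z] by (metis half_gt_zero)
    \<comment> \<open>Chosen for the range between \<open>\<mu> z / 2\<close> and
      \<open>2 * \<mu> z\<close> that continuity gives near \<open>z\<close>.\<close>
    define C where "C = 2 * \<mu> z + 2 / \<mu> z"
    have C: "C > 0" using pos[OF z] by (simp add: C_def add_pos_pos)
    have "\<mu> p \<le> C \<and> 1 \<le> C * \<mu> p" if p: "p \<in> frontier G \<inter> ball z (min d r)" for p
    proof -
      have "\<bar>\<mu> p - \<mu> z\<bar> < \<mu> z / 2"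
        using d(2)[of p] p chart_graph_point[OF c, of p] by (auto simp: dist_real_def dist_commute)
      hence b: "\<mu> p \<ge> \<mu> z / 2" "\<mu> p \<le> 2 * \<mu> z" using pos[OF z] by (auto simp: abs_if split: if_splits)
      have "1 = (2 / \<mu> z) * (\<mu> z / 2)" using pos[OF z] by simp
      also have "\<dots> \<le> C * \<mu> p" using b pos[OF z] by (intro mult_mono) (auto simp: C_def)
      finally have "1 \<le> C * \<mu> p" .
      moreover have "2 / \<mu> z > 0" using pos[OF z] by simp
      hence "\<mu> p \<le> C" using b unfolding C_def by linarith
      ultimately show ?thesis by simp
    qed
    moreover have "min d r > 0" using d r by simp
    ultimately show "\<exists>\<rho>>0. \<exists>C>0. \<forall>p\<in>frontier G \<inter> ball z \<rho>. \<forall>q\<in>frontier G \<inter> ball z \<rho>. \<mu> p \<le> C \<and> 1 \<le> C * \<mu> p"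
      using C by blast
  qed auto
  thus ?thesis by (metis dist_self)
qed

section \<open>One step of the method\<close>

text \<open>The values of one vector of signs. Sums over this finite set, not divided by its
  cardinality, replace expectations of one step.\<close>

definition sign_cube :: "(real ^ 'n) set" where
  "sign_cube = {v. \<forall>i. v $ i = 1 \<or> v $ i = - 1}"

text \<open>Stopping adds one unit, so that the error of the stopping step is also \<open>O(h)\<close> times the increment.\<close>

definition stop_clock :: "real \<Rightarrow> real \<Rightarrow> real" where
  "stop_clock T t = t + (if t < T then 0 else 1)"

lemma finite_sign_cube: "finite (sign_cube :: (real ^ 'n) set)"
proof -
  have "(sign_cube :: (real ^ 'n) set) = vec_lambda ` (UNIV \<rightarrow> {1, -1})"
  proof (intro equalityI subsetI)
    fix v :: "real ^ 'n" assume "v \<in> sign_cube"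
    thus "v \<in> vec_lambda ` (UNIV \<rightarrow> {1, -1})"
      by (intro image_eqI[of _ _ "\<lambda>i. v $ i"]) (auto simp: sign_cube_def)
  qed (auto simp: sign_cube_def Pi_def)
  moreover have "finite (UNIV \<rightarrow> {1, -1 :: real} :: ('n \<Rightarrow> real) set)"
    using finite_PiE[of "UNIV :: 'n set" "\<lambda>_. {1, -1 :: real}"] by (simp add: PiE_UNIV_domain Pi_def)
  ultimately show ?thesis using finite_imageI by metis
qed

lemma sign_cube_nonempty: "(sign_cube :: (real ^ 'n) set) \<noteq> {}"
  by (auto simp: sign_cube_def intro!: exI[of _ "vec 1"])

text \<open>\<open>L\<close>, \<open>B\<close> and \<open>C\<close> are the first three derivatives of \<open>u\<close> as symmetric multilinear forms, and \<open>K\<close> is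
  a common bound for all data. In \<open>equation\<close> the second-order part of the generator is written as the
  average of \<open>B\<close> over the signs; \<open>boundary\<close> is the boundary condition with the generator eliminated
  by means of the equation.\<close>

locale sticky =
  fixes T :: real and G :: "(real ^ 'n) set" and \<nu> :: "real ^ 'n \<Rightarrow> real ^ 'n"
    and b :: "real \<times> (real ^ 'n) \<Rightarrow> real ^ 'n"
    and \<sigma> :: "real \<times> (real ^ 'n) \<Rightarrow> real ^ 'n ^ 'n"
    and c g \<gamma> \<psi> u :: "real \<times> (real ^ 'n) \<Rightarrow> real"
    and \<mu> \<phi> :: "real ^ 'n \<Rightarrow> real"
    and L :: "real \<times> (real ^ 'n) \<Rightarrow> real \<times> (real ^ 'n) \<Rightarrow> real"
    and B :: "real \<times> (real ^ 'n) \<Rightarrow> real \<times> (real ^ 'n) \<Rightarrow> real \<times> (real ^ 'n) \<Rightarrow> real"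
    and C :: "real \<times> (real ^ 'n) \<Rightarrow> real \<times> (real ^ 'n) \<Rightarrow> real \<times> (real ^ 'n) \<Rightarrow> real \<times> (real ^ 'n) \<Rightarrow> real"
    and K \<delta> :: real
  assumes T: "T > 0" and K: "K \<ge> 1" and \<delta>: "\<delta> > 0"
    and L_lin: "\<And>z. linear (L z)"
    and B_lin: "\<And>z h. linear (B z h)"
    and C_lin: "\<And>z h k. linear (C z h k)"
    and B_sym: "\<And>z h k. z \<in> {0..T} \<times> closure G \<Longrightarrow> B z h k = B z k h"
    and C_sym1: "\<And>z h k l. z \<in> {0..T} \<times> closure G \<Longrightarrow> C z h k l = C z k h l"
    and C_sym2: "\<And>z h k l. z \<in> {0..T} \<times> closure G \<Longrightarrow> C z h k l = C z h l k"
    and u_le: "\<And>z. z \<in> {0..T} \<times> closure G \<Longrightarrow> \<bar>u z\<bar> \<le> K"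
    and L_le: "\<And>z k. z \<in> {0..T} \<times> closure G \<Longrightarrow> \<bar>L z k\<bar> \<le> K * norm k"
    and B_le: "\<And>z h k. z \<in> {0..T} \<times> closure G \<Longrightarrow> \<bar>B z h k\<bar> \<le> K * norm h * norm k"
    and C_le: "\<And>z h k l. z \<in> {0..T} \<times> closure G \<Longrightarrow> \<bar>C z h k l\<bar> \<le> K * norm h * norm k * norm l"
    and expand0: "\<And>z y. z \<in> {0..T} \<times> closure G \<Longrightarrow> y \<in> {0..T} \<times> closure G \<Longrightarrow> norm (y - z) < \<delta> \<Longrightarrow>
      \<bar>u y - (u z + L z (y - z) + B z (y - z) (y - z) / 2 + C z (y - z) (y - z) (y - z) / 6)\<bar> \<le> K * norm (y - z) ^ 4"
    and expand1: "\<And>z y k. z \<in> {0..T} \<times> closure G \<Longrightarrow> y \<in> {0..T} \<times> closure G \<Longrightarrow> norm (y - z) < \<delta> \<Longrightarrow>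
      \<bar>L y k - (L z k + B z k (y - z) + C z k (y - z) (y - z) / 2)\<bar> \<le> K * norm k * norm (y - z) ^ 3"
    and b_le: "\<And>z. z \<in> {0..T} \<times> closure G \<Longrightarrow> norm (b z) \<le> K"
    and \<sigma>_le: "\<And>z \<xi>. z \<in> {0..T} \<times> closure G \<Longrightarrow> \<xi> \<in> sign_cube \<Longrightarrow> norm (\<sigma> z *v \<xi>) \<le> K"
    and c_le: "\<And>z. z \<in> {0..T} \<times> closure G \<Longrightarrow> \<bar>c z\<bar> \<le> K"
    and g_le: "\<And>z. z \<in> {0..T} \<times> closure G \<Longrightarrow> \<bar>g z\<bar> \<le> K"
    and \<gamma>_le: "\<And>t z. t \<in> {0..T} \<Longrightarrow> z \<in> frontier G \<Longrightarrow> \<bar>\<gamma> (t, z)\<bar> \<le> K"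
    and \<psi>_le: "\<And>t z. t \<in> {0..T} \<Longrightarrow> z \<in> frontier G \<Longrightarrow> \<bar>\<psi> (t, z)\<bar> \<le> K"
    and \<mu>_le: "\<And>z. z \<in> frontier G \<Longrightarrow> \<mu> z \<le> K"
    and \<mu>_ge: "\<And>z. z \<in> frontier G \<Longrightarrow> 1 \<le> K * \<mu> z"
    and \<nu>_norm: "\<And>z. z \<in> frontier G \<Longrightarrow> norm (\<nu> z) = 1"
    and proj: "\<And>x. x \<notin> closure G \<Longrightarrow> infdist x (frontier G) < \<delta> \<Longrightarrow>
     infdist x (frontier G) > 0 \<and> boundary_proj G \<nu> x \<in> frontier G \<and>
     boundary_proj G \<nu> x = x + infdist x (frontier G) *\<^sub>R \<nu> (boundary_proj G \<nu> x) \<and>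
     boundary_proj G \<nu> x + infdist x (frontier G) *\<^sub>R \<nu> (boundary_proj G \<nu> x) \<in> G"
    and equation: "\<And>z. z \<in> {0..T} \<times> closure G \<Longrightarrow>
      real (card (sign_cube :: (real ^ 'n) set)) * (L z (1, b z) + c z * u z + g z)
        + (\<Sum>\<xi>\<in>sign_cube. B z (0, \<sigma> z *v \<xi>) (0, \<sigma> z *v \<xi>)) / 2 = 0"
    and boundary: "\<And>t z. t \<in> {0..T} \<Longrightarrow> z \<in> frontier G \<Longrightarrow>
      L (t, z) (\<mu> z, \<nu> z) = \<psi> (t, z) - \<mu> z * g (t, z) - (\<gamma> (t, z) + \<mu> z * c (t, z)) * u (t, z)"
    and final_time: "\<And>z. z \<in> frontier G \<Longrightarrow>
      L (T, z) (1, 0) = - generator T G b \<sigma> (\<lambda>(_, y). \<phi> y) (T, z) - c (T, z) * u (T, z) - g (T, z)"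
    and final_normal: "\<And>z. z \<in> frontier G \<Longrightarrow>
      L (T, z) (0, \<nu> z) = \<psi> (T, z) - \<gamma> (T, z) * u (T, z) + \<mu> z * generator T G b \<sigma> (\<lambda>(_, y). \<phi> y) (T, z)"
begin

abbreviation Q :: "(real \<times> (real ^ 'n)) set" where "Q \<equiv> {0..T} \<times> closure G"

section \<open>Expansions of the cubic polynomial\<close>

text \<open>A polynomial in the increment \<open>h\<close>, so it has values also where
  \<open>z + h\<close> lies outside the domain.\<close>

definition P :: "real \<times> (real ^ 'n) \<Rightarrow> real \<times> (real ^ 'n) \<Rightarrow> real" where
  "P z h = u z + L z h + B z h h / 2 + C z h h h / 6"

lemma frontier_closure: "z \<in> frontier G \<Longrightarrow> z \<in> closure G"
  by (simp add: frontier_def)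

lemma L_simps: "L z (x + y) = L z x + L z y" "L z (x - y) = L z x - L z y" "L z (r *\<^sub>R x) = r * L z x"
  using L_lin[of z] by (simp_all add: linear_add linear_diff linear_scale)

lemma B_simps:
  assumes "z \<in> Q"
  shows "B z h (x + y) = B z h x + B z h y" "B z h (x - y) = B z h x - B z h y" "B z h (r *\<^sub>R x) = r * B z h x"
    "B z (x + y) h = B z x h + B z y h" "B z (x - y) h = B z x h - B z y h" "B z (r *\<^sub>R x) h = r * B z x h"
  unfolding B_sym[OF assms, of _ h]
  using B_lin[of z h] by (simp_all add: linear_add linear_diff linear_scale)

lemma C_simps:
  assumes "z \<in> Q"
  shows "C z h k (x + y) = C z h k x + C z h k y" "C z h k (x - y) = C z h k x - C z h k y"
    "C z h k (r *\<^sub>R x) = r * C z h k x"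
    "C z h (x + y) k = C z h x k + C z h y k" "C z h (x - y) k = C z h x k - C z h y k"
    "C z h (r *\<^sub>R x) k = r * C z h x k"
    "C z (x + y) h k = C z x h k + C z y h k" "C z (x - y) h k = C z x h k - C z y h k"
    "C z (r *\<^sub>R x) h k = r * C z x h k"
proof -
  have *: "C z h k (x + y) = C z h k x + C z h k y" "C z h k (x - y) = C z h k x - C z h k y"
    "C z h k (r *\<^sub>R x) = r * C z h k x" for h k x y r
    using C_lin[of z h k] by (simp_all add: linear_add linear_diff linear_scale)
  have 1: "C z h x k = C z h k x" "C z x h k = C z h k x" for x h k
    using C_sym1[OF assms] C_sym2[OF assms] by metis+
  show "C z h k (x + y) = C z h k x + C z h k y" "C z h k (x - y) = C z h k x - C z h k y"
    "C z h k (r *\<^sub>R x) = r * C z h k x" by (rule *)+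
  show "C z h (x + y) k = C z h x k + C z h y k" "C z h (x - y) k = C z h x k - C z h y k"
    "C z h (r *\<^sub>R x) k = r * C z h x k" unfolding 1(1)[of h _ k] by (rule *)+
  show "C z (x + y) h k = C z x h k + C z y h k" "C z (x - y) h k = C z x h k - C z y h k"
    "C z (r *\<^sub>R x) h k = r * C z x h k" unfolding 1(2)[of _ h k] by (rule *)+
qed

text \<open>With \<open>q\<close> the increment to the midpoint of a reflection and \<open>k\<close>
  half the reflection, even powers of \<open>k\<close> cancel. What remains is twice the derivative
  of \<open>P z\<close> at \<open>q\<close> along \<open>k\<close>, up to a cubic term in
  \<open>k\<close>.\<close>

lemma P_plus_minus:
  assumes "z \<in> Q"
  shows "P z (q + k) - P z (q - k) = 2 * L z k + 2 * B z k q + C z k q q + C z k k k / 3"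
proof -
  have "B z q k = B z k q" using B_sym[OF assms] .
  moreover have "C z q k q = C z k q q" "C z q q k = C z k q q" "C z q k k = C z k k q" "C z k q k = C z k k q"
    using C_sym1[OF assms] C_sym2[OF assms] by metis+
  ultimately show ?thesis unfolding P_def by (simp add: L_simps B_simps[OF assms] C_simps[OF assms] field_simps)
qed

text \<open>Odd powers of \<open>d\<close> cancel; \<open>d\<close> will be the noise and
  \<open>a\<close> the drift, including the time increment.\<close>

lemma P_even:
  assumes "z \<in> Q"
  shows "P z (a + d) + P z (a - d) = 2 * (u z + L z a + B z a a / 2 + B z d d / 2 + C z a a a / 6 + C z a d d / 2)"
proof -
  have "B z d a = B z a d" using B_sym[OF assms] .
  moreover have "C z d a d = C z a d d" "C z d d a = C z a d d" "C z d a a = C z a a d" "C z a d a = C z a a d"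
    using C_sym1[OF assms] C_sym2[OF assms] by metis+
  ultimately show ?thesis unfolding P_def by (simp add: L_simps B_simps[OF assms] C_simps[OF assms] field_simps)
qed

lemma P_increment:
  assumes "z \<in> Q"
  shows "P z (x + k) - P z x = L z k + B z k x + B z k k / 2 + C z k x x / 2 + C z k k x / 2 + C z k k k / 6"
proof -
  have "B z x k = B z k x" using B_sym[OF assms] .
  moreover have "C z x k x = C z k x x" "C z x x k = C z k x x" "C z x k k = C z k k x" "C z k x k = C z k k x"
    using C_sym1[OF assms] C_sym2[OF assms] by metis+
  ultimately show ?thesis unfolding P_def by (simp add: L_simps B_simps[OF assms] C_simps[OF assms] field_simps)
qed

lemma B_bound:
  assumes "z \<in> Q" "norm h \<le> x" "norm k \<le> y"
  shows "\<bar>B z h k\<bar> \<le> K * x * y"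
proof -
  have "0 \<le> x" "0 \<le> y" using assms(2,3) norm_ge_zero order_trans by blast+
  thus ?thesis using B_le[OF assms(1), of h k] K assms
    by (elim order_trans) (intro mult_mono mult_nonneg_nonneg; simp)
qed

lemma C_bound:
  assumes "z \<in> Q" "norm h \<le> x" "norm k \<le> y" "norm l \<le> w"
  shows "\<bar>C z h k l\<bar> \<le> K * x * y * w"
proof -
  have "0 \<le> x" "0 \<le> y" "0 \<le> w" using assms(2,3,4) norm_ge_zero order_trans by blast+
  thus ?thesis using C_le[OF assms(1), of h k l] K assms
    by (elim order_trans) (intro mult_mono mult_nonneg_nonneg; simp)
qed

lemma L_bound: "z \<in> Q \<Longrightarrow> norm k \<le> x \<Longrightarrow> \<bar>L z k\<bar> \<le> K * x"
  by (rule order_trans[OF L_le]) (use K in \<open>auto intro!: mult_left_mono\<close>)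

lemma expand0':
  assumes "z \<in> Q" "y \<in> Q" "norm (y - z) \<le> x" "x < \<delta>"
  shows "\<bar>u y - P z (y - z)\<bar> \<le> K * x ^ 4"
proof -
  have "\<bar>u y - P z (y - z)\<bar> \<le> K * norm (y - z) ^ 4" unfolding P_def using assms by (intro expand0) auto
  also have "\<dots> \<le> K * x ^ 4" using assms K by (intro mult_left_mono power_mono) auto
  finally show ?thesis .
qed

lemma expand1':
  assumes "z \<in> Q" "y \<in> Q" "norm (y - z) \<le> x" "x < \<delta>" "norm k \<le> w"
  shows "\<bar>L y k - (L z k + B z k (y - z) + C z k (y - z) (y - z) / 2)\<bar> \<le> K * w * x ^ 3"
proof -
  have x: "0 \<le> x" "0 \<le> w" using assms(3,5) norm_ge_zero order_trans by blast+
  have "\<bar>L y k - (L z k + B z k (y - z) + C z k (y - z) (y - z) / 2)\<bar> \<le> K * norm k * norm (y - z) ^ 3"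
    using assms by (intro expand1) auto
  also have "\<dots> \<le> K * w * x ^ 3" using assms K x by (intro mult_mono power_mono) auto
  finally show ?thesis .
qed

text \<open>Here \<open>m\<close> is the midpoint on the boundary and \<open>m - k\<close> the
  auxiliary point, where only the polynomial is available. The size \<open>w\<close> of
  \<open>k\<close> is kept apart from the scale \<open>\<rho>\<close> of the step, so that the
  midpoint rule retains a factor of the order of the overshoot. The second estimate allows
  \<open>u\<close> at the new point to be replaced by its value at the midpoint inside correction
  terms.\<close>

lemma reflect_estimate:
  assumes Q: "z \<in> Q" "m \<in> Q" "m + k \<in> Q" and q: "norm (m - z) \<le> \<rho>" and k: "norm k \<le> w" "w \<le> \<rho>"
    and \<rho>: "\<rho> \<le> 1" "2 * \<rho> < \<delta>"
  shows "\<bar>u (m + k) - P z (m - z - k) - 2 * L m k\<bar> \<le> 16 * (K * \<rho> ^ 4) + 3 * (K * w * \<rho>\<^sup>2)"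
    and "\<bar>u (m + k) - u m - L m k\<bar> \<le> 2 * (K * \<rho>\<^sup>2)"
proof -
  have w0: "0 \<le> w" using k(1) norm_ge_zero order_trans by blast
  have \<rho>0: "0 \<le> \<rho>" using w0 k by simp
  have kr: "norm k \<le> \<rho>" using k by simp
  have mk: "m + k - z = (m - z) + k" by simp
  have "norm ((m - z) + k) \<le> 2 * \<rho>" using norm_triangle_ineq[of "m - z" k] q kr by simp
  from expand0'[OF Q(1,3), of "2 * \<rho>"] this \<rho>
  have e0: "\<bar>u (m + k) - P z ((m - z) + k)\<bar> \<le> 16 * (K * \<rho> ^ 4)"
    by (simp add: mk power_mult_distrib)
  have e1: "\<bar>L m k - (L z k + B z k (m - z) + C z k (m - z) (m - z) / 2)\<bar> \<le> K * w * \<rho> ^ 3"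
    using expand1'[OF Q(1,2) q _ k(1)] \<rho> \<rho>0 by simp
  have "K * w * \<rho> ^ 3 \<le> K * w * \<rho>\<^sup>2"
    using w0 K \<rho> \<rho>0 by (intro mult_left_mono power_decreasing) auto
  hence e1: "\<bar>L m k - (L z k + B z k (m - z) + C z k (m - z) (m - z) / 2)\<bar> \<le> K * w * \<rho>\<^sup>2" using e1 by linarith
  have e2: "\<bar>C z k k k\<bar> \<le> K * w * \<rho>\<^sup>2"
    using C_bound[OF Q(1) k(1) kr kr] by (simp add: power2_eq_square mult_ac)
  have "0 \<le> K * w * \<rho>\<^sup>2" using K w0 by simp
  thus "\<bar>u (m + k) - P z (m - z - k) - 2 * L m k\<bar> \<le> 16 * (K * \<rho> ^ 4) + 3 * (K * w * \<rho>\<^sup>2)"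
    using P_plus_minus[OF Q(1), of "m - z" k] e0 e1 e2 by linarith
  have f0: "\<bar>u (m + k) - P m k\<bar> \<le> K * \<rho> ^ 4"
    using expand0'[OF Q(2,3), of \<rho>] kr \<rho> \<rho>0 by simp
  have "K * \<rho> ^ 4 \<le> K * \<rho>\<^sup>2" using K \<rho> \<rho>0 by (intro mult_left_mono power_decreasing) auto
  moreover have "\<bar>B m k k\<bar> \<le> K * \<rho>\<^sup>2" using B_bound[OF Q(2) kr kr] by (simp add: power2_eq_square mult_ac)
  moreover have "\<bar>C m k k k\<bar> \<le> K * \<rho> ^ 3" using C_bound[OF Q(2) kr kr kr] by (simp add: power3_eq_cube mult_ac)
  moreover have "K * \<rho> ^ 3 \<le> K * \<rho>\<^sup>2" using K \<rho> \<rho>0 by (intro mult_left_mono power_decreasing) auto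
  ultimately show "\<bar>u (m + k) - u m - L m k\<bar> \<le> 2 * (K * \<rho>\<^sup>2)" using f0 unfolding P_def by linarith
qed

text \<open>Only one step of a path stops it, so an error \<open>O(\<rho>\<^sup>2)\<close>, that is
  \<open>O(h)\<close>, is affordable. A first-order expansion at any nearby point \<open>m\<close>
  is then enough, and no midpoint structure enters.\<close>

lemma terminal_estimate:
  assumes Q: "z \<in> Q" "y \<in> Q" "m \<in> Q" and n: "norm (y - z) \<le> \<rho>" "norm (m - z) \<le> \<rho>" "norm k \<le> \<rho>"
    and \<rho>: "\<rho> \<le> 1" "2 * \<rho> < \<delta>"
  shows "\<bar>u y - P z (y - z - k) - L m k\<bar> \<le> 10 * (K * \<rho>\<^sup>2)"
    and "\<bar>u y - u m\<bar> \<le> 6 * (K * \<rho>)"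
proof -
  define x where "x = y - z - k"
  have \<rho>0: "0 \<le> \<rho>" using n(1) norm_ge_zero order_trans by blast
  have x: "norm x \<le> 2 * \<rho>" using norm_triangle_ineq4[of "y - z" k] n by (simp add: x_def)
  have p: "K * \<rho> ^ 4 \<le> K * \<rho>\<^sup>2" "K * \<rho> ^ 3 \<le> K * \<rho>\<^sup>2"  "K * \<rho>\<^sup>2 \<le> K * \<rho>"
    using K \<rho> \<rho>0 power_decreasing[of 1 2 \<rho>] by (auto intro!: mult_left_mono power_decreasing)
  have e0: "\<bar>u y - P z (x + k)\<bar> \<le> K * \<rho> ^ 4" "\<bar>u m - P z (m - z)\<bar> \<le> K * \<rho> ^ 4"
    using expand0'[OF Q(1,2) n(1)] expand0'[OF Q(1,3) n(2)] \<rho> \<rho>0 by (simp_all add: x_def)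
  have "\<bar>L m k - (L z k + B z k (m - z) + C z k (m - z) (m - z) / 2)\<bar> \<le> K * \<rho> * \<rho> ^ 3"
    using expand1'[OF Q(1,3) n(2) _ n(3)] \<rho> \<rho>0 by simp
  hence e1: "\<bar>L m k - (L z k + B z k (m - z) + C z k (m - z) (m - z) / 2)\<bar> \<le> K * \<rho> ^ 4"
    by (simp add: power4_eq_xxxx power3_eq_cube mult_ac)
  have B: "\<bar>B z k (m - z)\<bar> \<le> K * \<rho>\<^sup>2" "\<bar>B z k x\<bar> \<le> 2 * (K * \<rho>\<^sup>2)" "\<bar>B z k k\<bar> \<le> K * \<rho>\<^sup>2"
      "\<bar>B z (y - z) (y - z)\<bar> \<le> K * \<rho>\<^sup>2" "\<bar>B z (m - z) (m - z)\<bar> \<le> K * \<rho>\<^sup>2"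
    using B_bound[OF Q(1) n(3,2)] B_bound[OF Q(1) n(3) x] B_bound[OF Q(1) n(3,3)]
      B_bound[OF Q(1) n(1,1)] B_bound[OF Q(1) n(2,2)]
    by (simp_all add: power2_eq_square mult_ac)
  have C: "\<bar>C z k (m - z) (m - z)\<bar> \<le> K * \<rho> ^ 3" "\<bar>C z k x x\<bar> \<le> 4 * (K * \<rho> ^ 3)" "\<bar>C z k k x\<bar> \<le> 2 * (K * \<rho> ^ 3)"
     "\<bar>C z k k k\<bar> \<le> K * \<rho> ^ 3" "\<bar>C z (y - z) (y - z) (y - z)\<bar> \<le> K * \<rho> ^ 3" "\<bar>C z (m - z) (m - z) (m - z)\<bar> \<le> K * \<rho> ^ 3"
    using C_bound[OF Q(1) n(3,2,2)] C_bound[OF Q(1) n(3) x x] C_bound[OF Q(1) n(3,3) x]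
      C_bound[OF Q(1) n(3,3,3)] C_bound[OF Q(1) n(1,1,1)] C_bound[OF Q(1) n(2,2,2)]
    by (simp_all add: power3_eq_cube mult_ac)
  show "\<bar>u y - P z (y - z - k) - L m k\<bar> \<le> 10 * (K * \<rho>\<^sup>2)"
    using P_increment[OF Q(1), of x k] e0(1) e1 B(1-3) C(1-4) p(1,2)
    unfolding x_def[symmetric] abs_le_iff by (intro conjI) linarith+
  have "\<bar>L z (y - z)\<bar> \<le> K * \<rho>" "\<bar>L z (m - z)\<bar> \<le> K * \<rho>" using L_bound[OF Q(1)] n by auto
  moreover have "x + k = y - z" by (simp add: x_def)
  ultimately show "\<bar>u y - u m\<bar> \<le> 6 * (K * \<rho>)"
    using e0 B(4,5) C(5,6) p unfolding P_def abs_le_iff by (simp only:) (intro conjI; linarith)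
qed

text \<open>Pairing \<open>\<xi>\<close> with \<open>- \<xi>\<close> removes the odd powers of the
  noise. The terms of order \<open>h\<close> are those of \<open>equation\<close> and cancel against
  \<open>h * c z\<close> and \<open>h * g z\<close>. There remain terms with two factors of the
  drift, or with one factor of the drift and two of the noise, and the product of the corrections of
  order \<open>h\<close>.\<close>

lemma average_estimate:
  assumes z: "z \<in> Q" and h: "0 < h" "h \<le> 1"
  shows "\<bar>(\<Sum>\<xi>\<in>sign_cube. P z (h, h *\<^sub>R b z + sqrt h *\<^sub>R (\<sigma> z *v \<xi>)) * (1 + h * c z) + h * g z)
      - card (sign_cube :: (real ^ 'n) set) * u z\<bar>
    \<le> card (sign_cube :: (real ^ 'n) set) * (40 * K ^ 5 * h\<^sup>2)"
proof -
  define N where "N = real (card (sign_cube :: (real ^ 'n) set))"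
  have N: "N \<ge> 0" by (simp add: N_def)
  define a where "a = h *\<^sub>R (1 :: real, b z)"
  define e where "e = (\<lambda>\<xi>. (0 :: real, \<sigma> z *v \<xi>))"
  define d where "d = (\<lambda>\<xi>. sqrt h *\<^sub>R e \<xi>)"
  define E where "E = (\<lambda>\<xi>. B z a a / 2 + C z a a a / 6 + C z a (d \<xi>) (d \<xi>) / 2)"
  have arg: "(h, h *\<^sub>R b z + sqrt h *\<^sub>R (\<sigma> z *v \<xi>)) = a + d \<xi>" for \<xi>
    by (simp add: a_def d_def e_def)
  have neg: "d (- \<xi>) = - d \<xi>" for \<xi> by (simp add: d_def e_def linear_neg[OF matrix_vector_mul_linear])
  have "(\<Sum>\<xi>\<in>sign_cube. P z (a + d \<xi>)) = (\<Sum>\<xi>\<in>sign_cube. P z (a - d \<xi>))"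
    by (rule sum.reindex_bij_witness[of _ uminus uminus]) (auto simp: neg sign_cube_def)
  hence "2 * (\<Sum>\<xi>\<in>sign_cube. P z (a + d \<xi>)) = (\<Sum>\<xi>\<in>sign_cube. P z (a + d \<xi>) + P z (a - d \<xi>))"
    by (simp add: sum.distrib)
  also have "\<dots> = (\<Sum>\<xi>\<in>sign_cube. 2 * (u z + L z a + B z (d \<xi>) (d \<xi>) / 2 + E \<xi>))"
    unfolding P_even[OF z] by (intro sum.cong) (simp_all add: E_def)
  finally have S: "(\<Sum>\<xi>\<in>sign_cube. P z (a + d \<xi>)) = (\<Sum>\<xi>\<in>sign_cube. u z + L z a + B z (d \<xi>) (d \<xi>) / 2 + E \<xi>)"
    unfolding sum_distrib_left[symmetric] by linarith
  have "B z (d \<xi>) (d \<xi>) = h * B z (e \<xi>) (e \<xi>)" for \<xi>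
    using h by (simp add: d_def B_simps[OF z] mult.assoc[symmetric])
  moreover have "L z a = h * L z (1, b z)" by (simp only: a_def L_simps)
  ultimately have "(\<Sum>\<xi>\<in>sign_cube. P z (a + d \<xi>)) =
      N * u z + h * (N * L z (1, b z) + (\<Sum>\<xi>\<in>sign_cube. B z (e \<xi>) (e \<xi>)) / 2) + sum E sign_cube"
    unfolding S by (simp add: sum.distrib N_def sum_distrib_left sum_divide_distrib algebra_simps)
  also have "N * L z (1, b z) + (\<Sum>\<xi>\<in>sign_cube. B z (e \<xi>) (e \<xi>)) / 2 = - N * (c z * u z + g z)"
    using equation[OF z] by (simp add: N_def e_def algebra_simps)
  finally have SP: "(\<Sum>\<xi>\<in>sign_cube. P z (a + d \<xi>)) = N * u z - h * N * (c z * u z + g z) + sum E sign_cube"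
    by (simp add: algebra_simps)
  have K0: "0 \<le> K" using K by simp
  have na: "norm a \<le> 2 * K * h"
  proof -
    have "norm (1 :: real, b z) \<le> norm (1 :: real) + norm (b z)" by (rule norm_Pair_le)
    also have "\<dots> \<le> 2 * K" using b_le[OF z] K by simp
    finally have "h * norm (1 :: real, b z) \<le> h * (2 * K)" using h by (intro mult_left_mono) auto
    thus ?thesis unfolding a_def norm_scaleR using h by (simp add: mult_ac)
  qed
  have nd: "norm (d \<xi>) \<le> K * sqrt h" if "\<xi> \<in> sign_cube" for \<xi>
  proof -
    have "norm (d \<xi>) = sqrt h * norm (\<sigma> z *v \<xi>)" unfolding d_def norm_scaleR using h by (simp add: e_def)
    also have "\<dots> \<le> sqrt h * K" using \<sigma>_le[OF z that] h by (intro mult_left_mono) auto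
    finally show ?thesis by (simp add: mult.commute)
  qed
  have E: "\<bar>E \<xi>\<bar> \<le> 6 * K ^ 4 * h\<^sup>2" if "\<xi> \<in> sign_cube" for \<xi>
  proof -
    have "\<bar>B z a a\<bar> \<le> 4 * (K ^ 3 * h\<^sup>2)" using B_bound[OF z na na]
      by (simp add: power2_eq_square power3_eq_cube mult_ac)
    also have "\<dots> \<le> 4 * (K ^ 4 * h\<^sup>2)" using K by (intro mult_left_mono mult_right_mono power_increasing) auto
    finally have 1: "\<bar>B z a a\<bar> \<le> 4 * (K ^ 4 * h\<^sup>2)" .
    have "\<bar>C z a a a\<bar> \<le> 8 * (K ^ 4 * h ^ 3)" using C_bound[OF z na na na]
      by (simp add: power3_eq_cube power4_eq_xxxx mult_ac)
    also have "\<dots> \<le> 8 * (K ^ 4 * h\<^sup>2)" using K h by (intro mult_left_mono power_decreasing) auto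
    finally have 2: "\<bar>C z a a a\<bar> \<le> 8 * (K ^ 4 * h\<^sup>2)" .
    have "\<bar>C z a (d \<xi>) (d \<xi>)\<bar> \<le> K * (2 * K * h) * (K * sqrt h) * (K * sqrt h)"
      using C_bound[OF z na nd[OF that] nd[OF that]] .
    also have "\<dots> = 2 * (K ^ 4 * (h * (sqrt h * sqrt h)))" by (simp add: power4_eq_xxxx mult_ac)
    also have "\<dots> = 2 * (K ^ 4 * h\<^sup>2)" using h by (simp add: power2_eq_square)
    finally have 3: "\<bar>C z a (d \<xi>) (d \<xi>)\<bar> \<le> 2 * (K ^ 4 * h\<^sup>2)" .
    have "0 \<le> K ^ 4 * h\<^sup>2" using K0 by simp
    thus ?thesis using 1 2 3 unfolding E_def by (simp add: abs_if split: if_splits)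
  qed
  have sE: "\<bar>sum E sign_cube\<bar> \<le> N * (6 * K ^ 4 * h\<^sup>2)"
    using sum_bounded_above[of sign_cube "\<lambda>\<xi>. \<bar>E \<xi>\<bar>" "6 * K ^ 4 * h\<^sup>2"] E
    by (intro order_trans[OF sum_abs]) (auto simp: N_def)
  \<comment> \<open>With \<open>SP\<close> inserted, all terms of order \<open>h\<close> cancel; the
    product of the two corrections and the remainder \<open>E\<close> are left.\<close>
  have "(\<Sum>\<xi>\<in>sign_cube. P z (a + d \<xi>) * (1 + h * c z) + h * g z) - N * u z =
     (\<Sum>\<xi>\<in>sign_cube. P z (a + d \<xi>)) * (1 + h * c z) + N * (h * g z) - N * u z"
    by (simp add: sum.distrib sum_distrib_right N_def)
  also have "\<dots> = - N * h\<^sup>2 * (c z * (c z * u z + g z)) + sum E sign_cube * (1 + h * c z)"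
    unfolding SP by (simp add: algebra_simps power2_eq_square)
  finally have eq: "(\<Sum>\<xi>\<in>sign_cube. P z (a + d \<xi>) * (1 + h * c z) + h * g z) - N * u z =
     - N * h\<^sup>2 * (c z * (c z * u z + g z)) + sum E sign_cube * (1 + h * c z)" .
  have cu: "\<bar>c z * u z\<bar> \<le> K * K" using c_le[OF z] u_le[OF z] K0 by (simp add: abs_mult mult_mono)
  have KK: "1 * K \<le> K * K" using K by (intro mult_right_mono) auto
  have "\<bar>c z * u z + g z\<bar> \<le> 2 * (K * K)" using cu g_le[OF z] KK by linarith
  hence "\<bar>c z * (c z * u z + g z)\<bar> \<le> K * (2 * (K * K))"
    unfolding abs_mult using c_le[OF z] K0 by (intro mult_mono) auto
  also have "\<dots> = 2 * K ^ 3" by (simp add: power3_eq_cube)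
  also have "\<dots> \<le> 2 * K ^ 5" using K by (intro mult_left_mono power_increasing) auto
  finally have "N * h\<^sup>2 * \<bar>c z * (c z * u z + g z)\<bar> \<le> N * h\<^sup>2 * (2 * K ^ 5)" using N by (intro mult_left_mono) auto
  hence t1: "\<bar>- N * h\<^sup>2 * (c z * (c z * u z + g z))\<bar> \<le> N * (2 * K ^ 5 * h\<^sup>2)"
    using N by (simp add: abs_mult mult_ac)
  have hc: "\<bar>h * c z\<bar> \<le> 1 * K" unfolding abs_mult using c_le[OF z] h by (intro mult_mono) auto
  hence "\<bar>1 + h * c z\<bar> \<le> 2 * K" using K by (simp add: abs_if split: if_splits)
  hence "\<bar>sum E sign_cube * (1 + h * c z)\<bar> \<le> N * (6 * K ^ 4 * h\<^sup>2) * (2 * K)"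
    unfolding abs_mult using sE N K0 by (intro mult_mono) auto
  also have "\<dots> = N * (12 * K ^ 5 * h\<^sup>2)" by (simp add: eval_nat_numeral mult_ac)
  finally have t2: "\<bar>sum E sign_cube * (1 + h * c z)\<bar> \<le> N * (12 * K ^ 5 * h\<^sup>2)" .
  have "0 \<le> N * (K ^ 5 * h\<^sup>2)" using N K0 by simp
  hence "\<bar>- N * h\<^sup>2 * (c z * (c z * u z + g z)) + sum E sign_cube * (1 + h * c z)\<bar> \<le> N * (40 * K ^ 5 * h\<^sup>2)"
    using t1 t2 by linarith
  thus ?thesis unfolding arg eq[symmetric] N_def[symmetric] .
qed

end

section \<open>Algebra of the reflected steps\<close>

text \<open>\<open>v\<close>, \<open>U\<close> and \<open>p\<close> stand for the value of
  \<open>u\<close> at the new point, its value at the midpoint, and the polynomial at the auxiliary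
  point; \<open>D\<close> is the derivative along \<open>(\<mu>, \<nu>)\<close>. The boundary
  relation \<open>D = \<beta> - \<alpha> * U\<close> cancels the first- and second-order terms in
  \<open>r\<close>, apart from those grouped into the small differences
  \<open>v - p - 2 * (r * D)\<close> and \<open>v - U - r * D\<close>. The rest is cubic in
  \<open>r\<close> or carries the factor \<open>hc\<close>.\<close>

lemma reflect_algebra:
  fixes v p :: real
  assumes "D = \<beta> - \<alpha> * U"
  shows "v * (1 + hc + 2 * r * \<alpha> + 2 * r\<^sup>2 * \<alpha>\<^sup>2) - 2 * r * \<beta> - 2 * r\<^sup>2 * \<alpha> * \<beta> - p * (1 + hc)
    = (v - p - 2 * (r * D)) + (v - U - r * D) * (2 * r * \<alpha> + 2 * r\<^sup>2 * \<alpha>\<^sup>2) + 2 * r ^ 3 * \<alpha>\<^sup>2 * D + (v - p) * hc"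
  unfolding assms by (simp add: algebra_simps power2_eq_square power3_eq_cube)

text \<open>The clock reaches the final time during the reflection. Elapsed time and normal
  displacement are no longer in the ratio of \<open>\<mu>\<close> to \<open>\<nu>\<close>, so the
  time derivative \<open>\<tau>1\<close> and the normal derivative \<open>n\<close> enter
  separately, with \<open>\<tau> = 2 * p * m\<close> the time that is left.\<close>

lemma late_reflect_algebra:
  fixes v P :: real
  assumes "\<tau>1 = - A - c * U - g" "n = \<psi> - \<gamma> * U + m * A" "\<tau> = 2 * p * m"
  shows "v * (1 + hc + (2 * r * \<gamma> + 2 * p * m * c)) + (- 2 * m * (r - p) * A + 2 * p * m * g - 2 * r * \<psi>) - P * (1 + hc)
    = (v - P - (\<tau> * \<tau>1 + 2 * r * n)) + (v - U) * (2 * r * \<gamma> + 2 * p * m * c) + (v - P) * hc"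
  unfolding assms by (simp add: algebra_simps)

text \<open>The final time has already been reached by the auxiliary step; the time correction
  \<open>\<tau> * \<tau>1\<close> is not compensated by the scheme and has to be estimated.\<close>

lemma final_reflect_algebra:
  fixes v P :: real
  assumes "n = \<psi> - \<gamma> * U + m * A"
  shows "v * (1 + hc + (2 * r * \<gamma> + 2 * r\<^sup>2 * \<gamma>\<^sup>2))
      + (- 2 * r * m * A - 2 * r\<^sup>2 * \<gamma> * m * A - 2 * r * \<psi> - 2 * r\<^sup>2 * \<gamma> * \<psi>) - P * (1 + hc)
    = (v - P - (\<tau> * \<tau>1 + 2 * r * n)) + \<tau> * \<tau>1 + 2 * ((v - U) * (r * \<gamma>)) + 2 * (r\<^sup>2 * (\<gamma>\<^sup>2 * v))
      - 2 * (r\<^sup>2 * (\<gamma> * (m * A))) - 2 * (r\<^sup>2 * (\<gamma> * \<psi>)) + (v - P) * hc"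
  unfolding assms by (simp add: algebra_simps)

lemma abs_mult_le: "\<bar>x\<bar> \<le> a \<Longrightarrow> \<bar>y\<bar> \<le> b \<Longrightarrow> \<bar>x * y\<bar> \<le> a * (b :: real)"
  unfolding abs_mult by (intro mult_mono) auto

context sticky
begin

section \<open>Error of a single step, case by case\<close>

lemma K_power_le: "i \<le> j \<Longrightarrow> K ^ i \<le> K ^ j"
  using K by (rule power_increasing[rotated])

lemma K0: "0 \<le> K"
  using K by simp

context
  fixes h t :: real and X \<xi> :: "real ^ 'n"
  assumes h: "0 < h" and small: "16 * K\<^sup>2 * sqrt h \<le> 1" "2 * (16 * K\<^sup>2 * sqrt h) < \<delta>"
    and t: "0 \<le> t" "t < T" and X: "X \<in> closure G" and \<xi>: "\<xi> \<in> sign_cube"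
begin

private abbreviation "s \<equiv> sqrt h"
text \<open>One length that dominates every displacement of a step: \<open>2 * (K * s)\<close> from
  drift and noise, \<open>4 * (K * s)\<close> from a reflection and
  \<open>4 * (K\<^sup>2 * s)\<close> from its time advance.\<close>

private abbreviation "\<rho> \<equiv> 16 * K\<^sup>2 * s"
private abbreviation "z \<equiv> (t, X)"
private abbreviation "X' \<equiv> X + h *\<^sub>R b (t, X) + sqrt h *\<^sub>R (\<sigma> (t, X) *v \<xi>)"
private abbreviation "\<Delta> \<equiv> (h, h *\<^sub>R b (t, X) + sqrt h *\<^sub>R (\<sigma> (t, X) *v \<xi>))"

private lemma zQ: "z \<in> Q"
  using t X by simp

private lemma KK: "1 \<le> K\<^sup>2" "K \<le> K\<^sup>2"
  using K K_power_le[of 0 2] K_power_le[of 1 2] by simp_all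

private lemma s: "0 < s" "s \<le> 1" "h \<le> s" "s * s = h" "h \<le> 1"
proof -
  show s0: "0 < s" using h by simp
  have "1 * s \<le> 16 * K\<^sup>2 * s" using KK s0 by (intro mult_right_mono) auto
  thus s1: "s \<le> 1" using small by linarith
  show ss: "s * s = h" using h by simp
  have "s * s \<le> s * 1" using s1 s0 by (intro mult_left_mono) auto
  thus "h \<le> s" using ss by linarith
  thus "h \<le> 1" using s1 by linarith
qed

private lemma Ks: "s \<le> K\<^sup>2 * s" "K * s \<le> K\<^sup>2 * s"
  using mult_right_mono[OF KK(1), of s] mult_right_mono[OF KK(2), of s] s by auto

private lemma \<rho>_powers: "\<rho>\<^sup>2 = 256 * (K ^ 4 * h)" "\<rho> ^ 4 = 65536 * (K ^ 8 * h\<^sup>2)"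
proof -
  show 2: "\<rho>\<^sup>2 = 256 * (K ^ 4 * h)" using h by (simp add: power_mult_distrib)
  have "\<rho> ^ 4 = (\<rho>\<^sup>2)\<^sup>2" by (simp only: power_mult[symmetric]) simp
  thus "\<rho> ^ 4 = 65536 * (K ^ 8 * h\<^sup>2)" unfolding 2 by (simp add: power_mult_distrib)
qed

private lemma X'_near: "norm (X' - X) \<le> 2 * (K * s)"
proof -
  have "norm (h *\<^sub>R b z) \<le> s * K"
    using b_le[OF zQ] s h by (simp add: mult_mono)
  moreover have "norm (s *\<^sub>R (\<sigma> z *v \<xi>)) \<le> s * K"
    using \<sigma>_le[OF zQ \<xi>] s h by (simp add: mult_left_mono)
  ultimately have "norm (h *\<^sub>R b z + s *\<^sub>R (\<sigma> z *v \<xi>)) \<le> 2 * (K * s)"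
    by (intro order_trans[OF norm_triangle_ineq]) (simp add: mult.commute)
  thus ?thesis by (simp add: algebra_simps)
qed

private lemma data_le:
  "\<bar>h * c z\<bar> \<le> h * K" "\<bar>h * c z\<bar> \<le> K"
proof -
  show *: "\<bar>h * c z\<bar> \<le> h * K" using c_le[OF zQ] h by (simp add: abs_mult mult_left_mono)
  have "h * K \<le> 1 * K" using s K by (intro mult_right_mono) auto
  thus "\<bar>h * c z\<bar> \<le> K" using * by simp
qed

lemma step_size_le_1: "h \<le> 1"
  by (rule s(5))

text \<open>The only error is the fourth-order Taylor remainder, and \<open>\<rho> ^ 4\<close> is of
  order \<open>h\<^sup>2\<close>.\<close>

private lemma inside_estimate:
  assumes "X' \<in> closure G" "t + h < T"
  shows "\<bar>u (t + h, X') * (1 + h * c z) - P z \<Delta> * (1 + h * c z)\<bar> \<le> 10000000 * (K ^ 10 * (h * h))"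
proof -
  have d: "(t + h, X') - z = \<Delta>" by simp
  have "norm \<Delta> \<le> norm h + norm (X' - X)" using norm_Pair_le[of h "X' - X"] by (simp add: algebra_simps)
  also have "\<dots> \<le> \<rho>" using X'_near h s Ks unfolding real_norm_def abs_of_pos[OF h] by linarith
  finally have n: "norm ((t + h, X') - z) \<le> \<rho>" unfolding d .
  have "0 \<le> \<rho>" using s by simp
  hence "\<rho> < \<delta>" using small by linarith
  moreover have "(t + h, X') \<in> Q" using assms t h by simp
  ultimately have "\<bar>u (t + h, X') - P z \<Delta>\<bar> \<le> K * \<rho> ^ 4"
    using expand0'[OF zQ _ n] unfolding d by blast
  also have "\<dots> = 65536 * (K ^ 9 * (h * h))" unfolding \<rho>_powers by (simp add: eval_nat_numeral mult_ac)
  finally have 1: "\<bar>u (t + h, X') - P z \<Delta>\<bar> \<le> 65536 * (K ^ 9 * (h * h))" .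
  have "\<bar>1 + h * c z\<bar> \<le> 2 * K" using data_le(2) K by linarith
  from abs_mult_le[OF 1 this]
  have "\<bar>(u (t + h, X') - P z \<Delta>) * (1 + h * c z)\<bar> \<le> 131072 * (K ^ 10 * (h * h))"
    by (simp add: eval_nat_numeral mult_ac)
  moreover have "0 \<le> K ^ 10 * (h * h)" using K0 by simp
  ultimately show ?thesis unfolding left_diff_distrib by linarith
qed

text \<open>Common to all ways of stopping: \<open>(\<tau>, w)\<close> is the displacement from the
  auxiliary point to the state in which the chain stops, and \<open>\<tau>\<close> is negative or
  zero when the auxiliary step has reached the final time. The derivative is taken at
  \<open>(T, y)\<close>, where \<open>y\<close> will be \<open>X'\<close> or its projection.\<close>

private lemma terminal_step:
  assumes \<tau>: "T = t + h + \<tau>" "\<bar>\<tau>\<bar> \<le> 4 * (K\<^sup>2 * s)"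
    and w: "norm w \<le> 4 * (K * s)" "X' + w \<in> closure G"
    and y: "norm (y - X') \<le> 2 * (K * s)" "y \<in> closure G"
  shows "\<bar>u (T, X' + w) - P z \<Delta> - L (T, y) (\<tau>, w)\<bar> \<le> 2560 * (K ^ 5 * h)"
    and "\<bar>u (T, X' + w) - u (T, y)\<bar> \<le> 96 * (K ^ 3 * s)"
    and "\<bar>(u (T, X' + w) - P z \<Delta>) * (h * c z)\<bar> \<le> 2561 * (K ^ 6 * h)"
proof -
  note facts = X'_near h s Ks \<tau> w(1) y(1)
  have T0: "0 \<le> T" using t by simp
  have dt: "\<bar>T - t\<bar> \<le> h + 4 * (K\<^sup>2 * s)" using \<tau> h by linarith
  have "norm (T - t, X' + w - X) \<le> norm (T - t) + norm (X' + w - X)" by (rule norm_Pair_le)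
  also have "norm (X' + w - X) \<le> norm (X' - X) + norm w"
    using norm_triangle_ineq[of "X' - X" w] by (simp add: algebra_simps)
  finally have n1: "norm ((T, X' + w) - z) \<le> \<rho>"
    using dt facts unfolding real_norm_def minus_prod_def fst_conv snd_conv by linarith
  have "norm (T - t, y - X) \<le> norm (T - t) + norm (y - X)" by (rule norm_Pair_le)
  also have "norm (y - X) \<le> norm (X' - X) + norm (y - X')"
    using norm_triangle_ineq[of "X' - X" "y - X'"] by simp
  finally have n2: "norm ((T, y) - z) \<le> \<rho>"
    using dt facts unfolding real_norm_def minus_prod_def fst_conv snd_conv by linarith
  have "norm (\<tau>, w) \<le> norm \<tau> + norm w" by (rule norm_Pair_le)
  hence n3: "norm (\<tau>, w) \<le> \<rho>" using facts unfolding real_norm_def by linarith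
  have d: "(T, X' + w) - z - (\<tau>, w) = \<Delta>" using \<tau> by simp
  have Qs: "(T, X' + w) \<in> Q" "(T, y) \<in> Q" using w y T0 by auto
  show 1: "\<bar>u (T, X' + w) - P z \<Delta> - L (T, y) (\<tau>, w)\<bar> \<le> 2560 * (K ^ 5 * h)"
    using terminal_estimate(1)[OF zQ Qs n1 n2 n3 small] unfolding d \<rho>_powers
    by (simp add: eval_nat_numeral mult_ac)
  show "\<bar>u (T, X' + w) - u (T, y)\<bar> \<le> 96 * (K ^ 3 * s)"
    using terminal_estimate(2)[OF zQ Qs n1 n2 n3 small]
    by (simp add: eval_nat_numeral mult_ac)
  have "\<bar>L (T, y) (\<tau>, w)\<bar> \<le> K * 1"
    using n3 small by (intro L_bound Qs) auto
  moreover have "K ^ 5 * h \<le> K ^ 5 * 1" using s K0 by (intro mult_left_mono) auto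
  moreover have "K \<le> K ^ 5" using K_power_le[of 1 5] by simp
  ultimately have "\<bar>u (T, X' + w) - P z \<Delta>\<bar> \<le> 2561 * K ^ 5" using 1 by linarith
  from abs_mult_le[OF this data_le(1)]
  show "\<bar>(u (T, X' + w) - P z \<Delta>) * (h * c z)\<bar> \<le> 2561 * (K ^ 6 * h)"
    by (simp add: eval_nat_numeral mult_ac)
qed

private lemma stop_inside_estimate:
  assumes "X' \<in> closure G" "T \<le> t + h"
  shows "\<bar>u (T, X') * (1 + h * c z) - P z \<Delta> * (1 + h * c z)\<bar> \<le> 10000000 * (K ^ 10 * h)"
proof -
  define \<tau> where "\<tau> = T - (t + h)"
  have \<tau>: "T = t + h + \<tau>" "\<bar>\<tau>\<bar> \<le> h" using assms t by (auto simp: \<tau>_def)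
  have \<tau>s: "\<bar>\<tau>\<bar> \<le> 4 * (K\<^sup>2 * s)" using \<tau>(2) s Ks by linarith
  have Ks0: "0 \<le> K * s" using K0 s(1) by simp
  note est = terminal_step[OF \<tau>(1) \<tau>s, of 0 X', simplified, OF Ks0 assms(1)]
  have TQ: "(T, X') \<in> Q" using assms t by simp
  have "\<bar>L (T, X') (\<tau>, 0)\<bar> \<le> K * h" using \<tau>(2) by (intro L_bound TQ) simp
  moreover have "K * h \<le> K ^ 10 * h" "K ^ 5 * h \<le> K ^ 10 * h" "K ^ 6 * h \<le> K ^ 10 * h"
    using K_power_le[of 1 10] K_power_le[of 5 10] K_power_le[of 6 10] h by (auto intro: mult_right_mono)
  moreover have "0 \<le> K ^ 10 * h" using K0 h by simp
  moreover have "u (T, X') * (1 + h * c z) - P z \<Delta> * (1 + h * c z)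
      = (u (T, X') - P z \<Delta>) + (u (T, X') - P z \<Delta>) * (h * c z)" by (simp add: algebra_simps)
  ultimately show ?thesis using est(1,3) h by linarith
qed

context
  assumes out: "X' \<notin> closure G"
begin

private abbreviation "r \<equiv> infdist X' (frontier G)"
private abbreviation "y \<equiv> boundary_proj G \<nu> X'"
private abbreviation "m \<equiv> \<mu> y"

private lemma r_le: "r \<le> 2 * (K * s)" "r \<le> 1" "r\<^sup>2 \<le> 4 * (K\<^sup>2 * h)"
proof -
  show *: "r \<le> 2 * (K * s)" using infdist_crossing[OF X out] X'_near by simp
  thus "r \<le> 1" using small Ks s by linarith
  have "r\<^sup>2 \<le> (2 * (K * s))\<^sup>2" using * infdist_nonneg by (rule power_mono)
  thus "r\<^sup>2 \<le> 4 * (K\<^sup>2 * h)" using h by (simp add: power_mult_distrib)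
qed

lemma proj_facts: "0 < r" "y \<in> frontier G" "y = X' + r *\<^sub>R \<nu> y" "X' + (2 * r) *\<^sub>R \<nu> y \<in> closure G"
proof -
  have "r < \<delta>" using r_le(1) Ks small s by linarith
  note p = proj[OF out this]
  show "0 < r" "y \<in> frontier G" "y = X' + r *\<^sub>R \<nu> y" using p by blast+
  have "X' + (2 * r) *\<^sub>R \<nu> y = (X' + r *\<^sub>R \<nu> y) + r *\<^sub>R \<nu> y" by (simp add: scaleR_add_left[symmetric] add.assoc)
  also have "\<dots> = y + r *\<^sub>R \<nu> y" using p by metis
  also have "\<dots> \<in> closure G" using p closure_subset by blast
  finally show "X' + (2 * r) *\<^sub>R \<nu> y \<in> closure G" .
qed

lemma m_facts: "0 < m" "m \<le> K" "1 \<le> K * m" "norm (\<nu> y) = 1" "y \<in> closure G"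
proof -
  show "m \<le> K" "1 \<le> K * m" "norm (\<nu> y) = 1" "y \<in> closure G"
    using \<mu>_le \<mu>_ge \<nu>_norm proj_facts frontier_closure by blast+
  thus "0 < m" using K by (metis not_one_le_zero zero_less_mult_pos less_le_trans zero_less_one)
qed

text \<open>Every term of \<open>reflect_algebra\<close> is of order \<open>h * (h + r)\<close>: the
  midpoint rule by \<open>reflect_estimate\<close>, the next term as \<open>O(h)\<close> times
  \<open>O(r)\<close>, and the cubic term because \<open>r\<^sup>2\<close> is
  \<open>O(h)\<close>.\<close>

lemma reflect_step:
  assumes t'': "t + h + 2 * r * m < T"
  defines "q \<equiv> (t + h + r * m, y)"
  defines "\<alpha> \<equiv> \<gamma> q + m * c q" and "\<beta> \<equiv> \<psi> q - m * g q"
  shows "\<bar>u (t + h + 2 * r * m, X' + (2 * r) *\<^sub>R \<nu> y) * (1 + h * c z + 2 * r * \<alpha> + 2 * r\<^sup>2 * \<alpha>\<^sup>2)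
      - 2 * r * \<beta> - 2 * r\<^sup>2 * \<alpha> * \<beta> - P z \<Delta> * (1 + h * c z)\<bar> \<le> 10000000 * (K ^ 10 * (h * (h + r)))"
    and "\<bar>1 + h * c z + 2 * r * \<alpha> + 2 * r\<^sup>2 * \<alpha>\<^sup>2\<bar> \<le> 1 + 12 * (K ^ 4 * (h + r))"
proof -
  note r0 = proj_facts(1)
  have rm: "0 \<le> r * m" using r0 m_facts by simp
  have q_t: "t + h + r * m \<in> {0..T}" using rm t h t'' by simp
  have qQ: "q \<in> Q" using q_t m_facts(5) by (simp add: q_def)
  \<comment> \<open>Half of the reflection in space and time: \<open>q + k\<close> is the new point
    and \<open>q - k\<close> the auxiliary one.\<close>
  define k where "k = r *\<^sub>R (m, \<nu> y)"
  have qk: "q + k = (t + h + 2 * r * m, X' + (2 * r) *\<^sub>R \<nu> y)"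
  proof -
    have "y + r *\<^sub>R \<nu> y = (X' + r *\<^sub>R \<nu> y) + r *\<^sub>R \<nu> y" using proj_facts(3) by simp
    also have "\<dots> = X' + (2 * r) *\<^sub>R \<nu> y" by (simp add: scaleR_add_left[symmetric] add.assoc)
    finally show ?thesis by (simp add: q_def k_def)
  qed
  have qkQ: "q + k \<in> Q" unfolding qk using t'' rm t h proj_facts(4) by simp
  have yX: "y - r *\<^sub>R \<nu> y = X'" using proj_facts(3) by (metis add_diff_cancel_right')
  have "y - X - r *\<^sub>R \<nu> y = (y - r *\<^sub>R \<nu> y) - X" by simp
  also have "\<dots> = X' - X" by (simp only: yX)
  also have "\<dots> = h *\<^sub>R b z + s *\<^sub>R (\<sigma> z *v \<xi>)" by simp
  finally have "y - X - r *\<^sub>R \<nu> y = h *\<^sub>R b z + s *\<^sub>R (\<sigma> z *v \<xi>)" .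
  hence qz: "q - z - k = \<Delta>" by (simp add: q_def k_def)
  have "norm (m, \<nu> y) \<le> norm m + norm (\<nu> y)" by (rule norm_Pair_le)
  hence nw: "norm (m, \<nu> y) \<le> 2 * K" using m_facts K by simp
  have k: "norm k \<le> 2 * (K * r)" using mult_left_mono[OF nw, of r] r0
    unfolding k_def norm_scaleR by (simp add: mult_ac)
  have "K * r \<le> K * (2 * (K * s))" using r_le(1) K by (intro mult_left_mono) auto
  hence Kr: "K * r \<le> 2 * (K\<^sup>2 * s)" by (simp add: power2_eq_square)
  hence kr: "2 * (K * r) \<le> \<rho>" using Ks s by linarith
  have "norm \<Delta> \<le> norm h + norm (X' - X)" using norm_Pair_le[of h "X' - X"] by (simp add: algebra_simps)
  moreover have "norm (q - z) \<le> norm \<Delta> + norm k"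
    using norm_triangle_ineq[of \<Delta> k] unfolding qz[symmetric] by simp
  ultimately have nq: "norm (q - z) \<le> \<rho>"
    using X'_near h s Ks k Kr unfolding real_norm_def abs_of_pos[OF h] by linarith
  define U where "U = u q"
  define D where "D = L q (m, \<nu> y)"
  define v where "v = u (q + k)"
  define p where "p = P z \<Delta>"
  have Lk: "L q k = r * D" by (simp only: k_def D_def L_simps)
  note est = reflect_estimate[OF zQ qQ qkQ nq k kr small(1), unfolded qz Lk, folded v_def p_def U_def]
  define H where "H = K ^ 10 * (h * (h + r))"
  have hr: "h * h \<le> h * (h + r)" "h * r \<le> h * (h + r)" using h r0 by auto
  have pw: "K ^ i * (h * h) \<le> H" "K ^ i * (h * r) \<le> H" if "i \<le> 10" for i
    unfolding H_def using K_power_le[OF that] hr h r0 K0 by (auto intro!: mult_mono)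
  have H0: "0 \<le> H" using K0 h r0 by (simp add: H_def)
  have E1: "\<bar>v - p - 2 * (r * D)\<bar> \<le> 1050112 * H"
  proof -
    have "\<bar>v - p - 2 * (r * D)\<bar> \<le> 16 * (K * \<rho> ^ 4) + 3 * (K * (2 * (K * r)) * \<rho>\<^sup>2)"
      using est(1)[OF small(2)] by simp
    also have "\<dots> = 1048576 * (K ^ 9 * (h * h)) + 1536 * (K ^ 6 * (h * r))"
      unfolding \<rho>_powers by (simp add: eval_nat_numeral mult_ac)
    finally show ?thesis using pw(1)[of 9] pw(2)[of 6] by simp
  qed
  have E2: "\<bar>v - U - r * D\<bar> \<le> 512 * (K ^ 5 * h)"
    using est(2)[OF small(2)] unfolding \<rho>_powers by (simp add: eval_nat_numeral mult_ac)
  have mc: "\<bar>m * c q\<bar> \<le> K * K" "\<bar>m * g q\<bar> \<le> K * K"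
    using m_facts c_le[OF qQ] g_le[OF qQ] by (auto intro: abs_mult_le)
  have "\<bar>\<gamma> q\<bar> \<le> K" "\<bar>\<psi> q\<bar> \<le> K" using \<gamma>_le[OF q_t proj_facts(2)] \<psi>_le[OF q_t proj_facts(2)] by (simp_all add: q_def)
  hence ab: "\<bar>\<alpha>\<bar> \<le> 2 * K\<^sup>2" "\<bar>\<beta>\<bar> \<le> 2 * K\<^sup>2"
    using mc KK unfolding \<alpha>_def \<beta>_def power2_eq_square by linarith+
  have D: "\<bar>D\<bar> \<le> 2 * K\<^sup>2" using L_bound[OF qQ nw] by (simp add: D_def power2_eq_square)
  have rr: "r\<^sup>2 \<le> r" using r0 r_le(2) power_decreasing[of 1 2 r] by simp
  have a2: "\<alpha>\<^sup>2 \<le> 4 * K ^ 4"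
    using abs_mult_le[OF ab(1,1)] by (simp add: power2_eq_square eval_nat_numeral mult_ac)
  have f1: "\<bar>2 * r * \<alpha>\<bar> \<le> 4 * (K ^ 4 * r)"
  proof -
    have "\<bar>r * \<alpha>\<bar> \<le> r * (2 * K\<^sup>2)" using ab r0 by (intro abs_mult_le) auto
    also have "\<dots> \<le> r * (2 * K ^ 4)" using K_power_le[of 2 4] r0 by (intro mult_left_mono) auto
    finally show ?thesis by (simp add: abs_mult mult_ac)
  qed
  have "r\<^sup>2 * \<alpha>\<^sup>2 \<le> r * (4 * K ^ 4)" using rr a2 r0 by (intro mult_mono) auto
  hence f2: "\<bar>2 * r\<^sup>2 * \<alpha>\<^sup>2\<bar> \<le> 8 * (K ^ 4 * r)" by (simp add: abs_mult mult_ac)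
  have f: "\<bar>2 * r * \<alpha> + 2 * r\<^sup>2 * \<alpha>\<^sup>2\<bar> \<le> 12 * (K ^ 4 * r)" using f1 f2 by linarith
  have "h * K \<le> K ^ 4 * h" using K_power_le[of 1 4] h by (simp add: mult.commute)
  hence "\<bar>1 + h * c z + (2 * r * \<alpha> + 2 * r\<^sup>2 * \<alpha>\<^sup>2)\<bar> \<le> 1 + 12 * (K ^ 4 * h) + 12 * (K ^ 4 * r)"
    using f data_le(1) K0 h mult_nonneg_nonneg[of "K ^ 4" h] by linarith
  thus "\<bar>1 + h * c z + 2 * r * \<alpha> + 2 * r\<^sup>2 * \<alpha>\<^sup>2\<bar> \<le> 1 + 12 * (K ^ 4 * (h + r))"
    by (simp add: algebra_simps)
  have g1: "\<bar>(v - U - r * D) * (2 * r * \<alpha> + 2 * r\<^sup>2 * \<alpha>\<^sup>2)\<bar> \<le> 6144 * H"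
  proof -
    have "\<bar>(v - U - r * D) * (2 * r * \<alpha> + 2 * r\<^sup>2 * \<alpha>\<^sup>2)\<bar> \<le> 6144 * (K ^ 9 * (h * r))"
      using abs_mult_le[OF E2 f] by (simp add: eval_nat_numeral mult_ac)
    thus ?thesis using pw(2)[of 9] by simp
  qed
  have g2: "\<bar>2 * r ^ 3 * \<alpha>\<^sup>2 * D\<bar> \<le> 64 * H"
  proof -
    have "\<bar>r\<^sup>2 * (\<alpha>\<^sup>2 * D)\<bar> \<le> (4 * (K\<^sup>2 * h)) * ((4 * K ^ 4) * (2 * K\<^sup>2))"
      using r_le(3) a2 D by (intro abs_mult_le) auto
    from abs_mult_le[OF _ this, of r r]
    have "\<bar>r * (r\<^sup>2 * (\<alpha>\<^sup>2 * D))\<bar> \<le> r * ((4 * (K\<^sup>2 * h)) * ((4 * K ^ 4) * (2 * K\<^sup>2)))"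
      using r0 by simp
    hence "\<bar>2 * r ^ 3 * \<alpha>\<^sup>2 * D\<bar> \<le> 64 * (K ^ 8 * (h * r))"
      by (simp add: eval_nat_numeral mult_ac abs_mult)
    thus ?thesis using pw(2)[of 8] by simp
  qed
  \<comment> \<open>The difference \<open>v - p\<close> has the leading part
    \<open>2 * (r * D)\<close>, of order \<open>r\<close> only; the factor \<open>h * c z\<close>
    makes it \<open>O(r * h)\<close>.\<close>
  have g3: "\<bar>(v - p) * (h * c z)\<bar> \<le> 1060000 * H"
  proof -
    have "\<bar>r\<bar> \<le> r" using r0 by simp
    from abs_mult_le[OF abs_mult_le[OF this D] data_le(1)]
    have hc: "\<bar>(r * D) * (h * c z)\<bar> \<le> 2 * (K ^ 3 * (h * r))" by (simp add: eval_nat_numeral mult_ac)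
    have "\<bar>v - p - 2 * (r * D)\<bar> \<le> 1048576 * (K ^ 9 * (h * h)) + 1536 * (K ^ 6 * (h * r))"
      using est(1)[OF small(2)] unfolding \<rho>_powers by (simp add: eval_nat_numeral mult_ac)
    hence "\<bar>(v - p - 2 * (r * D)) * (h * c z)\<bar> \<le> (1048576 * (K ^ 9 * (h * h)) + 1536 * (K ^ 6 * (h * r))) * K"
      using data_le(2) by (rule abs_mult_le)
    also have "\<dots> = 1048576 * (K ^ 10 * (h * h)) + 1536 * (K ^ 7 * (h * r))"
      by (simp add: eval_nat_numeral algebra_simps)
    finally have "\<bar>(v - p - 2 * (r * D)) * (h * c z)\<bar> \<le> 1050112 * H"
      using pw(1)[of 10] pw(2)[of 7] by simp
    moreover have "\<bar>(r * D) * (h * c z)\<bar> \<le> 2 * H"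
      using hc pw(2)[of 3] by simp
    moreover have "(v - p) * (h * c z) = (v - p - 2 * (r * D)) * (h * c z) + 2 * ((r * D) * (h * c z))"
      by (simp add: algebra_simps)
    ultimately show ?thesis using H0 by linarith
  qed
  have DU: "D = \<beta> - \<alpha> * U"
    using boundary[OF q_t proj_facts(2)] by (simp add: D_def \<alpha>_def \<beta>_def U_def q_def)
  show "\<bar>u (t + h + 2 * r * m, X' + (2 * r) *\<^sub>R \<nu> y) * (1 + h * c z + 2 * r * \<alpha> + 2 * r\<^sup>2 * \<alpha>\<^sup>2)
      - 2 * r * \<beta> - 2 * r\<^sup>2 * \<alpha> * \<beta> - P z \<Delta> * (1 + h * c z)\<bar> \<le> 10000000 * (K ^ 10 * (h * (h + r)))"
    unfolding qk[symmetric] v_def[symmetric] p_def[symmetric] H_def[symmetric]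
      reflect_algebra[OF DU]
    using E1 g1 g2 g3 H0 by linarith
qed

text \<open>Splits the displacement \<open>(\<tau>, 2 r \<nu>)\<close> of a stopping reflection into
  its time and normal parts, for which \<open>final_time\<close> and \<open>final_normal\<close>
  give the derivatives separately.\<close>

private lemma exit_step:
  assumes \<tau>: "T = t + h + \<tau>" "\<bar>\<tau>\<bar> \<le> 4 * (K\<^sup>2 * s)"
  defines "v \<equiv> u (T, X' + (2 * r) *\<^sub>R \<nu> y)"
  defines "\<tau>1 \<equiv> L (T, y) (1, 0)" and "n \<equiv> L (T, y) (0, \<nu> y)"
  shows "\<bar>v - P z \<Delta> - (\<tau> * \<tau>1 + 2 * r * n)\<bar> \<le> 2560 * (K ^ 5 * h)"
    and "\<bar>v - u (T, y)\<bar> \<le> 96 * (K ^ 3 * s)"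
    and "\<bar>(v - P z \<Delta>) * (h * c z)\<bar> \<le> 2561 * (K ^ 6 * h)"
proof -
  define w where "w = (2 * r) *\<^sub>R \<nu> y"
  have w: "norm w \<le> 4 * (K * s)" using r_le(1) proj_facts(1) m_facts(4) unfolding w_def norm_scaleR by simp
  have wG: "X' + w \<in> closure G" using proj_facts(4) by (simp add: w_def)
  have "y - X' = r *\<^sub>R \<nu> y" using proj_facts(3) by (metis add_diff_cancel_left')
  hence "norm (y - X') = r" using m_facts(4) proj_facts(1) by (metis abs_of_pos mult.right_neutral norm_scaleR)
  hence yX: "norm (y - X') \<le> 2 * (K * s)" using r_le(1) by linarith
  have "(\<tau>, w) = \<tau> *\<^sub>R (1, 0) + (2 * r) *\<^sub>R (0, \<nu> y)" by (simp add: w_def)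
  hence Lw: "L (T, y) (\<tau>, w) = \<tau> * \<tau>1 + 2 * r * n" unfolding \<tau>1_def n_def by (simp only: L_simps)
  note est = terminal_step[OF \<tau> w wG yX m_facts(5), unfolded Lw, unfolded w_def, folded v_def]
  show "\<bar>v - P z \<Delta> - (\<tau> * \<tau>1 + 2 * r * n)\<bar> \<le> 2560 * (K ^ 5 * h)"
    and "\<bar>v - u (T, y)\<bar> \<le> 96 * (K ^ 3 * s)"
    and "\<bar>(v - P z \<Delta>) * (h * c z)\<bar> \<le> 2561 * (K ^ 6 * h)" using est by blast+
qed

text \<open>The bound on the generator of \<open>\<phi>\<close> is read off from
  \<open>final_time\<close>, as \<open>K + K\<^sup>2 + K \<le> 3 * K\<^sup>2\<close>.\<close>

private lemma final_bounds:
  "\<bar>\<gamma> (T, y)\<bar> \<le> K" "\<bar>\<psi> (T, y)\<bar> \<le> K" "\<bar>c (T, y)\<bar> \<le> K" "\<bar>g (T, y)\<bar> \<le> K" "\<bar>u (T, y)\<bar> \<le> K"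
  "\<bar>L (T, y) (1, 0)\<bar> \<le> K" "\<bar>generator T G b \<sigma> (\<lambda>(_, y). \<phi> y) (T, y)\<bar> \<le> 3 * K\<^sup>2"
proof -
  have TQ: "(T, y) \<in> Q" and T0: "T \<in> {0..T}" using m_facts(5) t by auto
  show "\<bar>\<gamma> (T, y)\<bar> \<le> K" "\<bar>\<psi> (T, y)\<bar> \<le> K" using \<gamma>_le \<psi>_le T0 proj_facts(2) by blast+
  show cg: "\<bar>c (T, y)\<bar> \<le> K" "\<bar>g (T, y)\<bar> \<le> K" "\<bar>u (T, y)\<bar> \<le> K" using c_le g_le u_le TQ by blast+
  show L1: "\<bar>L (T, y) (1, 0)\<bar> \<le> K" using L_bound[OF TQ, of "(1, 0)" 1] by simp
  have "\<bar>c (T, y) * u (T, y)\<bar> \<le> K\<^sup>2" using abs_mult_le[OF cg(1,3)] by (simp add: power2_eq_square)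
  moreover have "generator T G b \<sigma> (\<lambda>(_, y). \<phi> y) (T, y) = - L (T, y) (1, 0) - c (T, y) * u (T, y) - g (T, y)"
    using final_time[OF proj_facts(2)] by simp
  ultimately show "\<bar>generator T G b \<sigma> (\<lambda>(_, y). \<phi> y) (T, y)\<bar> \<le> 3 * K\<^sup>2"
    using cg L1 KK by linarith
qed

private lemma r\<gamma>_le: "\<bar>r * \<gamma> (T, y)\<bar> \<le> 2 * (K\<^sup>2 * s)" "\<bar>r * \<gamma> (T, y)\<bar> \<le> K"
proof -
  have "\<bar>r\<bar> \<le> 2 * (K * s)" "\<bar>r\<bar> \<le> 1" using r_le proj_facts(1) by auto
  from abs_mult_le[OF this(1) final_bounds(1)] abs_mult_le[OF this(2) final_bounds(1)]
  show "\<bar>r * \<gamma> (T, y)\<bar> \<le> 2 * (K\<^sup>2 * s)" "\<bar>r * \<gamma> (T, y)\<bar> \<le> K"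
    by (simp_all add: power2_eq_square mult_ac)
qed

private lemma K_h_le: "i \<le> 10 \<Longrightarrow> K ^ i * h \<le> K ^ 10 * h"
  using K_power_le[of i 10] h by (intro mult_right_mono) auto

text \<open>The correction factor and the change of \<open>u\<close> between projection and final
  point are both of order \<open>sqrt h\<close>, so their product is within the error
  \<open>O(h)\<close> allowed to a stopping step.\<close>

lemma late_reflect_step:
  assumes "t + h < T" "T \<le> t + h + 2 * r * m"
  defines "q \<equiv> (T, y)" and "p \<equiv> (T - (t + h)) / (2 * m)"
  defines "A \<equiv> generator T G b \<sigma> (\<lambda>(_, y). \<phi> y) q"
  shows "\<bar>u (T, X' + (2 * r) *\<^sub>R \<nu> y) * (1 + h * c z + (2 * r * \<gamma> q + 2 * p * m * c q))
      + (- 2 * m * (r - p) * A + 2 * p * m * g q - 2 * r * \<psi> q) - P z \<Delta> * (1 + h * c z)\<bar> \<le> 10000000 * (K ^ 10 * h)"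
    and "\<bar>1 + h * c z + (2 * r * \<gamma> q + 2 * p * m * c q)\<bar> \<le> 1 + 12 * K ^ 4"
proof -
  define \<tau> where "\<tau> = T - (t + h)"
  \<comment> \<open>The parameter \<open>p\<close> measures the part of the reflection that fits
    before the final time, in the same unit in which the whole reflection is
    \<open>r\<close>.\<close>
  have \<tau>p: "\<tau> = 2 * p * m" using m_facts(1) by (simp add: p_def \<tau>_def)
  have \<tau>1: "T = t + h + \<tau>" "0 < \<tau>" "\<tau> \<le> 2 * (r * m)" using assms by (auto simp: \<tau>_def)
  have "r * m \<le> r * K" using m_facts(2) proj_facts(1) by (intro mult_left_mono) auto
  moreover have "r * K \<le> 2 * (K * s) * K" using r_le(1) K by (intro mult_right_mono) auto
  ultimately have \<tau>2: "\<tau> \<le> 4 * (K\<^sup>2 * s)" "\<tau> \<le> 2 * K"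
    using \<tau>1(3) mult_right_mono[OF r_le(2) K0] by (simp_all add: power2_eq_square mult_ac)
  have \<tau>3: "\<bar>\<tau>\<bar> \<le> 4 * (K\<^sup>2 * s)" "\<bar>\<tau>\<bar> \<le> 2 * K" using \<tau>1 \<tau>2 by simp_all
  note est = exit_step[OF \<tau>1(1) \<tau>3(1), folded q_def]
  have fb: "\<bar>c q\<bar> \<le> K" using final_bounds(3) by (simp add: q_def)
  have "\<bar>\<tau> * c q\<bar> \<le> 4 * (K ^ 3 * s)" "\<bar>\<tau> * c q\<bar> \<le> 2 * K\<^sup>2"
    using abs_mult_le[OF \<tau>3(1) fb] abs_mult_le[OF \<tau>3(2) fb] by (simp_all add: eval_nat_numeral mult_ac)
  moreover have "K\<^sup>2 * s \<le> K ^ 3 * s" using K_power_le[of 2 3] s by (intro mult_right_mono) auto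
  moreover have "2 * r * \<gamma> q + 2 * p * m * c q = 2 * (r * \<gamma> q) + \<tau> * c q" by (simp add: \<tau>p)
  ultimately have f: "\<bar>2 * r * \<gamma> q + 2 * p * m * c q\<bar> \<le> 8 * (K ^ 3 * s)"
     "\<bar>2 * r * \<gamma> q + 2 * p * m * c q\<bar> \<le> 4 * K\<^sup>2"
    using r\<gamma>_le[folded q_def] KK by linarith+
  have K4: "K\<^sup>2 \<le> K ^ 4" using K_power_le[of 2 4] by simp
  show "\<bar>1 + h * c z + (2 * r * \<gamma> q + 2 * p * m * c q)\<bar> \<le> 1 + 12 * K ^ 4"
    using f(2) data_le(2) KK K4 by linarith
  have "\<bar>(u (T, X' + (2 * r) *\<^sub>R \<nu> y) - u q) * (2 * r * \<gamma> q + 2 * p * m * c q)\<bar> \<le> 96 * (K ^ 3 * s) * (8 * (K ^ 3 * s))"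
    by (rule abs_mult_le[OF est(2) f(1)])
  also have "\<dots> = 768 * (K ^ 6 * (s * s))" by (simp add: eval_nat_numeral mult_ac)
  also have "\<dots> = 768 * (K ^ 6 * h)" by (simp only: s(4))
  finally have g1: "\<bar>(u (T, X' + (2 * r) *\<^sub>R \<nu> y) - u q) * (2 * r * \<gamma> q + 2 * p * m * c q)\<bar> \<le> 768 * (K ^ 6 * h)" .
  have a: "L q (1, 0) = - A - c q * u q - g q" "L q (0, \<nu> y) = \<psi> q - \<gamma> q * u q + m * A"
    using final_time[OF proj_facts(2)] final_normal[OF proj_facts(2)] by (simp_all add: q_def A_def)
  have "0 \<le> K ^ 10 * h" using K0 h by simp
  thus "\<bar>u (T, X' + (2 * r) *\<^sub>R \<nu> y) * (1 + h * c z + (2 * r * \<gamma> q + 2 * p * m * c q))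
      + (- 2 * m * (r - p) * A + 2 * p * m * g q - 2 * r * \<psi> q) - P z \<Delta> * (1 + h * c z)\<bar> \<le> 10000000 * (K ^ 10 * h)"
    unfolding late_reflect_algebra[OF a \<tau>p] using est(1,3) g1 K_h_le[of 5] K_h_le[of 6] by linarith
qed

text \<open>The auxiliary step passes the final time by at most \<open>h\<close>, so the
  uncompensated time derivative costs \<open>O(h)\<close>; so do all terms with
  \<open>r\<^sup>2\<close>.\<close>

lemma final_reflect_step:
  assumes "T \<le> t + h"
  defines "q \<equiv> (T, y)"
  defines "A \<equiv> generator T G b \<sigma> (\<lambda>(_, y). \<phi> y) q"
  shows "\<bar>u (T, X' + (2 * r) *\<^sub>R \<nu> y) * (1 + h * c z + (2 * r * \<gamma> q + 2 * r\<^sup>2 * (\<gamma> q)\<^sup>2))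
      + (- 2 * r * m * A - 2 * r\<^sup>2 * \<gamma> q * m * A - 2 * r * \<psi> q - 2 * r\<^sup>2 * \<gamma> q * \<psi> q)
      - P z \<Delta> * (1 + h * c z)\<bar> \<le> 10000000 * (K ^ 10 * h)"
    and "\<bar>1 + h * c z + (2 * r * \<gamma> q + 2 * r\<^sup>2 * (\<gamma> q)\<^sup>2)\<bar> \<le> 1 + 12 * K ^ 4"
proof -
  define \<tau> where "\<tau> = T - (t + h)"
  have \<tau>: "T = t + h + \<tau>" "\<bar>\<tau>\<bar> \<le> h" using assms t by (auto simp: \<tau>_def)
  have \<tau>s: "\<bar>\<tau>\<bar> \<le> 4 * (K\<^sup>2 * s)" using \<tau>(2) s Ks by linarith
  note est = exit_step[OF \<tau>(1) \<tau>s, folded q_def]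
  note fb = final_bounds[folded q_def, folded A_def]
  note r\<gamma> = r\<gamma>_le[folded q_def]
  define v where "v = u (T, X' + (2 * r) *\<^sub>R \<nu> y)"
  have v: "\<bar>v\<bar> \<le> K" unfolding v_def using u_le proj_facts(4) t by simp
  have r2: "\<bar>r\<^sup>2\<bar> \<le> 4 * (K\<^sup>2 * h)" using r_le(3) by simp
  have K4: "K\<^sup>2 \<le> K ^ 4" using K_power_le[of 2 4] by simp
  have "\<bar>r * \<gamma> q * (r * \<gamma> q)\<bar> \<le> K\<^sup>2" using abs_mult_le[OF r\<gamma>(2,2)] by (simp add: power2_eq_square)
  moreover have "2 * r * \<gamma> q + 2 * r\<^sup>2 * (\<gamma> q)\<^sup>2 = 2 * (r * \<gamma> q) + 2 * (r * \<gamma> q * (r * \<gamma> q))"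
    by (simp add: power2_eq_square)
  ultimately show "\<bar>1 + h * c z + (2 * r * \<gamma> q + 2 * r\<^sup>2 * (\<gamma> q)\<^sup>2)\<bar> \<le> 1 + 12 * K ^ 4"
    using r\<gamma>(2) data_le(2) KK K4 by linarith
  have g0: "\<bar>\<tau> * L q (1, 0)\<bar> \<le> K ^ 1 * h" using abs_mult_le[OF \<tau>(2) fb(6)] by (simp add: mult.commute)
  have "\<bar>(v - u q) * (r * \<gamma> q)\<bar> \<le> 96 * (K ^ 3 * s) * (2 * (K\<^sup>2 * s))"
    unfolding v_def by (rule abs_mult_le[OF est(2) r\<gamma>(1)])
  also have "\<dots> = 192 * (K ^ 5 * (s * s))" by (simp add: eval_nat_numeral mult_ac)
  also have "\<dots> = 192 * (K ^ 5 * h)" by (simp only: s(4))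
  finally have g1: "\<bar>(v - u q) * (r * \<gamma> q)\<bar> \<le> 192 * (K ^ 5 * h)" .
  have g2: "\<bar>r\<^sup>2 * ((\<gamma> q)\<^sup>2 * v)\<bar> \<le> 4 * (K ^ 5 * h)"
    using abs_mult_le[OF r2 abs_mult_le[OF abs_mult_le[OF fb(1,1)] v]]
    by (simp add: eval_nat_numeral mult_ac)
  have "\<bar>m\<bar> \<le> K" using m_facts by simp
  hence g3: "\<bar>r\<^sup>2 * (\<gamma> q * (m * A))\<bar> \<le> 12 * (K ^ 6 * h)"
    using abs_mult_le[OF r2 abs_mult_le[OF fb(1) abs_mult_le[OF _ fb(7)]], of m K]
    by (simp add: eval_nat_numeral mult_ac)
  have g4: "\<bar>r\<^sup>2 * (\<gamma> q * \<psi> q)\<bar> \<le> 4 * (K ^ 4 * h)"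
    using abs_mult_le[OF r2 abs_mult_le[OF fb(1,2)]]
    by (simp add: eval_nat_numeral mult_ac)
  have a: "L q (0, \<nu> y) = \<psi> q - \<gamma> q * u q + m * A"
    using final_normal[OF proj_facts(2)] by (simp add: q_def A_def)
  have "0 \<le> K ^ 10 * h" using K0 h by simp
  thus "\<bar>u (T, X' + (2 * r) *\<^sub>R \<nu> y) * (1 + h * c z + (2 * r * \<gamma> q + 2 * r\<^sup>2 * (\<gamma> q)\<^sup>2))
      + (- 2 * r * m * A - 2 * r\<^sup>2 * \<gamma> q * m * A - 2 * r * \<psi> q - 2 * r\<^sup>2 * \<gamma> q * \<psi> q)
      - P z \<Delta> * (1 + h * c z)\<bar> \<le> 10000000 * (K ^ 10 * h)"
    unfolding v_def[symmetric] final_reflect_algebra[OF a, of _ _ _ _ \<tau> "L q (1, 0)"]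
    using est(1,3)[folded v_def] g0 g1 g2 g3 g4 K_h_le[of 1] K_h_le[of 4] K_h_le[of 5] K_h_le[of 6]
    unfolding abs_le_iff by (intro conjI) linarith+
qed

end

text \<open>Every case multiplies \<open>Y\<close> by some \<open>fac\<close> and adds
  \<open>\<zeta> * Y\<close> to \<open>Z\<close> besides the Euler increment. The step error is then
  proportional to \<open>Y\<close>, and only a scalar estimate is left for each case.\<close>

private lemma step_combine:
  fixes U Y fac \<zeta> p d :: real
  assumes "Y1 = Y * fac" "Z1 = Z + h * g z * Y + \<zeta> * Y"
    and "\<bar>fac\<bar> \<le> 1 + 12 * (K ^ 5 * d)" "\<bar>U * fac + \<zeta> - p * (1 + h * c z)\<bar> \<le> 10000000 * (K ^ 11 * (h * d))"
  shows "\<bar>Y1\<bar> \<le> \<bar>Y\<bar> * (1 + 12 * (K ^ 5 * d))"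
    and "\<bar>U * Y1 + Z1 - ((p * (1 + h * c z) + h * g z) * Y + Z)\<bar> \<le> \<bar>Y\<bar> * (10000000 * (K ^ 11 * (h * d)))"
proof -
  show "\<bar>Y1\<bar> \<le> \<bar>Y\<bar> * (1 + 12 * (K ^ 5 * d))"
    unfolding assms(1) using assms(3) by (intro abs_mult_le) auto
  have "U * Y1 + Z1 - ((p * (1 + h * c z) + h * g z) * Y + Z) = Y * (U * fac + \<zeta> - p * (1 + h * c z))"
    unfolding assms(1,2) by (simp add: algebra_simps)
  thus "\<bar>U * Y1 + Z1 - ((p * (1 + h * c z) + h * g z) * Y + Z)\<bar> \<le> \<bar>Y\<bar> * (10000000 * (K ^ 11 * (h * d)))"
    using assms(4) abs_mult_le[of Y "\<bar>Y\<bar>"] by simp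
qed

text \<open>The reference value with \<open>P z \<Delta>\<close> has the same form in all cases,
  reflected or not; that is what permits averaging over the signs afterwards. All that depends on
  the case is in the error \<open>h * d\<close>, with \<open>d\<close> the advance of the
  clock.\<close>

lemma step_estimate:
  assumes step: "sticky_step T G \<nu> b \<sigma> c g \<gamma> \<psi> \<mu> \<phi> h \<xi> (t, X, Y, Z) = (t1, X1, Y1, Z1)"
  defines "d \<equiv> stop_clock T t1 - stop_clock T t"
  shows "X1 \<in> closure G \<and> t \<le> t1 \<and> t1 \<le> T \<and> (t1 < T \<longrightarrow> t + h \<le> t1) \<and> h \<le> d \<and>
    \<bar>Y1\<bar> \<le> \<bar>Y\<bar> * (1 + 12 * (K ^ 5 * d)) \<and>
    \<bar>u (t1, X1) * Y1 + Z1 - ((P z \<Delta> * (1 + h * c z) + h * g z) * Y + Z)\<bar> \<le> \<bar>Y\<bar> * (10000000 * (K ^ 11 * (h * d)))"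
proof -
  have base: "\<bar>1 + h * c z\<bar> \<le> 1 + 12 * (K ^ 5 * h)" "\<bar>1 + h * c z\<bar> \<le> 1 + 12 * K ^ 4"
  proof -
    have "h * K \<le> K ^ 5 * h" using K_power_le[of 1 5] h by (simp add: mult.commute)
    moreover have "0 \<le> K ^ 5 * h" using K0 h by simp
    ultimately show "\<bar>1 + h * c z\<bar> \<le> 1 + 12 * (K ^ 5 * h)" using data_le(1) by linarith
    have "K \<le> K ^ 4" using K_power_le[of 1 4] by simp
    thus "\<bar>1 + h * c z\<bar> \<le> 1 + 12 * K ^ 4" using data_le(2) K by linarith
  qed
  have up: "K ^ 10 * (h * x) \<le> K ^ 11 * (h * x)" if "0 \<le> x" for x
    using K_power_le[of 10 11] h that by (intro mult_right_mono) auto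
  \<comment> \<open>In a stopping step the clock advances by at least 1, which turns an error
    \<open>O(h)\<close> into \<open>O(h * d)\<close> and a bounded factor for \<open>Y\<close> into
    \<open>1 + O(d)\<close>.\<close>
  have final: ?thesis
    if "t1 = T" "X1 \<in> closure G" "Y1 = Y * fac" "Z1 = Z + h * g z * Y + \<zeta> * Y"
      and f: "\<bar>fac\<bar> \<le> 1 + 12 * K ^ 4"
      and e: "\<bar>u (T, X1) * fac + \<zeta> - P z \<Delta> * (1 + h * c z)\<bar> \<le> 10000000 * (K ^ 10 * h)" for fac \<zeta>
  proof -
    have d: "1 \<le> d" using that(1) t by (simp add: d_def stop_clock_def)
    have "K ^ 4 * 1 \<le> K ^ 5 * d" using K_power_le[of 4 5] d K0 by (intro mult_mono) auto
    hence f': "\<bar>fac\<bar> \<le> 1 + 12 * (K ^ 5 * d)" using f by simp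
    have "K ^ 10 * (h * 1) \<le> K ^ 11 * (h * d)" using K_power_le[of 10 11] d K0 h by (intro mult_mono) auto
    hence "\<bar>u (T, X1) * fac + \<zeta> - P z \<Delta> * (1 + h * c z)\<bar> \<le> 10000000 * (K ^ 11 * (h * d))" using e by simp
    from step_combine[OF that(3,4) f' this] show ?thesis using that(1,2) t d s by simp
  qed
  show ?thesis
  proof (cases "X' \<in> closure G")
    case True
    show ?thesis
    proof (cases "t + h < T")
      case tT: True
      have *: "t1 = t + h" "X1 = X'" "Y1 = Y * (1 + h * c z)" "Z1 = Z + h * g z * Y + 0 * Y"
        using step True tT unfolding sticky_step_def by (simp_all add: Let_def algebra_simps)
      have d: "d = h" using * t tT by (simp add: d_def stop_clock_def)
      have "\<bar>u (t + h, X') * (1 + h * c z) + 0 - P z \<Delta> * (1 + h * c z)\<bar> \<le> 10000000 * (K ^ 11 * (h * h))"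
        using inside_estimate[OF True tT] up[OF less_imp_le[OF h]] by linarith
      from step_combine[OF *(3,4) base(1) this] show ?thesis
        unfolding d using * True tT h by simp
    next
      case False
      have *: "t1 = T" "X1 = X'" "Y1 = Y * (1 + h * c z)" "Z1 = Z + h * g z * Y + 0 * Y"
        using step True False unfolding sticky_step_def by (simp_all add: Let_def algebra_simps)
      show ?thesis
        using stop_inside_estimate[OF True] False *(2) True by (intro final[OF *(1) _ *(3,4) base(2)]) auto
    qed
  next
    case out: False
    define r where "r = infdist X' (frontier G)"
    define y where "y = boundary_proj G \<nu> X'"
    define m where "m = \<mu> y"
    note fold = r_def[symmetric] y_def[symmetric] m_def[symmetric]
    note r0 = proj_facts(1)[OF out, unfolded fold] and XG = proj_facts(4)[OF out, unfolded fold]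
      and m = m_facts(1,3)[OF out, unfolded fold]
    consider "t + h < T" "t + h + 2 * r * m < T" | "t + h < T" "T \<le> t + h + 2 * r * m" | "T \<le> t + h" by linarith
    thus ?thesis
    proof cases
      case 1
      define q where "q = (t + h + r * m, y)"
      define \<alpha> where "\<alpha> = \<gamma> q + m * c q"
      define \<beta> where "\<beta> = \<psi> q - m * g q"
      have st: "t1 = t + h + 2 * r * m" "X1 = X' + (2 * r) *\<^sub>R \<nu> y"
        "Y1 = Y + h * c z * Y + (2*r*\<gamma> q + 2*r*m*c q + 2*r^2*(\<gamma> q)^2 + 4*r^2*m*\<gamma> q*c q + 2*r^2*m^2*(c q)^2) * Y"
        "Z1 = Z + h * g z * Y + (- 2*r*\<psi> q - 2*r^2*\<gamma> q*\<psi> q - 2*r^2*m*c q*\<psi> q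
                   + 2*r*m*g q + 2*r^2*m*\<gamma> q*g q + 2*r^2*m^2*c q*g q) * Y"
        using step out 1 unfolding sticky_step_def by (simp_all add: Let_def fold q_def)
      have Y1: "Y1 = Y * (1 + h * c z + 2 * r * \<alpha> + 2 * r\<^sup>2 * \<alpha>\<^sup>2)"
        unfolding st(3) \<alpha>_def by (simp add: algebra_simps power2_eq_square)
      have Z1: "Z1 = Z + h * g z * Y + (- 2 * r * \<beta> - 2 * r\<^sup>2 * \<alpha> * \<beta>) * Y"
        unfolding st(4) \<alpha>_def \<beta>_def by (simp add: algebra_simps power2_eq_square)
      note est = reflect_step[OF out, unfolded fold, OF 1(2), folded q_def, folded \<alpha>_def \<beta>_def]
      have rm: "0 \<le> r * m" "0 \<le> m * r" using r0 m(1) by simp_all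
      have d: "d = h + 2 * (r * m)" using st(1) t 1 by (simp add: d_def stop_clock_def)
      \<comment> \<open>Here the lower bound on \<open>\<mu>\<close> enters:
        \<open>r \<le> K * (r * m)\<close>, and \<open>2 * (r * m)\<close> is part of the elapsed
        time. Each use of \<open>h + r \<le> K * d\<close> costs one further power of
        \<open>K\<close>.\<close>
      have "1 * h \<le> K * h" using K h by (intro mult_right_mono) auto
      moreover have "r * 1 \<le> r * (K * m)" using m(2) r0 by (intro mult_left_mono) auto
      moreover have "0 \<le> K * (r * m)" using K0 rm by simp
      ultimately have hd: "h + r \<le> K * d" unfolding d by (simp add: algebra_simps)
      hence "K ^ 4 * (h + r) \<le> K ^ 4 * (K * d)" using K0 by (intro mult_left_mono) auto
      also have "K ^ 4 * (K * d) = K ^ 5 * d" by (simp add: eval_nat_numeral mult_ac)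
      finally have f: "\<bar>1 + h * c z + 2 * r * \<alpha> + 2 * r\<^sup>2 * \<alpha>\<^sup>2\<bar> \<le> 1 + 12 * (K ^ 5 * d)"
        using est(2) by linarith
      have "K ^ 10 * (h * (h + r)) \<le> K ^ 10 * (h * (K * d))" using hd K0 h by (intro mult_left_mono) auto
      also have "\<dots> = K ^ 11 * (h * d)" by (simp add: eval_nat_numeral mult_ac)
      finally have "\<bar>u (t1, X1) * (1 + h * c z + 2 * r * \<alpha> + 2 * r\<^sup>2 * \<alpha>\<^sup>2)
        + (- 2 * r * \<beta> - 2 * r\<^sup>2 * \<alpha> * \<beta>) - P z \<Delta> * (1 + h * c z)\<bar> \<le> 10000000 * (K ^ 11 * (h * d))"
        using est(1) unfolding st(1,2) by simp
      from step_combine[OF Y1 Z1 f this] show ?thesis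
        using st(1,2) XG 1 rm h d by simp
    next
      case 2
      define q where "q = (T, y)"
      define p where "p = (T - (t + h)) / (2 * m)"
      define A where "A = generator T G b \<sigma> (\<lambda>(_, y). \<phi> y) q"
      have st: "t1 = T" "X1 = X' + (2 * r) *\<^sub>R \<nu> y"
        "Y1 = Y + h * c z * Y + (2 * r * \<gamma> q + 2 * p * m * c q) * Y"
        "Z1 = Z + h * g z * Y + (- 2 * m * (r - p) * A + 2 * p * m * g q - 2 * r * \<psi> q) * Y"
      proof -
        have "sticky_step T G \<nu> b \<sigma> c g \<gamma> \<psi> \<mu> \<phi> h \<xi> (t, X, Y, Z) = (T, X' + (2 * r) *\<^sub>R \<nu> y,
          Y + h * c z * Y + (2 * r * \<gamma> q + 2 * p * m * c q) * Y,
          Z + h * g z * Y + (- 2 * m * (r - p) * A + 2 * p * m * g q - 2 * r * \<psi> q) * Y)"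
          using out 2 unfolding sticky_step_def by (simp add: Let_def fold q_def p_def[symmetric] A_def)
        from this[unfolded step] show "t1 = T" "X1 = X' + (2 * r) *\<^sub>R \<nu> y"
          "Y1 = Y + h * c z * Y + (2 * r * \<gamma> q + 2 * p * m * c q) * Y"
          "Z1 = Z + h * g z * Y + (- 2 * m * (r - p) * A + 2 * p * m * g q - 2 * r * \<psi> q) * Y"
          by blast+
      qed
      have Y1: "Y1 = Y * (1 + h * c z + (2 * r * \<gamma> q + 2 * p * m * c q))"
        unfolding st(3) by (simp add: algebra_simps)
      note est = late_reflect_step[OF out, unfolded fold, OF 2, folded q_def p_def, folded A_def]
      show ?thesis by (rule final[OF st(1) _ Y1 st(4) est(2)]) (use XG st(2) est(1) in simp_all)
    next
      case 3
      define q where "q = (T, y)"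
      define A where "A = generator T G b \<sigma> (\<lambda>(_, y). \<phi> y) q"
      have st: "t1 = T" "X1 = X' + (2 * r) *\<^sub>R \<nu> y"
        "Y1 = Y + h * c z * Y + (2 * r * \<gamma> q + 2 * r\<^sup>2 * (\<gamma> q)\<^sup>2) * Y"
        "Z1 = Z + h * g z * Y + (- 2 * r * m * A - 2 * r\<^sup>2 * \<gamma> q * m * A - 2 * r * \<psi> q - 2 * r\<^sup>2 * \<gamma> q * \<psi> q) * Y"
      proof -
        have "sticky_step T G \<nu> b \<sigma> c g \<gamma> \<psi> \<mu> \<phi> h \<xi> (t, X, Y, Z) = (T, X' + (2 * r) *\<^sub>R \<nu> y,
          Y + h * c z * Y + (2 * r * \<gamma> q + 2 * r\<^sup>2 * (\<gamma> q)\<^sup>2) * Y,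
          Z + h * g z * Y + (- 2 * r * m * A - 2 * r\<^sup>2 * \<gamma> q * m * A - 2 * r * \<psi> q - 2 * r\<^sup>2 * \<gamma> q * \<psi> q) * Y)"
          using out 3 unfolding sticky_step_def by (simp add: Let_def fold q_def A_def)
        from this[unfolded step] show "t1 = T" "X1 = X' + (2 * r) *\<^sub>R \<nu> y"
          "Y1 = Y + h * c z * Y + (2 * r * \<gamma> q + 2 * r\<^sup>2 * (\<gamma> q)\<^sup>2) * Y"
          "Z1 = Z + h * g z * Y + (- 2 * r * m * A - 2 * r\<^sup>2 * \<gamma> q * m * A - 2 * r * \<psi> q - 2 * r\<^sup>2 * \<gamma> q * \<psi> q) * Y"
          by blast+
      qed
      have Y1: "Y1 = Y * (1 + h * c z + (2 * r * \<gamma> q + 2 * r\<^sup>2 * (\<gamma> q)\<^sup>2))"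
        unfolding st(3) by (simp add: algebra_simps)
      note est = final_reflect_step[OF out, unfolded fold, OF 3, folded q_def, folded A_def]
      show ?thesis by (rule final[OF st(1) _ Y1 st(4) est(2)]) (use XG st(2) est(1) in simp_all)
    qed
  qed
qed

end

end

section \<open>The chain\<close>

lemma sticky_chain_cong:
  assumes "\<And>j. 1 \<le> j \<Longrightarrow> j \<le> k \<Longrightarrow> v j = w j"
  shows "sticky_chain T step s0 v k = sticky_chain T step s0 w k"
  using assms by (induction k) (auto simp: Let_def)

lemma sticky_chain_stopped:
  assumes "\<not> fst (sticky_chain T step s0 w k) < T"
  shows "sticky_chain T step s0 w (k + n) = sticky_chain T step s0 w k"
  using assms by (induction n) (auto simp: Let_def)

text \<open>Replaces the random number of steps by a fixed horizon: a chain that has stopped stays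
  constant, so any index with time \<open>T\<close> shows the final state.\<close>

lemma final_state_eq:
  assumes "fst (sticky_chain T step s0 w N) = T"
  shows "final_state T step s0 w = sticky_chain T step s0 w N"
proof -
  define k where "k = num_steps T step s0 w"
  have k: "fst (sticky_chain T step s0 w k) = T" "k \<le> N"
    unfolding k_def num_steps_def
    using assms by (auto intro: LeastI[of "\<lambda>k. fst (sticky_chain T step s0 w k) = T"] Least_le)
  have "sticky_chain T step s0 w (k + (N - k)) = sticky_chain T step s0 w k"
    by (rule sticky_chain_stopped) (simp add: k(1))
  thus ?thesis using k(2) by (simp add: final_state_def k_def)
qed

section \<open>Averages over sign sequences\<close>

text \<open>The indices start at 1 because step \<open>Suc k\<close> of the chain uses the sign
  vector with index \<open>Suc k\<close>; extensionality makes each sequence of signs occur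
  once.\<close>

definition sign_paths :: "nat \<Rightarrow> (nat \<Rightarrow> real ^ 'n) set" where
  "sign_paths N = {1..N} \<rightarrow>\<^sub>E sign_cube"

text \<open>The finite form of conditioning on the first \<open>N\<close> sign vectors.\<close>

lemma sum_sign_paths_Suc:
  "(\<Sum>w\<in>sign_paths (Suc N). F w) = (\<Sum>w\<in>sign_paths N. \<Sum>v\<in>sign_cube. F (w(Suc N := v)) :: real)"
proof -
  have S: "{1..Suc N} = insert (Suc N) {1..N}" by auto
  have "(\<Sum>w\<in>sign_paths (Suc N). F w) = (\<Sum>(v, w)\<in>sign_cube \<times> sign_paths N. F (w(Suc N := v)))"
    unfolding sign_paths_def S PiE_insert_eq
    by (subst sum.reindex[OF inj_combinator]) (auto simp: case_prod_unfold)
  also have "\<dots> = (\<Sum>v\<in>sign_cube. \<Sum>w\<in>sign_paths N. F (w(Suc N := v)))" by (rule sum.cartesian_product[symmetric])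
  finally show ?thesis by (subst (asm) sum.swap)
qed

text \<open>Independence over all pairs of step and coordinate gives every sequence of the first
  \<open>N\<close> sign vectors the same probability, and a function of these vectors is a finite
  combination of indicators.\<close>

lemma (in prob_space) expectation_sign_paths:
  fixes \<xi> :: "nat \<Rightarrow> 'a \<Rightarrow> real ^ 'n" and F :: "(nat \<Rightarrow> real ^ 'n) \<Rightarrow> real"
  assumes fin: "finite (sign_cube :: (real ^ 'n) set)"
    and ind: "indep_vars (\<lambda>_. borel) (\<lambda>(k, i) \<omega>. \<xi> k \<omega> $ i) ({1..} \<times> UNIV)"
    and val: "\<And>k i \<omega>. 1 \<le> k \<Longrightarrow> \<omega> \<in> space M \<Longrightarrow> \<xi> k \<omega> $ i = 1 \<or> \<xi> k \<omega> $ i = - 1"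
    and p: "\<And>k i. 1 \<le> k \<Longrightarrow> measure M {\<omega> \<in> space M. \<xi> k \<omega> $ i = 1} = 1/2"
      "\<And>k i. 1 \<le> k \<Longrightarrow> measure M {\<omega> \<in> space M. \<xi> k \<omega> $ i = - 1} = 1/2"
    and F: "\<And>v w. (\<And>j. 1 \<le> j \<Longrightarrow> j \<le> N \<Longrightarrow> v j = w j) \<Longrightarrow> F v = F w" and N: "1 \<le> N"
  shows "integrable M (\<lambda>\<omega>. F (\<lambda>k. \<xi> k \<omega>))"
    and "(\<integral>\<omega>. F (\<lambda>k. \<xi> k \<omega>) \<partial>M) = (\<Sum>w\<in>sign_paths N. F w) / card (sign_paths N :: (nat \<Rightarrow> real ^ 'n) set)"
proof -
  define W where "W = (sign_paths N :: (nat \<Rightarrow> real ^ 'n) set)"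
  have W: "finite W" unfolding W_def sign_paths_def using fin by (intro finite_PiE) auto
  define E where "E = (\<lambda>w. {\<omega> \<in> space M. \<forall>j\<in>{1..N}. \<xi> j \<omega> = w j})"
  define P where "P = (1 / 2 :: real) ^ card ({1..N} \<times> (UNIV :: 'n set))"
  have E: "E w \<in> events \<and> prob (E w) = P" if w: "w \<in> W" for w
  proof -
    define A where "A = (\<lambda>(j, i). {w j $ i})"
    define X where "X = (\<lambda>(k, i) \<omega>. \<xi> k \<omega> $ i)"
    have Eq: "E w = (\<Inter>a\<in>{1..N} \<times> UNIV. X a -` A a \<inter> space M)"
      using N by (auto simp: E_def A_def X_def vec_eq_iff)
    have rv: "random_variable borel (X a)" if "a \<in> {1..} \<times> UNIV" for a
      using ind that unfolding indep_vars_def X_def by blast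
    have ev: "X a -` A a \<inter> space M \<in> events" if "a \<in> {1..N} \<times> UNIV" for a
      using that by (intro measurable_sets[OF rv]) (auto simp: A_def split: prod.splits)
    have pr: "prob (X a -` A a \<inter> space M) = 1 / 2" if a0: "a \<in> {1..N} \<times> UNIV" for a
    proof -
      obtain j i where a: "a = (j, i)" "1 \<le> j" "j \<le> N" using a0 by (cases a) auto
      have "w j \<in> sign_cube" using w a by (auto simp: W_def sign_paths_def PiE_def Pi_def)
      hence "w j $ i = 1 \<or> w j $ i = -1" by (simp add: sign_cube_def)
      moreover have "X a -` A a \<inter> space M = {\<omega> \<in> space M. \<xi> j \<omega> $ i = w j $ i}" by (auto simp: a A_def X_def)
      ultimately show ?thesis using p[OF a(2), of i] by auto
    qed
    have "prob (\<Inter>a\<in>{1..N} \<times> UNIV. X a -` A a \<inter> space M) = (\<Prod>a\<in>{1..N} \<times> UNIV. prob (X a -` A a \<inter> space M))"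
      using N ind[folded X_def] by (intro indep_varsD) (auto simp: A_def split: prod.splits)
    also have "\<dots> = P" unfolding P_def using pr by (simp add: prod.cong[OF refl pr])
    finally have "prob (E w) = P" unfolding Eq .
    moreover have "E w \<in> events" unfolding Eq using N by (intro sets.finite_INT ev) auto
    ultimately show ?thesis by blast
  qed
  have rep: "H (\<lambda>k. \<xi> k \<omega>) = (\<Sum>w\<in>W. H w * indicator (E w) \<omega>)"
    if \<omega>: "\<omega> \<in> space M" and H: "\<And>v w. (\<And>j. 1 \<le> j \<Longrightarrow> j \<le> N \<Longrightarrow> v j = w j) \<Longrightarrow> H v = H w" for \<omega> and H :: "(nat \<Rightarrow> real ^ 'n) \<Rightarrow> real"
  proof -
    define w0 where "w0 = restrict (\<lambda>k. \<xi> k \<omega>) {1..N}"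
    have w0: "w0 \<in> W" using val \<omega> by (auto simp: W_def sign_paths_def w0_def sign_cube_def)
    have "\<omega> \<in> E w \<longleftrightarrow> w = w0" if "w \<in> W" for w
    proof
      assume e: "\<omega> \<in> E w"
      show "w = w0"
        by (rule PiE_ext[of _ "{1..N}" "\<lambda>_. sign_cube"]) (use e that w0 in \<open>auto simp: W_def sign_paths_def E_def w0_def\<close>)
    qed (use \<omega> in \<open>auto simp: E_def w0_def\<close>)
    hence "(\<Sum>w\<in>W. H w * indicator (E w) \<omega>) = (\<Sum>w\<in>W. if w = w0 then H w else 0)"
      by (intro sum.cong) (auto simp: indicator_def)
    also have "\<dots> = H w0" using W w0 by simp
    also have "\<dots> = H (\<lambda>k. \<xi> k \<omega>)" by (rule H) (simp add: w0_def)
    finally show ?thesis by simp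
  qed
  \<comment> \<open>Stated for every \<open>H\<close>, since the constant 1 is needed besides
    \<open>F\<close>.\<close>
  have int: "integrable M (\<lambda>\<omega>. H (\<lambda>k. \<xi> k \<omega>)) \<and> (\<integral>\<omega>. H (\<lambda>k. \<xi> k \<omega>) \<partial>M) = (\<Sum>w\<in>W. H w) * P"
    if H: "\<And>v w. (\<And>j. 1 \<le> j \<Longrightarrow> j \<le> N \<Longrightarrow> v j = w j) \<Longrightarrow> H v = H w" for H :: "(nat \<Rightarrow> real ^ 'n) \<Rightarrow> real"
  proof -
    have i: "integrable M (\<lambda>\<omega>. H w * indicator (E w) \<omega>)" if "w \<in> W" for w
      using E[OF that] by (intro integrable_mult_right integrable_real_indicator) (auto simp: emeasure_eq_measure)
    have "integrable M (\<lambda>\<omega>. H (\<lambda>k. \<xi> k \<omega>)) \<longleftrightarrow> integrable M (\<lambda>\<omega>. \<Sum>w\<in>W. H w * indicator (E w) \<omega>)"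
      by (intro Bochner_Integration.integrable_cong refl rep H)
    moreover have "(\<integral>\<omega>. H (\<lambda>k. \<xi> k \<omega>) \<partial>M) = (\<integral>\<omega>. (\<Sum>w\<in>W. H w * indicator (E w) \<omega>) \<partial>M)"
      by (intro Bochner_Integration.integral_cong refl rep H)
    moreover have "(\<integral>\<omega>. (\<Sum>w\<in>W. H w * indicator (E w) \<omega>) \<partial>M) = (\<Sum>w\<in>W. H w * P)"
    proof (subst Bochner_Integration.integral_sum)
      show "(\<Sum>w\<in>W. \<integral>\<omega>. H w * indicator (E w) \<omega> \<partial>M) = (\<Sum>w\<in>W. H w * P)"
        using E by (intro sum.cong) auto
    qed (rule i)
    ultimately show ?thesis using i by (simp add: sum_distrib_right)
  qed
  show "integrable M (\<lambda>\<omega>. F (\<lambda>k. \<xi> k \<omega>))" using int[of F] F by blast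
  \<comment> \<open>Total probability identifies the common probability with the reciprocal of the
    number of sequences; the cardinality itself need not be evaluated.\<close>
  have c: "1 = real (card W) * P" using int[of "\<lambda>_. 1"] prob_space by simp
  hence "real (card W) \<noteq> 0" by (metis mult_zero_left zero_neq_one)
  hence "P = 1 / card W" using c by (simp add: eq_divide_eq mult.commute)
  moreover have "(\<integral>\<omega>. F (\<lambda>k. \<xi> k \<omega>) \<partial>M) = sum F W * P" using int[of F] F by blast
  ultimately show "(\<integral>\<omega>. F (\<lambda>k. \<xi> k \<omega>) \<partial>M) = (\<Sum>w\<in>sign_paths N. F w) / card (sign_paths N :: (nat \<Rightarrow> real ^ 'n) set)"
    by (simp add: W_def)
qed

section \<open>Accumulation of the error\<close>

context sticky
begin

definition state_value :: "'n state \<Rightarrow> real" where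
  "state_value = (\<lambda>(t, X, Y, Z). u (t, X) * Y + Z)"

text \<open>Error per unit of clock and of \<open>h\<close>: the first summand comes from the single
  outcomes of a step, the second from their average. The exponential bounds
  \<open>\<bar>Y\<bar>\<close> at every state from which a step is made.\<close>

definition error_rate :: real where
  "error_rate = (10000000 * K ^ 11 + 40 * K ^ 5) * exp (12 * K ^ 5 * (T + 1))"

lemma error_rate_pos: "0 < error_rate"
  using K by (simp add: error_rate_def add_pos_pos)

context
  fixes h t0 :: real and x :: "real ^ 'n"
  assumes h: "0 < h" and small: "16 * K\<^sup>2 * sqrt h \<le> 1" "2 * (16 * K\<^sup>2 * sqrt h) < \<delta>"
    and t0: "0 \<le> t0" "t0 < T" and x: "x \<in> closure G"
begin

abbreviation "step \<equiv> sticky_step T G \<nu> b \<sigma> c g \<gamma> \<psi> \<mu> \<phi> h"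
abbreviation "chain \<equiv> sticky_chain T step (t0, x, 1, 0)"
abbreviation "clock s \<equiv> stop_clock T (fst s)"

text \<open>The invariant after \<open>k\<close> steps. The lower bound on the time of a running
  chain limits the number of steps. The bound on \<open>Y\<close> follows the clock and not the
  number of steps, because a single reflection changes \<open>Y\<close> by a factor
  \<open>1 + O(r)\<close>.\<close>

definition regular :: "nat \<Rightarrow> 'n state \<Rightarrow> bool" where
  "regular k = (\<lambda>(t, X, Y, Z). X \<in> closure G \<and> t0 \<le> t \<and> t \<le> T \<and> (t < T \<longrightarrow> t0 + k * h \<le> t) \<and>
     \<bar>Y\<bar> \<le> exp (12 * K ^ 5 * (stop_clock T t - stop_clock T t0)))"

lemma regular_step:
  assumes "regular k (t, X, Y, Z)" "t < T" "\<xi> \<in> sign_cube"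
  shows "regular (Suc k) (step \<xi> (t, X, Y, Z))"
proof -
  obtain t1 X1 Y1 Z1 where st: "step \<xi> (t, X, Y, Z) = (t1, X1, Y1, Z1)" by (metis prod_cases4)
  have t: "0 \<le> t" and X: "X \<in> closure G" using assms(1) t0 by (auto simp: regular_def)
  note est = step_estimate[OF h small t assms(2) X assms(3) st]
  define d where "d = stop_clock T t1 - stop_clock T t"
  define M where "M = exp (12 * K ^ 5 * (stop_clock T t - stop_clock T t0))"
  have d0: "0 \<le> d" using est h unfolding d_def by linarith
  have "\<bar>Y1\<bar> \<le> \<bar>Y\<bar> * (1 + 12 * (K ^ 5 * d))" using est by (simp add: d_def)
  \<comment> \<open>The factors \<open>1 + x\<close> are replaced by \<open>exp x\<close>, so that
    their product follows the sum of the clock increments.\<close>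
  also have "\<dots> \<le> M * exp (12 * K ^ 5 * d)"
  proof (rule mult_mono)
    show "\<bar>Y\<bar> \<le> M" using assms(1) by (simp add: regular_def M_def)
    show "1 + 12 * (K ^ 5 * d) \<le> exp (12 * K ^ 5 * d)" using exp_ge_add_one_self[of "12 * K ^ 5 * d"] by (simp add: mult_ac)
    show "0 \<le> M" by (simp add: M_def)
    show "0 \<le> 1 + 12 * (K ^ 5 * d)" using d0 K0 by simp
  qed
  also have "\<dots> = exp (12 * K ^ 5 * (stop_clock T t1 - stop_clock T t0))"
    by (simp add: M_def d_def exp_add[symmetric] algebra_simps)
  finally show ?thesis using est assms(1,2) unfolding st regular_def by (auto simp: algebra_simps)
qed

lemma regular_chain:
  assumes "\<And>j. 1 \<le> j \<Longrightarrow> j \<le> k \<Longrightarrow> w j \<in> sign_cube"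
  shows "regular k (chain w k)"
  using assms
proof (induction k)
  case 0 thus ?case using t0 x by (simp add: regular_def)
next
  case (Suc k)
  obtain t X Y Z where c: "chain w k = (t, X, Y, Z)" by (metis prod_cases4)
  have r: "regular k (t, X, Y, Z)" using Suc c by simp
  show ?case
  proof (cases "t < T")
    case True thus ?thesis using regular_step[OF r True, of "w (Suc k)"] Suc.prems c by (simp add: Let_def)
  next
    case False
    thus ?thesis using r c by (auto simp: Let_def regular_def)
  qed
qed

text \<open>The averaged error of one step is bounded by the averaged advance of the clock, which
  telescopes over the steps. Stopped states contribute 0 to both sides. The error
  \<open>O(h\<^sup>2)\<close> of the average fits in because the clock advances by at least
  \<open>h\<close> in every outcome.\<close>

lemma average_step:
  assumes r: "regular k s"
  shows "\<bar>(\<Sum>\<xi>\<in>sign_cube. state_value (if fst s < T then step \<xi> s else s))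
      - card (sign_cube :: (real ^ 'n) set) * state_value s\<bar>
    \<le> error_rate * h * ((\<Sum>\<xi>\<in>sign_cube. clock (if fst s < T then step \<xi> s else s))
      - card (sign_cube :: (real ^ 'n) set) * clock s)"
proof (cases "fst s < T")
  case False thus ?thesis by simp
next
  case True
  obtain t X Y Z where s: "s = (t, X, Y, Z)" by (metis prod_cases4)
  define N where "N = real (card (sign_cube :: (real ^ 'n) set))"
  define p where "p = (\<lambda>\<xi>. P (t, X) (h, h *\<^sub>R b (t, X) + sqrt h *\<^sub>R (\<sigma> (t, X) *v \<xi>)) * (1 + h * c (t, X)) + h * g (t, X))"
  define d where "d = (\<lambda>\<xi>. clock (step \<xi> s) - clock s)"
  define V where "V = (\<lambda>\<xi>. state_value (step \<xi> s))"
  have t: "0 \<le> t" "t < T" and X: "X \<in> closure G" using r t0 True by (auto simp: regular_def s)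
  obtain \<xi>0 where "\<xi>0 \<in> (sign_cube :: (real ^ 'n) set)" using sign_cube_nonempty by blast
  from step_size_le_1[OF h small t X this] have h1: "h \<le> 1" .
  have st: "h \<le> d \<xi> \<and> \<bar>V \<xi> - (p \<xi> * Y + Z)\<bar> \<le> \<bar>Y\<bar> * (10000000 * (K ^ 11 * (h * d \<xi>)))"
    if "\<xi> \<in> sign_cube" for \<xi>
  proof -
    obtain t1 X1 Y1 Z1 where st: "step \<xi> (t, X, Y, Z) = (t1, X1, Y1, Z1)" by (metis prod_cases4)
    show ?thesis using step_estimate[OF h small t X that st] by (simp add: d_def V_def p_def s st state_value_def)
  qed
  have av: "\<bar>(\<Sum>\<xi>\<in>sign_cube. p \<xi>) - N * u (t, X)\<bar> \<le> N * (40 * K ^ 5 * h\<^sup>2)"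
    unfolding p_def N_def using average_estimate[OF _ h h1, of "(t, X)"] t X by simp
  \<comment> \<open>Deviation of the single outcomes from their polynomial values, plus the error of
    the averaged polynomial.\<close>
  have eq: "(\<Sum>\<xi>\<in>sign_cube. V \<xi>) - N * state_value s
      = (\<Sum>\<xi>\<in>sign_cube. V \<xi> - (p \<xi> * Y + Z)) + ((\<Sum>\<xi>\<in>sign_cube. p \<xi>) - N * u (t, X)) * Y"
    by (simp add: s state_value_def sum_subtractf sum.distrib N_def sum_distrib_left[symmetric] algebra_simps)
  have hd: "h\<^sup>2 \<le> h * d \<xi>" if "\<xi> \<in> sign_cube" for \<xi> using st[OF that] h by (simp add: power2_eq_square)
  have "N * h\<^sup>2 = (\<Sum>\<xi>\<in>(sign_cube :: (real ^ 'n) set). h\<^sup>2)" by (simp add: N_def)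
  also have "\<dots> \<le> (\<Sum>\<xi>\<in>sign_cube. h * d \<xi>)" by (rule sum_mono) (rule hd)
  also have "\<dots> = h * sum d sign_cube" by (simp add: sum_distrib_left)
  finally have Nh: "N * h\<^sup>2 \<le> h * sum d sign_cube" .
  have "N * (40 * K ^ 5 * h\<^sup>2) = 40 * K ^ 5 * (N * h\<^sup>2)" by (simp add: mult_ac)
  also have "\<dots> \<le> 40 * K ^ 5 * (h * sum d sign_cube)" using Nh K0 by (intro mult_left_mono) auto
  finally have "\<bar>(\<Sum>\<xi>\<in>sign_cube. p \<xi>) - N * u (t, X)\<bar> \<le> 40 * K ^ 5 * (h * sum d sign_cube)" using av by linarith
  hence b1: "\<bar>((\<Sum>\<xi>\<in>sign_cube. p \<xi>) - N * u (t, X)) * Y\<bar> \<le> 40 * K ^ 5 * (h * sum d sign_cube) * \<bar>Y\<bar>"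
    by (rule abs_mult_le) simp
  have "\<bar>\<Sum>\<xi>\<in>sign_cube. V \<xi> - (p \<xi> * Y + Z)\<bar> \<le> (\<Sum>\<xi>\<in>sign_cube. \<bar>V \<xi> - (p \<xi> * Y + Z)\<bar>)" by (rule sum_abs)
  also have "\<dots> \<le> (\<Sum>\<xi>\<in>sign_cube. \<bar>Y\<bar> * (10000000 * (K ^ 11 * (h * d \<xi>))))"
    using st by (intro sum_mono) auto
  also have "\<dots> = 10000000 * K ^ 11 * (h * sum d sign_cube) * \<bar>Y\<bar>"
    by (simp add: sum_distrib_left sum_distrib_right mult_ac)
  finally have "\<bar>(\<Sum>\<xi>\<in>sign_cube. V \<xi>) - N * state_value s\<bar> \<le> (10000000 * K ^ 11 + 40 * K ^ 5) * (h * sum d sign_cube) * \<bar>Y\<bar>"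
    unfolding eq using b1 by (simp add: algebra_simps)
  also have "\<dots> \<le> (10000000 * K ^ 11 + 40 * K ^ 5) * (h * sum d sign_cube) * exp (12 * K ^ 5 * (T + 1))"
  proof (rule mult_left_mono)
    have "stop_clock T t - stop_clock T t0 \<le> T + 1" using t t0 by (simp add: stop_clock_def)
    hence "12 * K ^ 5 * (stop_clock T t - stop_clock T t0) \<le> 12 * K ^ 5 * (T + 1)" using K0 by (intro mult_left_mono) auto
    hence "exp (12 * K ^ 5 * (stop_clock T t - stop_clock T t0)) \<le> exp (12 * K ^ 5 * (T + 1))"
      by (simp only: exp_le_cancel_iff)
    moreover have "\<bar>Y\<bar> \<le> exp (12 * K ^ 5 * (stop_clock T t - stop_clock T t0))" using r by (simp add: regular_def s)
    ultimately show "\<bar>Y\<bar> \<le> exp (12 * K ^ 5 * (T + 1))" by linarith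
    have "0 \<le> sum d sign_cube" using st h by (intro sum_nonneg) force
    thus "0 \<le> (10000000 * K ^ 11 + 40 * K ^ 5) * (h * sum d sign_cube)" using K0 h by simp
  qed
  also have "\<dots> = error_rate * h * sum d sign_cube" by (simp add: error_rate_def mult_ac)
  also have "sum d sign_cube = (\<Sum>\<xi>\<in>sign_cube. clock (step \<xi> s)) - N * clock s"
    by (simp add: d_def sum_subtractf N_def)
  finally show ?thesis using True by (simp add: V_def N_def)
qed

text \<open>Telescoping in the mean. Errors and clock advances are both kept as sums over all
  sequences, each step multiplying the previous sums by the number of sign vectors.\<close>

lemma chain_average:
  "\<bar>(\<Sum>w\<in>sign_paths k. state_value (chain w k)) - card (sign_paths k :: (nat \<Rightarrow> real ^ 'n) set) * u (t0, x)\<bar>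
    \<le> error_rate * h * ((\<Sum>w\<in>sign_paths k. clock (chain w k)) - card (sign_paths k :: (nat \<Rightarrow> real ^ 'n) set) * stop_clock T t0)"
proof (induction k)
  case 0
  have "sign_paths 0 = {\<lambda>_. undefined :: real ^ 'n}" by (simp add: sign_paths_def)
  thus ?case by (simp add: state_value_def)
next
  case (Suc k)
  define N where "N = real (card (sign_cube :: (real ^ 'n) set))"
  define n where "n = (\<lambda>k. real (card (sign_paths k :: (nat \<Rightarrow> real ^ 'n) set)))"
  have nS: "n (Suc k) = N * n k"
    unfolding n_def N_def sign_paths_def by (simp add: card_PiE prod_constant)
  have S: "(\<Sum>w\<in>sign_paths (Suc k). H (chain w (Suc k)))
      = (\<Sum>w\<in>sign_paths k. \<Sum>v\<in>sign_cube. H (if fst (chain w k) < T then step v (chain w k) else chain w k))" for H :: "'n state \<Rightarrow> real"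
  proof -
    have "chain (w(Suc k := v)) k = chain w k" for w v by (rule sticky_chain_cong) simp
    hence "chain (w(Suc k := v)) (Suc k) = (if fst (chain w k) < T then step v (chain w k) else chain w k)" for w v
      by (simp only: sticky_chain.simps Let_def fun_upd_same)
    thus ?thesis unfolding sum_sign_paths_Suc by (simp only:)
  qed
  define a where "a = (\<lambda>w. (\<Sum>v\<in>sign_cube. state_value (if fst (chain w k) < T then step v (chain w k) else chain w k))
      - N * state_value (chain w k))"
  define d where "d = (\<lambda>w. (\<Sum>v\<in>sign_cube. clock (if fst (chain w k) < T then step v (chain w k) else chain w k))
      - N * clock (chain w k))"
  have ad: "\<bar>a w\<bar> \<le> error_rate * h * d w" if "w \<in> sign_paths k" for w
  proof -
    have "regular k (chain w k)" using that by (intro regular_chain) (auto simp: sign_paths_def PiE_def Pi_def)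
    thus ?thesis unfolding a_def d_def N_def by (rule average_step)
  qed
  have "\<bar>sum a (sign_paths k)\<bar> \<le> (\<Sum>w\<in>sign_paths k. error_rate * h * d w)"
    by (rule order_trans[OF sum_abs]) (rule sum_mono, rule ad)
  hence 1: "\<bar>sum a (sign_paths k)\<bar> \<le> error_rate * h * sum d (sign_paths k)" by (simp add: sum_distrib_left)
  define I where "I = (\<Sum>w\<in>sign_paths k. state_value (chain w k)) - n k * u (t0, x)"
  define J where "J = (\<Sum>w\<in>sign_paths k. clock (chain w k)) - n k * stop_clock T t0"
  have "N * \<bar>I\<bar> \<le> N * (error_rate * h * J)"
    using Suc.IH unfolding I_def J_def n_def by (intro mult_left_mono) (auto simp: N_def)
  hence 2: "\<bar>N * I\<bar> \<le> error_rate * h * (N * J)" by (simp add: abs_mult N_def mult_ac)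
  have eI: "(\<Sum>w\<in>sign_paths (Suc k). state_value (chain w (Suc k))) - n (Suc k) * u (t0, x) = sum a (sign_paths k) + N * I"
    unfolding S nS a_def I_def by (simp add: sum_subtractf sum_distrib_left algebra_simps)
  have eJ: "(\<Sum>w\<in>sign_paths (Suc k). clock (chain w (Suc k))) - n (Suc k) * stop_clock T t0 = sum d (sign_paths k) + N * J"
    unfolding S[of "\<lambda>s. clock s"] nS d_def J_def by (simp add: sum_subtractf sum_distrib_left algebra_simps)
  have "\<bar>sum a (sign_paths k) + N * I\<bar> \<le> error_rate * h * sum d (sign_paths k) + error_rate * h * (N * J)" using 1 2 by linarith
  also have "\<dots> = error_rate * h * (sum d (sign_paths k) + N * J)" by (simp add: distrib_left)
  finally show ?case unfolding eI[unfolded n_def] eJ[unfolded n_def] .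
qed

lemma sticky_convergence:
  assumes fin: "\<And>y. y \<in> closure G \<Longrightarrow> u (T, y) = \<phi> y"
    and prob: "prob_space M"
    and ind: "prob_space.indep_vars M (\<lambda>_. borel) (\<lambda>(k, i) \<omega>. \<xi> k \<omega> $ i) ({1..} \<times> UNIV)"
    and val: "\<And>k i \<omega>. 1 \<le> k \<Longrightarrow> \<omega> \<in> space M \<Longrightarrow> \<xi> k \<omega> $ i = 1 \<or> \<xi> k \<omega> $ i = - 1"
    and p: "\<And>k i. 1 \<le> k \<Longrightarrow> measure M {\<omega> \<in> space M. \<xi> k \<omega> $ i = 1} = 1/2"
      "\<And>k i. 1 \<le> k \<Longrightarrow> measure M {\<omega> \<in> space M. \<xi> k \<omega> $ i = - 1} = 1/2"
  defines "V \<equiv> \<lambda>\<omega>. payoff \<phi> (final_state T step (t0, x, 1, 0) (\<lambda>k. \<xi> k \<omega>))"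
  shows "integrable M V \<and> \<bar>(\<integral>\<omega>. V \<omega> \<partial>M) - u (t0, x)\<bar> \<le> error_rate * (T + 1) * h"
proof -
  interpret prob_space M by fact
  \<comment> \<open>A chain still running after \<open>N\<close> steps would have a time of at least
    \<open>t0 + N * h\<close>, which exceeds \<open>T\<close>; so \<open>N\<close> steps stop every
    path.\<close>
  obtain N0 :: nat where N0: "T / h < N0" using reals_Archimedean2 by blast
  define N where "N = Suc N0"
  have N: "T < N * h" "1 \<le> N" using N0 h by (auto simp: N_def divide_less_eq algebra_simps add_strict_increasing)
  define F where "F = (\<lambda>w. state_value (chain w N))"
  have stopped: "fst (chain w N) = T \<and> state_value (chain w N) = payoff \<phi> (chain w N)"
    if "\<And>j. 1 \<le> j \<Longrightarrow> w j \<in> sign_cube" for w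
  proof -
    obtain t X Y Z where c: "chain w N = (t, X, Y, Z)" by (metis prod_cases4)
    have r: "regular N (t, X, Y, Z)" using regular_chain[of N w] that c by simp
    have "t = T" using r N t0 by (auto simp: regular_def)
    thus ?thesis using c r fin by (simp add: state_value_def payoff_def regular_def)
  qed
  have VF: "V \<omega> = F (\<lambda>k. \<xi> k \<omega>)" if "\<omega> \<in> space M" for \<omega>
    using stopped[of "\<lambda>k. \<xi> k \<omega>"] val that final_state_eq[of T step "(t0, x, 1, 0)" "\<lambda>k. \<xi> k \<omega>" N]
    by (simp add: V_def F_def sign_cube_def)
  have Fc: "F v = F w" if "\<And>j. 1 \<le> j \<Longrightarrow> j \<le> N \<Longrightarrow> v j = w j" for v w
    unfolding F_def using sticky_chain_cong[of N v w] that by metis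
  have "integrable M (\<lambda>\<omega>. F (\<lambda>k. \<xi> k \<omega>))"
    by (rule expectation_sign_paths(1)[OF finite_sign_cube ind val p Fc N(2)])
  hence iV: "integrable M V" using VF by (simp cong: Bochner_Integration.integrable_cong)
  have "(\<integral>\<omega>. F (\<lambda>k. \<xi> k \<omega>) \<partial>M) = (\<Sum>w\<in>sign_paths N. F w) / card (sign_paths N :: (nat \<Rightarrow> real ^ 'n) set)"
    by (rule expectation_sign_paths(2)[OF finite_sign_cube ind val p Fc N(2)])
  hence eV: "(\<integral>\<omega>. V \<omega> \<partial>M) = (\<Sum>w\<in>sign_paths N. F w) / card (sign_paths N :: (nat \<Rightarrow> real ^ 'n) set)"
    using VF by (simp cong: Bochner_Integration.integral_cong)
  define n where "n = real (card (sign_paths N :: (nat \<Rightarrow> real ^ 'n) set))"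
  have finN: "finite (sign_paths N :: (nat \<Rightarrow> real ^ 'n) set)"
    unfolding sign_paths_def using finite_sign_cube by (intro finite_PiE) auto
  have "(sign_paths N :: (nat \<Rightarrow> real ^ 'n) set) \<noteq> {}"
    unfolding sign_paths_def by (simp add: PiE_eq_empty_iff sign_cube_nonempty)
  with finN have n: "n > 0" by (simp add: n_def card_gt_0_iff)
  have A0: "0 \<le> error_rate * h" using K0 h by (simp add: error_rate_def)
  \<comment> \<open>The total advance of the clock is at most \<open>T + 1\<close>, the unit being
    the one added at stopping; this makes the accumulated error \<open>O(h)\<close> whatever the
    number of reflections.\<close>
  have "(\<Sum>w\<in>sign_paths N. clock (chain w N)) \<le> (\<Sum>w\<in>(sign_paths N :: (nat \<Rightarrow> real ^ 'n) set). T + 1)"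
  proof (rule sum_mono)
    fix w :: "nat \<Rightarrow> real ^ 'n" assume w: "w \<in> sign_paths N"
    obtain t X Y Z where c: "chain w N = (t, X, Y, Z)" by (metis prod_cases4)
    have "regular N (t, X, Y, Z)"
      using regular_chain[of N w] w c by (auto simp: sign_paths_def PiE_def Pi_def)
    thus "clock (chain w N) \<le> T + 1" by (auto simp: regular_def stop_clock_def c)
  qed
  also have "\<dots> = n * (T + 1)" by (simp add: n_def)
  finally have "(\<Sum>w\<in>sign_paths N. clock (chain w N)) \<le> n * (T + 1)" .
  moreover have "0 \<le> n * stop_clock T t0" using t0 n by (simp add: stop_clock_def)
  ultimately have "(\<Sum>w\<in>sign_paths N. clock (chain w N)) - n * stop_clock T t0 \<le> n * (T + 1)" by linarith
  hence "error_rate * h * ((\<Sum>w\<in>sign_paths N. clock (chain w N)) - n * stop_clock T t0) \<le> error_rate * h * (n * (T + 1))"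
    using A0 by (rule mult_left_mono)
  hence "\<bar>sum F (sign_paths N) - n * u (t0, x)\<bar> \<le> error_rate * h * (n * (T + 1))"
    using chain_average[of N] unfolding F_def n_def by linarith
  also have "sum F (sign_paths N) - n * u (t0, x) = n * ((\<integral>\<omega>. V \<omega> \<partial>M) - u (t0, x))"
    unfolding eV n_def[symmetric] using n by (simp add: field_simps)
  also have "\<bar>\<dots>\<bar> = n * \<bar>(\<integral>\<omega>. V \<omega> \<partial>M) - u (t0, x)\<bar>" using n by (simp add: abs_mult)
  also have "error_rate * h * (n * (T + 1)) = n * (error_rate * (T + 1) * h)" by (simp add: mult_ac)
  finally have "\<bar>(\<integral>\<omega>. V \<omega> \<partial>M) - u (t0, x)\<bar> \<le> error_rate * (T + 1) * h" using n by simp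
  with iV show ?thesis by blast
qed

end

end

section \<open>Derivatives as multilinear forms\<close>

definition lin_form :: "('a::euclidean_space list \<Rightarrow> real) \<Rightarrow> 'a \<Rightarrow> real" where
  "lin_form J h = (\<Sum>e\<in>Basis. (h \<bullet> e) * J [e])"

text \<open>The first argument belongs to the derivative taken first, which stands last in the list.
  The nested form of the sum lets \<open>inner_sum_bound\<close> be applied once for each
  argument.\<close>

definition bil_form :: "('a::euclidean_space list \<Rightarrow> real) \<Rightarrow> 'a \<Rightarrow> 'a \<Rightarrow> real" where
  "bil_form J h k = (\<Sum>e\<in>Basis. (h \<bullet> e) * (\<Sum>f\<in>Basis. (k \<bullet> f) * J [f, e]))"

definition tri_form :: "('a::euclidean_space list \<Rightarrow> real) \<Rightarrow> 'a \<Rightarrow> 'a \<Rightarrow> 'a \<Rightarrow> real" where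
  "tri_form J h k l = (\<Sum>e\<in>Basis. (h \<bullet> e) * (\<Sum>f\<in>Basis. (k \<bullet> f) * (\<Sum>g\<in>Basis. (l \<bullet> g) * J [g, f, e])))"

lemma linear_inner_sum: "linear (\<lambda>h :: 'a::euclidean_space. \<Sum>e\<in>Basis. (h \<bullet> e) * (a e :: real))"
  by (intro linearI) (simp_all add: inner_add_left algebra_simps sum.distrib sum_distrib_left)

lemma linear_lin_form: "linear (lin_form J)"
  unfolding lin_form_def by (rule linear_inner_sum)

lemma linear_bil_form: "linear (bil_form J h)"
  unfolding bil_form_def
  by (intro linearI) (simp_all add: inner_add_left algebra_simps sum.distrib sum_distrib_left)

lemma linear_tri_form: "linear (tri_form J h k)"
  unfolding tri_form_def
  by (intro linearI) (simp_all add: inner_add_left algebra_simps sum.distrib sum_distrib_left)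

lemma bil_form_sym:
  assumes "swap_invariant m J" "2 \<le> m"
  shows "bil_form J h k = bil_form J k h"
proof -
  have sw: "J [f, e] = J [e, f]" if "e \<in> Basis" "f \<in> Basis" for e f
    using assms that unfolding swap_invariant_def
    by (metis append_Nil empty_set empty_subsetI insert_subset length_Cons list.simps(15) list.size(3) numeral_2_eq_2)
  have "bil_form J h k = (\<Sum>e\<in>Basis. \<Sum>f\<in>Basis. (k \<bullet> f) * ((h \<bullet> e) * J [e, f]))"
    unfolding bil_form_def by (auto simp: sum_distrib_left sw mult_ac intro!: sum.cong)
  also have "\<dots> = bil_form J k h"
    unfolding bil_form_def by (subst sum.swap) (simp add: sum_distrib_left)
  finally show ?thesis .
qed

lemma swap_invariant_Cons:
  assumes "swap_invariant (Suc m) J" "e \<in> Basis"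
  shows "swap_invariant m (\<lambda>es. J (e # es))" "swap_invariant m (\<lambda>es. J (es @ [e]))"
  unfolding swap_invariant_def
proof (safe)
  fix xs ys :: "'a list" and a b assume *: "set (xs @ a # b # ys) \<subseteq> Basis" "length (xs @ a # b # ys) \<le> m"
  show "J (e # xs @ a # b # ys) = J (e # xs @ b # a # ys)"
    using assms * spec[OF assms(1)[unfolded swap_invariant_def], of "e # xs"] by simp
  show "J ((xs @ a # b # ys) @ [e]) = J ((xs @ b # a # ys) @ [e])"
    using assms * assms(1)[unfolded swap_invariant_def, rule_format, of xs a b "ys @ [e]"] by simp
qed

lemma tri_form_eq: "tri_form J h k l = (\<Sum>e\<in>Basis. (h \<bullet> e) * bil_form (\<lambda>es. J (es @ [e])) k l)"
  by (simp add: tri_form_def bil_form_def)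

lemma tri_form_eq': "tri_form J h k l = (\<Sum>g\<in>Basis. (l \<bullet> g) * bil_form (\<lambda>es. J (g # es)) h k)"
proof -
  have "tri_form J h k l = (\<Sum>e\<in>Basis. \<Sum>f\<in>Basis. \<Sum>g\<in>Basis. (l \<bullet> g) * ((h \<bullet> e) * ((k \<bullet> f) * J [g, f, e])))"
    unfolding tri_form_def by (simp add: sum_distrib_left mult_ac)
  also have "\<dots> = (\<Sum>e\<in>Basis. \<Sum>g\<in>Basis. \<Sum>f\<in>Basis. (l \<bullet> g) * ((h \<bullet> e) * ((k \<bullet> f) * J [g, f, e])))"
    by (intro sum.cong refl sum.swap)
  also have "\<dots> = (\<Sum>g\<in>Basis. \<Sum>e\<in>Basis. \<Sum>f\<in>Basis. (l \<bullet> g) * ((h \<bullet> e) * ((k \<bullet> f) * J [g, f, e])))"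
    by (rule sum.swap)
  finally show ?thesis unfolding bil_form_def by (simp add: sum_distrib_left)
qed

text \<open>Fixing the last or the first argument leaves a combination of bilinear forms of
  shortened jets, so both transpositions reduce to \<open>bil_form_sym\<close>.\<close>

lemma tri_form_sym:
  assumes "swap_invariant 3 J"
  shows "tri_form J h k l = tri_form J k h l" "tri_form J h k l = tri_form J h l k"
proof -
  have 3: "swap_invariant (Suc 2) J" using assms by (simp add: numeral_3_eq_3)
  show "tri_form J h k l = tri_form J k h l"
    unfolding tri_form_eq' using bil_form_sym[OF swap_invariant_Cons(1)[OF 3]] by (intro sum.cong) auto
  show "tri_form J h k l = tri_form J h l k"
    unfolding tri_form_eq using bil_form_sym[OF swap_invariant_Cons(2)[OF 3]] by (intro sum.cong) auto
qed

lemma inner_sum_bound: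
  fixes c :: real
  assumes "\<And>e. e \<in> Basis \<Longrightarrow> \<bar>a e\<bar> \<le> c"
  shows "\<bar>\<Sum>e\<in>Basis. (h \<bullet> e) * a e\<bar> \<le> DIM('a) * c * norm (h :: 'a::euclidean_space)"
proof -
  have "norm (\<Sum>e\<in>Basis. (h \<bullet> e) * a e) \<le> (\<Sum>e\<in>(Basis :: 'a set). norm h * c)"
    using assms Basis_le_norm[of _ h] by (intro sum_norm_le) (auto simp: abs_mult intro!: mult_mono)
  thus ?thesis by (simp add: mult_ac)
qed

lemma forms_bounded:
  fixes J :: "'a::euclidean_space list \<Rightarrow> real" and M K :: real
  assumes M: "\<And>es. set es \<subseteq> Basis \<Longrightarrow> length es \<le> 3 \<Longrightarrow> \<bar>J es\<bar> \<le> M" and K: "DIM('a) ^ 3 * M \<le> K"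
  shows "\<bar>lin_form J h\<bar> \<le> K * norm h" "\<bar>bil_form J h k\<bar> \<le> K * norm h * norm k"
    "\<bar>tri_form J h k l\<bar> \<le> K * norm h * norm k * norm l"
proof -
  define N where "N = real DIM('a)"
  have N: "N \<ge> 1" using DIM_positive[where 'a='a] by (simp add: N_def Suc_leI)
  have M0: "0 \<le> M" using M[of "[]"] by simp
  have KN: "N * (N * (N * M)) \<le> K" using K by (simp add: N_def power3_eq_cube mult_ac)
  have NM: "M \<le> N * M" "N * M \<le> N * (N * M)" "N * (N * M) \<le> N * (N * (N * M))"
    using N M0 mult_right_mono[of 1 N "M"] mult_right_mono[of 1 N "N * M"] mult_right_mono[of 1 N "N * (N * M)"] by auto
  have "\<bar>lin_form J h\<bar> \<le> N * M * norm h" unfolding lin_form_def N_def by (intro inner_sum_bound M) auto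
  also have "\<dots> \<le> K * norm h" using NM KN by (intro mult_right_mono) auto
  finally show "\<bar>lin_form J h\<bar> \<le> K * norm h" .
  have "\<bar>bil_form J h k\<bar> \<le> N * (N * M * norm k) * norm h"
    unfolding bil_form_def N_def by (intro inner_sum_bound M) auto
  also have "\<dots> = N * (N * M) * (norm h * norm k)" by (simp add: mult_ac)
  also have "\<dots> \<le> K * (norm h * norm k)" using NM KN by (intro mult_right_mono) auto
  finally show "\<bar>bil_form J h k\<bar> \<le> K * norm h * norm k" by (simp add: mult_ac)
  have "\<bar>tri_form J h k l\<bar> \<le> N * (N * (N * M * norm l) * norm k) * norm h"
    unfolding tri_form_def N_def by (intro inner_sum_bound M) auto
  also have "\<dots> = N * (N * (N * M)) * (norm h * norm k * norm l)" by (simp add: mult_ac)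
  also have "\<dots> \<le> K * (norm h * norm k * norm l)" using KN by (intro mult_right_mono) auto
  finally show "\<bar>tri_form J h k l\<bar> \<le> K * norm h * norm k * norm l" by (simp add: mult_ac)
qed

text \<open>Translates the list-indexed Taylor polynomials of \<open>u\<close> and of its first
  derivatives into the forms used in the locale \<open>sticky\<close>.\<close>

lemma taylor_forms:
  "taylor 3 J [] h = J [] + lin_form J h + bil_form J h h / 2 + tri_form J h h h / 6"
  "(\<Sum>e\<in>Basis. (k \<bullet> e) * taylor 2 J [e] h) = lin_form J k + bil_form J k h + tri_form J k h h / 2"
  by (simp_all add: taylor_def eval_nat_numeral lin_form_def bil_form_def tri_form_def
      sum_distrib_left sum_divide_distrib sum.distrib distrib_left mult_ac)

lemma sum_space_time_Basis:
  fixes F :: "real \<times> (real ^ 'n) \<Rightarrow> real"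
  shows "(\<Sum>e\<in>Basis. F e) = F time_dir + (\<Sum>i\<in>UNIV. F (space_dir i))"
proof -
  have ax: "(\<Sum>e\<in>(Basis :: (real ^ 'n) set). f e) = (\<Sum>i\<in>UNIV. f (axis i 1))" for f :: "real ^ 'n \<Rightarrow> real"
    unfolding Basis_vec_def by (simp add: sum.UNION_disjoint axis_eq_axis)
  have "inj_on (\<lambda>u. (u :: real, 0 :: real ^ 'n)) Basis" "inj_on (\<lambda>u. (0 :: real, u :: real ^ 'n)) Basis"
    by (auto intro!: inj_onI)
  hence "(\<Sum>e\<in>Basis. F e) = (\<Sum>t\<in>Basis. F (t, 0)) + (\<Sum>y\<in>Basis. F (0, y))"
    unfolding Basis_prod_def by (subst sum.union_disjoint) (auto simp: Basis_prod_def sum.reindex)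
  thus ?thesis by (simp add: ax)
qed

lemma lin_form_space_time:
  "lin_form J (a, w :: real ^ 'n) = a * J [time_dir] + (\<Sum>i\<in>UNIV. w $ i * J [space_dir i])"
  unfolding lin_form_def sum_space_time_Basis by (simp add: inner_axis)

lemma bil_form_space:
  "bil_form J (0, v) (0, w :: real ^ 'n) = (\<Sum>i\<in>UNIV. v $ i * (\<Sum>j\<in>UNIV. w $ j * J [space_dir j, space_dir i]))"
  unfolding bil_form_def sum_space_time_Basis by (simp add: inner_axis)

section \<open>Second moments of the signs\<close>

text \<open>For \<open>k \<noteq> l\<close>, flipping the sign of coordinate \<open>k\<close> is a
  bijection of the cube that negates the product.\<close>

lemma sign_cube_moment:
  assumes "finite (sign_cube :: (real ^ 'n) set)"
  shows "(\<Sum>\<xi>\<in>(sign_cube :: (real ^ 'n) set). \<xi> $ k * \<xi> $ l) = (if k = l then real (card (sign_cube :: (real ^ 'n) set)) else 0)"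
proof (cases "k = l")
  case True
  have "\<xi> $ l * \<xi> $ l = 1" if "\<xi> \<in> sign_cube" for \<xi> :: "real ^ 'n"
  proof -
    have "\<xi> $ l = 1 \<or> \<xi> $ l = - 1" using that by (simp add: sign_cube_def)
    thus ?thesis by auto
  qed
  thus ?thesis using True by simp
next
  case False
  define fl where "fl = (\<lambda>\<xi> :: real ^ 'n. \<chi> i. if i = k then - \<xi> $ i else \<xi> $ i)"
  have "(\<Sum>\<xi>\<in>(sign_cube :: (real ^ 'n) set). \<xi> $ k * \<xi> $ l) = (\<Sum>\<xi>\<in>(sign_cube :: (real ^ 'n) set). - (\<xi> $ k * \<xi> $ l))"
  proof (rule sum.reindex_bij_witness[of _ fl fl])
    fix \<xi> :: "real ^ 'n" assume "\<xi> \<in> sign_cube"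
    show "fl (fl \<xi>) = \<xi>" by (simp add: fl_def vec_eq_iff)
    show "fl (fl \<xi>) = \<xi>" by (simp add: fl_def vec_eq_iff)
    show "fl \<xi> \<in> sign_cube" using \<open>\<xi> \<in> sign_cube\<close> by (auto simp: sign_cube_def fl_def)
    show "fl \<xi> \<in> sign_cube" using \<open>\<xi> \<in> sign_cube\<close> by (auto simp: sign_cube_def fl_def)
    show "- (fl \<xi> $ k * fl \<xi> $ l) = \<xi> $ k * \<xi> $ l" using False by (simp add: fl_def)
  qed
  thus ?thesis using False by (simp add: sum_negf)
qed

text \<open>The origin of the matrix \<open>\<sigma> \<sigma>\<^sup>T\<close> in the generator: the
  signs are uncorrelated with unit variance.\<close>

lemma sign_cube_second_moment:
  fixes S :: "real ^ 'n ^ 'n"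
  assumes "finite (sign_cube :: (real ^ 'n) set)"
  shows "(\<Sum>\<xi>\<in>sign_cube. (S *v \<xi>) $ i * (S *v \<xi>) $ j)
    = card (sign_cube :: (real ^ 'n) set) * (S ** transpose S) $ i $ j"
proof -
  have "(\<Sum>\<xi>\<in>sign_cube. (S *v \<xi>) $ i * (S *v \<xi>) $ j)
      = (\<Sum>\<xi>\<in>sign_cube. \<Sum>k\<in>UNIV. \<Sum>l\<in>UNIV. S $ i $ k * S $ j $ l * (\<xi> $ k * \<xi> $ l))"
    by (simp add: matrix_vector_mult_def sum_product mult_ac)
  also have "\<dots> = (\<Sum>k\<in>UNIV. \<Sum>\<xi>\<in>sign_cube. \<Sum>l\<in>UNIV. S $ i $ k * S $ j $ l * (\<xi> $ k * \<xi> $ l))" by (rule sum.swap)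
  also have "\<dots> = (\<Sum>k\<in>UNIV. \<Sum>l\<in>UNIV. \<Sum>\<xi>\<in>sign_cube. S $ i $ k * S $ j $ l * (\<xi> $ k * \<xi> $ l))"
    by (intro sum.cong refl sum.swap)
  also have "\<dots> = (\<Sum>k\<in>UNIV. S $ i $ k * S $ j $ k * card (sign_cube :: (real ^ 'n) set))"
    by (simp add: sum_distrib_left[symmetric] sign_cube_moment[OF assms] if_distrib cong: if_cong)
  also have "\<dots> = card (sign_cube :: (real ^ 'n) set) * (S ** transpose S) $ i $ j"
    by (simp add: matrix_matrix_mult_def transpose_def sum_distrib_left mult_ac)
  finally show ?thesis .
qed

section \<open>Derivatives at the final time\<close>

lemma quadratic_remainder_DERIV:
  fixes f :: "real \<Rightarrow> real"
  assumes "d > 0" "\<And>s. \<bar>s\<bar> < d \<Longrightarrow> \<bar>f s\<bar> \<le> K * s\<^sup>2"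
  shows "(f has_real_derivative 0) (at 0)"
proof -
  have f0: "f 0 = 0" using assms(2)[of 0] assms(1) by simp
  have lim: "((\<lambda>s. \<bar>K\<bar> * \<bar>s\<bar>) \<longlongrightarrow> \<bar>K\<bar> * \<bar>0\<bar>) (at (0 :: real))" by (intro tendsto_intros)
  have "((\<lambda>s. f s / s) \<longlongrightarrow> 0) (at 0)"
  proof (rule Lim_null_comparison)
    show "((\<lambda>s. \<bar>K\<bar> * \<bar>s\<bar>) \<longlongrightarrow> 0) (at (0 :: real))" using lim by simp
    show "\<forall>\<^sub>F s in at 0. norm (f s / s) \<le> \<bar>K\<bar> * \<bar>s\<bar>"
      unfolding eventually_at
    proof (intro exI[of _ d] conjI ballI impI assms(1); elim conjE)
      fix s :: real assume s: "s \<noteq> 0" "dist s 0 < d"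
      have "\<bar>f s\<bar> \<le> K * s\<^sup>2" using s assms(2)[of s] by simp
      also have "\<dots> \<le> \<bar>K\<bar> * s\<^sup>2" by (intro mult_right_mono) auto
      finally have "\<bar>f s\<bar> \<le> \<bar>K\<bar> * (\<bar>s\<bar> * \<bar>s\<bar>)" by (simp add: power2_eq_square)
      thus "norm (f s / s) \<le> \<bar>K\<bar> * \<bar>s\<bar>" using s by (simp add: abs_divide divide_le_eq mult.assoc)
    qed
  qed
  thus ?thesis unfolding has_field_derivative_iff by (simp add: f0)
qed

text \<open>The generator of \<open>\<phi>\<close> at time \<open>T\<close> is an extension of interior values; the Taylor estimate at points
  \<open>(T, y)\<close> identifies the derivatives of \<open>\<phi>\<close> with those of \<open>u\<close>.\<close>

lemma final_time_derivatives:
  fixes G :: "'a::euclidean_space set" and u :: "real \<times> 'a \<Rightarrow> real"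
  assumes T: "T > 0" and G: "open G"
    and u: "smooth_closure (\<lambda>_. 1) 4 (cyl T G) u"
    and est: "\<And>p q es. p \<in> closure (cyl T G) \<Longrightarrow> q \<in> closure (cyl T G) \<Longrightarrow> dist p q < \<delta> \<Longrightarrow> set es \<subseteq> Basis \<Longrightarrow>
      length es \<le> 3 \<Longrightarrow> \<bar>cl_partial (cyl T G) es u q - taylor (3 - length es) (\<lambda>fs. cl_partial (cyl T G) fs u p) es (q - p)\<bar>
       \<le> K * norm (q - p) ^ (Suc 3 - length es)"
    and \<delta>: "\<delta> > 0" and final: "\<And>y. y \<in> closure G \<Longrightarrow> u (T, y) = \<phi> y"
    and es: "set es \<subseteq> Pair 0 ` Basis" "length es \<le> 3" and z: "z \<in> closure G"
  shows "cl_partial (cyl T G) es (\<lambda>(_, y). \<phi> y) (T, z) = cl_partial (cyl T G) es u (T, z)"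
proof -
  define \<Omega> where "\<Omega> = cyl T G"
  define J where "J = (\<lambda>p es. cl_partial \<Omega> es u p)"
  have o: "open \<Omega>" unfolding \<Omega>_def cyl_def using G by (intro open_Times) auto
  have cl: "closure \<Omega> = {0..T} \<times> closure G" unfolding \<Omega>_def by (rule closure_cyl[OF T])
  have bas: "Pair 0 ` Basis \<subseteq> (Basis :: (real \<times> 'a) set)" by (auto simp: Basis_prod_def)
  have TG: "(T, y) \<in> closure \<Omega>" if "y \<in> closure G" for y using that T by (simp add: cl)
  have cont: "continuous_on (closure \<Omega>) u" using u unfolding \<Omega>_def smooth_closure_def by blast
  \<comment> \<open>The claim holds at every time \<open>t\<close>, because \<open>\<phi>\<close>
    does not depend on time, while the jet of \<open>u\<close> is always the one at time
    \<open>T\<close>. The induction differentiates the boundary values of \<open>u\<close> within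
    the final slice.\<close>
  have inside: "dpartial es (\<lambda>(_, y). \<phi> y) (t, y) = J (T, y) es"
    if "set es \<subseteq> Pair 0 ` Basis" "length es \<le> 3" "y \<in> G" for es t y
    using that
  proof (induction es arbitrary: y)
    case Nil
    hence "y \<in> closure G" using closure_subset by blast
    thus ?case using cl_partial_Nil[OF cont TG] final by (simp add: J_def)
  next
    case (Cons e es)
    obtain e' where e: "e = (0, e')" "e' \<in> Basis" using Cons.prems by auto
    have eB: "e \<in> Basis" "set es \<subseteq> Basis" using Cons.prems bas by auto
    have ne: "norm e = 1" using eB by simp
    obtain d where d: "d > 0" "ball y d \<subseteq> G" using G Cons.prems open_contains_ball by blast
    define d' where "d' = min d (min 1 \<delta>)"
    have d': "d' > 0" "d' \<le> d" "d' \<le> 1" "d' \<le> \<delta>" using d \<delta> by (auto simp: d'_def)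
    have in_G: "y + s *\<^sub>R e' \<in> G" if "\<bar>s\<bar> < d'" for s
      using that d' d(2) e(2) by (auto simp: dist_norm subset_iff)
    \<comment> \<open>The derivative \<open>es\<close> of \<open>u\<close> is expanded to degree
      \<open>Suc n = 3 - length es\<close>; since \<open>es\<close> has length at most 2, the
      remainder is at least quadratic.\<close>
    define n where "n = 2 - length es"
    have n: "3 - length es = Suc n" "length es + Suc n \<le> 4" using Cons.prems by (auto simp: n_def)
    define \<tau> where "\<tau> = (\<lambda>s. taylor (Suc n) (J (T, y)) es (s *\<^sub>R e))"
    define f where "f = (\<lambda>s. J (T, y + s *\<^sub>R e') es)"
    have yG: "y \<in> closure G" using Cons.prems closure_subset by blast
    have sw: "swap_invariant 4 (J (T, y))" unfolding J_def
      using cl_partial_swap[OF o u[folded \<Omega>_def] TG[OF yG]] .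
    have "(\<tau> has_derivative (\<lambda>s. \<Sum>k\<in>Basis. ((s *\<^sub>R e) \<bullet> k) * taylor n (J (T, y)) (k # es) (0 *\<^sub>R e))) (at 0)"
      unfolding \<tau>_def
    proof (rule has_derivative_compose[where g = "taylor (Suc n) (J (T, y)) es" and f' = "\<lambda>s. s *\<^sub>R e"])
      show "((\<lambda>s. s *\<^sub>R e) has_derivative (\<lambda>s. s *\<^sub>R e)) (at 0)" by (auto intro!: derivative_eq_intros)
    qed (rule taylor_has_derivative[OF sw eB(2) n(2)])
    also have "(\<lambda>s. \<Sum>k\<in>Basis. ((s *\<^sub>R e) \<bullet> k) * taylor n (J (T, y)) (k # es) (0 *\<^sub>R e))
        = (\<lambda>s. s * J (T, y) (e # es))"
    proof
      fix s :: real
      have "(\<Sum>k\<in>Basis. ((s *\<^sub>R e) \<bullet> k) * taylor n (J (T, y)) (k # es) (0 *\<^sub>R e))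
         = (\<Sum>k\<in>Basis. if k = e then s * J (T, y) (e # es) else 0)"
        using eB by (intro sum.cong) (auto simp: inner_Basis)
      thus "(\<Sum>k\<in>Basis. ((s *\<^sub>R e) \<bullet> k) * taylor n (J (T, y)) (k # es) (0 *\<^sub>R e)) = s * J (T, y) (e # es)"
        using eB by simp
    qed
    finally have 1: "(\<tau> has_real_derivative J (T, y) (e # es)) (at 0)"
      by (simp add: has_field_derivative_def mult_commute_abs)
    \<comment> \<open>Along the final slice the jet differs from its Taylor polynomial by a
      quadratic remainder, so both have the same derivative at 0.\<close>
    have 2: "((\<lambda>s. f s - \<tau> s) has_real_derivative 0) (at 0)"
    proof (rule quadratic_remainder_DERIV[OF d'(1)])
      fix s assume s: "\<bar>s\<bar> < d'"
      have "y + s *\<^sub>R e' \<in> closure G" using in_G[OF s] closure_subset by blast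
      note cls = TG[OF yG] TG[OF this]
      have diff: "(T, y + s *\<^sub>R e') - (T, y) = s *\<^sub>R e" by (simp add: e)
      have "dist (T, y) (T, y + s *\<^sub>R e') < \<delta>"
        using s d' ne diff by (metis dist_commute dist_norm less_le_trans mult.right_neutral norm_scaleR)
      from est[folded \<Omega>_def, OF cls this eB(2)] Cons.prems
      have "\<bar>f s - \<tau> s\<bar> \<le> K * \<bar>s\<bar> ^ (Suc 3 - length es)"
        unfolding diff f_def \<tau>_def J_def using n ne by simp
      also have "\<dots> \<le> \<bar>K\<bar> * \<bar>s\<bar> ^ (Suc 3 - length es)" by (intro mult_right_mono) auto
      also have "\<dots> \<le> \<bar>K\<bar> * \<bar>s\<bar> ^ 2"
        using s d' Cons.prems by (intro mult_left_mono power_decreasing) auto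
      finally show "\<bar>f s - \<tau> s\<bar> \<le> \<bar>K\<bar> * s\<^sup>2" by simp
    qed
    from DERIV_add[OF 2 1] have fd: "(f has_real_derivative J (T, y) (e # es)) (at 0)" by simp
    have "eventually (\<lambda>s. s \<in> ball 0 d') (nhds (0 :: real))"
      using d' by (intro eventually_nhds_in_open) auto
    hence ev: "eventually (\<lambda>s. dpartial es (\<lambda>(_, y). \<phi> y) ((t, y) + s *\<^sub>R e) = f s) (nhds 0)"
    proof eventually_elim
      case (elim s)
      hence "y + s *\<^sub>R e' \<in> G" by (intro in_G) simp
      thus ?case using Cons.IH Cons.prems by (simp add: e f_def)
    qed
    show ?case using deriv_cong_ev[OF ev refl] DERIV_imp_deriv[OF fd] by simp
  qed
  have esB: "set es \<subseteq> Basis" using es bas by blast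
  \<comment> \<open>The jet of \<open>u\<close> at time \<open>T\<close>, regarded as constant in
    time, is thus the continuous extension that defines the boundary values of the derivatives of
    \<open>\<phi>\<close>.\<close>
  have "continuous_on (closure \<Omega>) (\<lambda>p. J (T, snd p) es)"
  proof (rule continuous_on_compose2[where f = "\<lambda>p. (T, snd p)" and t = "closure \<Omega>"])
    show "continuous_on (closure \<Omega>) (\<lambda>p. J p es)"
      unfolding J_def \<Omega>_def using es esB by (intro smooth_closure_continuous[OF u]) auto
    show "continuous_on (closure \<Omega>) (\<lambda>p. (T, snd p))" by (intro continuous_intros)
    show "(\<lambda>p. (T, snd p)) ` closure \<Omega> \<subseteq> closure \<Omega>" using T by (auto simp: cl)
  qed
  from cl_partial_limit[OF this _ TG[OF z], of es "\<lambda>(_, y). \<phi> y"]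
  show ?thesis using inside[OF es] by (force simp: \<Omega>_def[symmetric] J_def cyl_def \<Omega>_def)
qed

section \<open>Convergence\<close>

lemma vector_data_bounded:
  fixes b :: "real \<times> (real ^ 'n) \<Rightarrow> real ^ 'n"
  assumes "\<And>i. parabolic_holder \<epsilon> T G (\<lambda>p. b p $ i)" "bounded G" "T > 0"
  shows "\<exists>C>0. \<forall>z\<in>{0..T} \<times> closure G. norm (b z) \<le> C"
proof -
  have "continuous_on (closure (cyl T G)) (\<lambda>z. \<Sum>i\<in>UNIV. \<bar>b z $ i\<bar>)"
    by (intro continuous_on_sum continuous_on_rabs parabolic_holder_continuous[OF assms(1)])
  from cyl_continuous_bounded[OF this assms(2,3)] obtain C where C: "C > 0"
    "\<And>t y. t \<in> {0..T} \<Longrightarrow> y \<in> closure G \<Longrightarrow> \<bar>\<Sum>i\<in>UNIV. \<bar>b (t, y) $ i\<bar>\<bar> \<le> C" by blast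
  have "norm (b z) \<le> C" if "z \<in> {0..T} \<times> closure G" for z
    using norm_le_l1_cart[of "b z"] C(2)[of "fst z" "snd z"] that by (auto simp: mem_Times_iff)
  thus ?thesis using C(1) by blast
qed

lemma matrix_data_bounded:
  fixes \<sigma> :: "real \<times> (real ^ 'n) \<Rightarrow> real ^ 'n ^ 'n"
  assumes "\<And>i j. parabolic_holder \<epsilon> T G (\<lambda>p. \<sigma> p $ i $ j)" "bounded G" "T > 0"
  shows "\<exists>C>0. \<forall>z\<in>{0..T} \<times> closure G. \<forall>\<xi>\<in>sign_cube. norm (\<sigma> z *v \<xi>) \<le> C"
proof -
  have "continuous_on (closure (cyl T G)) (\<lambda>z. \<Sum>i\<in>UNIV. \<Sum>j\<in>UNIV. \<bar>\<sigma> z $ i $ j\<bar>)"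
    by (intro continuous_on_sum continuous_on_rabs parabolic_holder_continuous[OF assms(1)])
  from cyl_continuous_bounded[OF this assms(2,3)] obtain C where C: "C > 0"
    "\<And>t y. t \<in> {0..T} \<Longrightarrow> y \<in> closure G \<Longrightarrow> \<bar>\<Sum>i\<in>UNIV. \<Sum>j\<in>UNIV. \<bar>\<sigma> (t, y) $ i $ j\<bar>\<bar> \<le> C" by blast
  have "norm (\<sigma> z *v \<xi>) \<le> C" if z: "z \<in> {0..T} \<times> closure G" and \<xi>: "\<xi> \<in> sign_cube" for z \<xi>
  proof -
    have one: "\<bar>\<xi> $ j\<bar> = 1" for j
    proof -
      have "\<xi> $ j = 1 \<or> \<xi> $ j = - 1" using \<xi> by (simp add: sign_cube_def)
      thus ?thesis by auto
    qed
    have "norm (\<sigma> z *v \<xi>) \<le> (\<Sum>i\<in>UNIV. \<bar>(\<sigma> z *v \<xi>) $ i\<bar>)" by (rule norm_le_l1_cart)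
    also have "\<dots> \<le> (\<Sum>i\<in>UNIV. \<Sum>j\<in>UNIV. \<bar>\<sigma> z $ i $ j\<bar>)"
    proof (rule sum_mono)
      fix i
      have "\<bar>(\<sigma> z *v \<xi>) $ i\<bar> \<le> (\<Sum>j\<in>UNIV. \<bar>\<sigma> z $ i $ j * \<xi> $ j\<bar>)"
        by (simp add: matrix_vector_mult_def)
      thus "\<bar>(\<sigma> z *v \<xi>) $ i\<bar> \<le> (\<Sum>j\<in>UNIV. \<bar>\<sigma> z $ i $ j\<bar>)" by (simp add: abs_mult one)
    qed
    also have "\<dots> \<le> C" using C(2)[of "fst z" "snd z"] z by (auto simp: mem_Times_iff)
    finally show ?thesis .
  qed
  thus ?thesis using C(1) by blast
qed

lemma scalar_data_bounded:
  fixes c :: "real \<times> 'a::euclidean_space \<Rightarrow> real"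
  assumes "parabolic_holder \<epsilon> T G c" "bounded G" "T > 0"
  shows "\<exists>C>0. \<forall>z\<in>{0..T} \<times> closure G. \<bar>c z\<bar> \<le> C"
  using cyl_continuous_bounded[OF parabolic_holder_continuous[OF assms(1)] assms(2,3)] by auto

theorem theorem4p1:
  fixes G :: "(real ^ 'n) set" and T \<epsilon> t0 :: real and x :: "real ^ 'n"
    and \<nu> :: "real ^ 'n \<Rightarrow> real ^ 'n"
    and b :: "real \<times> (real ^ 'n) \<Rightarrow> real ^ 'n"
    and \<sigma> :: "real \<times> (real ^ 'n) \<Rightarrow> real ^ 'n ^ 'n"
    and c g \<gamma> \<psi> u :: "real \<times> (real ^ 'n) \<Rightarrow> real"
    and \<mu> \<phi> :: "real ^ 'n \<Rightarrow> real"
    and M :: "'w measure" and \<xi> :: "nat \<Rightarrow> 'w \<Rightarrow> real ^ 'n"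
  assumes "0 < \<epsilon>" and "\<epsilon> < 1" and "T > 0"
    and "open G" and "connected G" and "bounded G"
    and "holder_boundary 4 \<epsilon> G"
    and "\<And>z. z \<in> frontier G \<Longrightarrow> inward_unit_normal G z (\<nu> z)"
    and "\<And>i. parabolic_holder \<epsilon> T G (\<lambda>p. b p $ i)"
    and "\<And>i j. parabolic_holder \<epsilon> T G (\<lambda>p. \<sigma> p $ i $ j)"
    and "parabolic_holder \<epsilon> T G c"
    and "parabolic_holder \<epsilon> T G g"
    and "parabolic_holder_on_boundary \<epsilon> T G \<gamma>"
    and "parabolic_holder_on_boundary \<epsilon> T G \<psi>"
    and "holder_on_boundary \<epsilon> G \<mu>"
    and "\<And>z. z \<in> frontier G \<Longrightarrow> \<mu> z > 0"
    and "holder_space 4 \<epsilon> G \<phi>"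
    and "bvp_solution T G \<nu> b \<sigma> c g \<gamma> \<psi> \<mu> \<phi> u"
    and "\<And>v. bvp_solution T G \<nu> b \<sigma> c g \<gamma> \<psi> \<mu> \<phi> v \<Longrightarrow> \<forall>p \<in> {0..T} \<times> closure G. v p = u p"
    and "holder_space 4 \<epsilon> (cyl T G) u"
    and "0 \<le> t0" and "t0 < T" and "x \<in> G"
    and "prob_space M"
    and "prob_space.indep_vars M (\<lambda>_. borel) (\<lambda>(k, i) \<omega>. \<xi> k \<omega> $ i) ({1..} \<times> UNIV)"
    and "\<And>k i \<omega>. 1 \<le> k \<Longrightarrow> \<omega> \<in> space M \<Longrightarrow> \<xi> k \<omega> $ i = 1 \<or> \<xi> k \<omega> $ i = - 1"
    and "\<And>k i. 1 \<le> k \<Longrightarrow> measure M {\<omega> \<in> space M. \<xi> k \<omega> $ i = 1} = 1/2"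
    and "\<And>k i. 1 \<le> k \<Longrightarrow> measure M {\<omega> \<in> space M. \<xi> k \<omega> $ i = - 1} = 1/2"
  shows "\<exists>C>0. \<exists>h0>0. \<forall>h. 0 < h \<and> h < h0 \<longrightarrow>
    (let V = (\<lambda>\<omega>. payoff \<phi>
               (final_state T (sticky_step T G \<nu> b \<sigma> c g \<gamma> \<psi> \<mu> \<phi> h) (t0, x, 1, 0) (\<lambda>k. \<xi> k \<omega>)))
     in integrable M V \<and> \<bar>(\<integral>\<omega>. V \<omega> \<partial>M) - u (t0, x)\<bar> \<le> C * h)"
proof -
  note G = \<open>open G\<close> \<open>bounded G\<close> \<open>holder_boundary 4 \<epsilon> G\<close>
  note T = \<open>T > 0\<close>
  note \<nu> = assms(8)
  define \<Omega> where "\<Omega> = cyl T G"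
  define J where "J = (\<lambda>z es. cl_partial \<Omega> es u z)"
  have cl: "closure \<Omega> = {0..T} \<times> closure G" unfolding \<Omega>_def by (rule closure_cyl[OF T])
  have o: "open \<Omega>" unfolding \<Omega>_def cyl_def using G by (intro open_Times) auto
  have bd: "bounded \<Omega>" unfolding \<Omega>_def cyl_def using G by (intro bounded_Times) auto
  have smooth: "smooth_closure (\<lambda>_. 1) 4 \<Omega> u"
    using \<open>holder_space 4 \<epsilon> (cyl T G) u\<close> unfolding holder_space_def \<Omega>_def by blast
  hence smooth4: "smooth_closure (\<lambda>_. 1) (Suc 3) \<Omega> u" by simp
  note bvp = \<open>bvp_solution T G \<nu> b \<sigma> c g \<gamma> \<psi> \<mu> \<phi> u\<close>[unfolded bvp_solution_def, folded \<Omega>_def]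
  have fin: "u (T, y) = \<phi> y" if "y \<in> closure G" for y using bvp that by blast
  have Ju: "J z [] = u z" if "z \<in> closure \<Omega>" for z
    unfolding J_def using smooth that by (intro cl_partial_Nil) (auto simp: smooth_closure_def)
  have sw: "swap_invariant 4 (J z)" if "z \<in> closure \<Omega>" for z
    unfolding J_def using cl_partial_swap[OF o smooth that] .
  have sw3: "swap_invariant 3 (J z)" if "z \<in> closure \<Omega>" for z
    using sw[OF that] unfolding swap_invariant_def by auto
  obtain MJ where MJ: "MJ \<ge> 0" "\<And>es z. set es \<subseteq> Basis \<Longrightarrow> length es \<le> 4 \<Longrightarrow> z \<in> closure \<Omega> \<Longrightarrow> \<bar>J z es\<bar> \<le> MJ"
    using smooth_closure_bounded[OF smooth bd] unfolding J_def by blast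
  obtain \<delta>1 Lc where seg: "\<delta>1 > 0" "Lc > 0" "\<And>p q. p \<in> G \<Longrightarrow> q \<in> G \<Longrightarrow> dist p q < \<delta>1 \<Longrightarrow> three_segment G Lc p q"
    using three_segment_domain[OF G] by blast
  have path: "three_segment \<Omega> Lc p q" if "p \<in> \<Omega>" "q \<in> \<Omega>" "dist p q < \<delta>1" for p q
    unfolding \<Omega>_def
  proof (rule three_segment_cyl)
    show "three_segment G Lc (snd p) (snd q)"
      using that dist_snd_le[of p q] by (intro seg) (auto simp: \<Omega>_def cyl_def)
  qed (use that seg in \<open>auto simp: \<Omega>_def\<close>)
  have "\<exists>K\<ge>0. \<forall>p\<in>closure \<Omega>. \<forall>q\<in>closure \<Omega>. \<forall>es. dist p q < \<delta>1 \<and> set es \<subseteq> Basis \<and> length es \<le> 3 \<longrightarrow>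
      \<bar>cl_partial \<Omega> es u q - taylor (3 - length es) (\<lambda>fs. cl_partial \<Omega> fs u p) es (q - p)\<bar>
        \<le> K * norm (q - p) ^ (Suc 3 - length es)"
    by (rule taylor_estimate_closure[OF o bd smooth4 less_imp_le[OF seg(2)]]) (rule path)
  then obtain K1 where K1a: "K1 \<ge> 0"
    "\<forall>p\<in>closure \<Omega>. \<forall>q\<in>closure \<Omega>. \<forall>es. dist p q < \<delta>1 \<and> set es \<subseteq> Basis \<and> length es \<le> 3 \<longrightarrow>
      \<bar>cl_partial \<Omega> es u q - taylor (3 - length es) (\<lambda>fs. cl_partial \<Omega> fs u p) es (q - p)\<bar>
        \<le> K1 * norm (q - p) ^ (Suc 3 - length es)"
    by (elim exE conjE) (rule that)
  have K1: "\<bar>J q es - taylor (3 - length es) (J p) es (q - p)\<bar> \<le> K1 * norm (q - p) ^ (Suc 3 - length es)"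
    if "p \<in> closure \<Omega>" "q \<in> closure \<Omega>" "dist p q < \<delta>1" "set es \<subseteq> Basis" "length es \<le> 3" for p q es
    unfolding J_def using K1a(2)[rule_format, OF that(1,2), of es] that(3-5) by blast
  \<comment> \<open>\<open>G\<close> contains \<open>x\<close> and, being bounded, is not the whole
    space.\<close>
  have "frontier G \<noteq> {}"
    using \<open>x \<in> G\<close> G by (intro frontier_not_empty) auto
  from boundary_projection[OF G this \<nu>] obtain \<delta>2 where \<delta>2: "\<delta>2 > 0"
    "\<And>x. x \<notin> closure G \<Longrightarrow> infdist x (frontier G) < \<delta>2 \<Longrightarrow>
     infdist x (frontier G) > 0 \<and> boundary_proj G \<nu> x \<in> frontier G \<and>
     boundary_proj G \<nu> x = x + infdist x (frontier G) *\<^sub>R \<nu> (boundary_proj G \<nu> x) \<and>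
     boundary_proj G \<nu> x + infdist x (frontier G) *\<^sub>R \<nu> (boundary_proj G \<nu> x) \<in> G" by blast
  obtain kb where kb: "kb > 0" "\<And>z. z \<in> {0..T} \<times> closure G \<Longrightarrow> norm (b z) \<le> kb"
    using vector_data_bounded[OF assms(9) G(2) T] by blast
  obtain ks where ks: "ks > 0" "\<And>z \<xi>. z \<in> {0..T} \<times> closure G \<Longrightarrow> \<xi> \<in> sign_cube \<Longrightarrow> norm (\<sigma> z *v \<xi>) \<le> ks"
    using matrix_data_bounded[OF assms(10) G(2) T] by blast
  obtain kc where kc: "kc > 0" "\<And>z. z \<in> {0..T} \<times> closure G \<Longrightarrow> \<bar>c z\<bar> \<le> kc"
    using scalar_data_bounded[OF assms(11) G(2) T] by blast
  obtain kg where kg: "kg > 0" "\<And>z. z \<in> {0..T} \<times> closure G \<Longrightarrow> \<bar>g z\<bar> \<le> kg"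
    using scalar_data_bounded[OF assms(12) G(2) T] by blast
  obtain ky where ky: "ky > 0" "\<And>t z. t \<in> {0..T} \<Longrightarrow> z \<in> frontier G \<Longrightarrow> \<bar>\<gamma> (t, z)\<bar> \<le> ky"
    using lateral_data_bounded[OF G T assms(13)] by blast
  obtain kp where kp: "kp > 0" "\<And>t z. t \<in> {0..T} \<Longrightarrow> z \<in> frontier G \<Longrightarrow> \<bar>\<psi> (t, z)\<bar> \<le> kp"
    using lateral_data_bounded[OF G T assms(14)] by blast
  obtain km where km: "km > 0" "\<And>z. z \<in> frontier G \<Longrightarrow> \<mu> z \<le> km \<and> 1 \<le> km * \<mu> z"
    using boundary_data_bounded[OF G assms(15,16)] by blast
  define N where "N = real DIM(real \<times> (real ^ 'n))"
  have N1: "N \<ge> 1" by (simp add: N_def)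
  \<comment> \<open>The sum dominates each bound. The powers of the dimension come from the sums
    over basis vectors: three for the trilinear form, one for the remainder of the first
    derivative.\<close>
  define K where "K = 1 + N ^ 3 * MJ + N * K1 + K1 + MJ + kb + ks + kc + kg + ky + kp + km"
  have pos: "0 \<le> N ^ 3 * MJ" "0 \<le> N * K1" using N1 MJ(1) K1a(1) by auto
  have K: "1 \<le> K" "N ^ 3 * MJ \<le> K" "N * K1 \<le> K" "K1 \<le> K" "MJ \<le> K" "kb \<le> K" "ks \<le> K" "kc \<le> K" "kg \<le> K"
    "ky \<le> K" "kp \<le> K" "km \<le> K"
    unfolding K_def using pos MJ(1) K1a(1) kb(1) ks(1) kc(1) kg(1) ky(1) kp(1) km(1) by linarith+
  define \<delta> where "\<delta> = min \<delta>1 \<delta>2"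
  have \<delta>: "\<delta> > 0" "\<delta> \<le> \<delta>1" "\<delta> \<le> \<delta>2" using seg \<delta>2 by (auto simp: \<delta>_def)
  have finc: "finite (sign_cube :: (real ^ 'n) set)" by (rule finite_sign_cube)
  have gen: "generator T G b \<sigma> v z =
      1/2 * (\<Sum>i\<in>UNIV. \<Sum>j\<in>UNIV. (\<sigma> z ** transpose (\<sigma> z)) $ i $ j * cl_partial \<Omega> [space_dir i, space_dir j] v z)
      + (\<Sum>i\<in>UNIV. b z $ i * cl_partial \<Omega> [space_dir i] v z)" for v z
    unfolding generator_def \<Omega>_def ..
  have pde: "J z [time_dir] + generator T G b \<sigma> u z + c z * u z + g z = 0" if "z \<in> {0..T} \<times> closure G" for z
    using bvp that unfolding J_def by blast
  have bc: "- \<mu> z * generator T G b \<sigma> u (t, z) + (\<Sum>i\<in>UNIV. \<nu> z $ i * J (t, z) [space_dir i]) + \<gamma> (t, z) * u (t, z) = \<psi> (t, z)"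
    if "t \<in> {0..T}" "z \<in> frontier G" for t z
    using bvp that unfolding J_def inner_vec_def by simp
  \<comment> \<open>The scheme uses the generator of \<open>\<phi>\<close>, whereas the equation and
    the boundary condition speak of that of \<open>u\<close>.\<close>
  have genT: "generator T G b \<sigma> (\<lambda>(_, y). \<phi> y) (T, z) = generator T G b \<sigma> u (T, z)" if "z \<in> frontier G" for z
  proof -
    have z: "z \<in> closure G" using that by (simp add: frontier_def)
    have "cl_partial \<Omega> es (\<lambda>(_, y). \<phi> y) (T, z) = cl_partial \<Omega> es u (T, z)"
      if "set es \<subseteq> Pair 0 ` Basis" "length es \<le> 3" for es
      unfolding \<Omega>_def
      using final_time_derivatives[OF T G(1) smooth[unfolded \<Omega>_def] K1[unfolded J_def \<Omega>_def] seg(1) fin that z] .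
    thus ?thesis unfolding gen by (simp add: axis_in_Basis_iff)
  qed
  have sticky: "sticky T G \<nu> b \<sigma> c g \<gamma> \<psi> u \<mu> \<phi> (\<lambda>z. lin_form (J z)) (\<lambda>z. bil_form (J z)) (\<lambda>z. tri_form (J z)) K \<delta>"
  proof (rule sticky.intro, goal_cases)
    case 1 show ?case by (rule T)
  next
    case 2 show ?case by (rule K)
  next
    case 3 show ?case by (rule \<delta>)
  next
    case 4 show ?case by (rule linear_lin_form)
  next
    case 5 show ?case by (rule linear_bil_form)
  next
    case 6 show ?case by (rule linear_tri_form)
  next
    case (7 z h k) thus ?case using sw[of z] by (intro bil_form_sym[of 4]) (auto simp: cl)
  next
    case (8 z h k l) thus ?case using sw3[of z] by (intro tri_form_sym) (auto simp: cl)
  next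
    case (9 z h k l) thus ?case using sw3[of z] by (intro tri_form_sym) (auto simp: cl)
  next
    case (10 z) thus ?case using MJ(2)[of "[]" z] K(5) Ju[of z] by (simp add: cl)
  next
    case (11 z k)
    thus ?case using MJ(2) K(2) by (intro forms_bounded[of _ MJ]) (auto simp: cl N_def)
  next
    case (12 z h k)
    thus ?case using MJ(2) K(2) by (intro forms_bounded[of _ MJ]) (auto simp: cl N_def)
  next
    case (13 z h k l)
    thus ?case using MJ(2) K(2) by (intro forms_bounded[of _ MJ]) (auto simp: cl N_def)
  next
    case (14 z y)
    have "\<bar>u y - (u z + lin_form (J z) (y - z) + bil_form (J z) (y - z) (y - z) / 2 + tri_form (J z) (y - z) (y - z) (y - z) / 6)\<bar>
        \<le> K1 * norm (y - z) ^ 4"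
      using K1[of z y "[]"] 14 \<delta> by (simp add: cl taylor_forms(1) Ju dist_norm norm_minus_commute)
    also have "\<dots> \<le> K * norm (y - z) ^ 4" using K by (intro mult_right_mono) auto
    finally show ?case .
  next
    case (15 z y k)
    have "lin_form (J y) k - (lin_form (J z) k + bil_form (J z) k (y - z) + tri_form (J z) k (y - z) (y - z) / 2)
        = (\<Sum>e\<in>Basis. (k \<bullet> e) * (J y [e] - taylor 2 (J z) [e] (y - z)))"
      unfolding taylor_forms(2)[symmetric] by (simp add: lin_form_def right_diff_distrib sum_subtractf)
    moreover have "\<bar>J y [e] - taylor 2 (J z) [e] (y - z)\<bar> \<le> K1 * norm (y - z) ^ 3" if "e \<in> Basis" for e
      using K1[of z y "[e]"] 15 \<delta> that by (simp add: cl dist_norm norm_minus_commute)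
    ultimately have "\<bar>lin_form (J y) k - (lin_form (J z) k + bil_form (J z) k (y - z) + tri_form (J z) k (y - z) (y - z) / 2)\<bar>
        \<le> N * (K1 * norm (y - z) ^ 3) * norm k"
      unfolding N_def by (simp only: inner_sum_bound)
    also have "\<dots> = (N * K1) * (norm k * norm (y - z) ^ 3)" by (simp add: mult_ac)
    also have "\<dots> \<le> K * (norm k * norm (y - z) ^ 3)" using K(3) by (intro mult_right_mono) auto
    finally show ?case by (simp only: mult.assoc)
  next
    case (16 z) thus ?case using kb(2) K(6) by (meson order_trans)
  next
    case (17 z \<xi>) thus ?case using ks(2) K(7) by (meson order_trans)
  next
    case (18 z) thus ?case using kc(2) K(8) by (meson order_trans)
  next
    case (19 z) thus ?case using kg(2) K(9) by (meson order_trans)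
  next
    case (20 t z) thus ?case using ky(2) K(10) by (meson order_trans)
  next
    case (21 t z) thus ?case using kp(2) K(11) by (meson order_trans)
  next
    case (22 z) thus ?case using km(2) K(12) by (meson order_trans)
  next
    case (23 z)
    have "km * \<mu> z \<le> K * \<mu> z" using K(12) assms(16)[OF 23] by (intro mult_right_mono) auto
    thus ?case using km(2)[OF 23] by linarith
  next
    case (24 z) thus ?case using \<nu> unfolding inward_unit_normal_def by blast
  next
    case (25 x) thus ?case using \<delta>2(2)[of x] \<delta> by simp
  next
    case (26 z)
    define n where "n = real (card (sign_cube :: (real ^ 'n) set))"
    have zc: "z \<in> closure \<Omega>" using 26 cl by simp
    \<comment> \<open>\<open>bil_form\<close> lists the two directions in the reverse order of
      \<open>generator\<close>.\<close>
    have Jsym: "J z [space_dir j, space_dir i] = J z [space_dir i, space_dir j]" for i j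
      using sw[OF zc, unfolded swap_invariant_def, rule_format, of "[]" "space_dir j" "space_dir i" "[]"]
      by (simp add: Basis_prod_def axis_in_Basis_iff image_iff)
    have "(\<Sum>\<xi>\<in>sign_cube. bil_form (J z) (0, \<sigma> z *v \<xi>) (0, \<sigma> z *v \<xi>))
      = (\<Sum>\<xi>\<in>sign_cube. \<Sum>i\<in>UNIV. \<Sum>j\<in>UNIV. (\<sigma> z *v \<xi>) $ i * (\<sigma> z *v \<xi>) $ j * J z [space_dir i, space_dir j])"
      unfolding bil_form_space Jsym by (simp add: sum_distrib_left mult.assoc)
    also have "\<dots> = (\<Sum>i\<in>UNIV. \<Sum>\<xi>\<in>sign_cube. \<Sum>j\<in>UNIV. (\<sigma> z *v \<xi>) $ i * (\<sigma> z *v \<xi>) $ j * J z [space_dir i, space_dir j])"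
      by (rule sum.swap)
    also have "\<dots> = (\<Sum>i\<in>UNIV. \<Sum>j\<in>UNIV. \<Sum>\<xi>\<in>sign_cube. (\<sigma> z *v \<xi>) $ i * (\<sigma> z *v \<xi>) $ j * J z [space_dir i, space_dir j])"
      by (intro sum.cong refl sum.swap)
    also have "\<dots> = n * (\<Sum>i\<in>UNIV. \<Sum>j\<in>UNIV. (\<sigma> z ** transpose (\<sigma> z)) $ i $ j * J z [space_dir i, space_dir j])"
      unfolding sum_distrib_right[symmetric] sign_cube_second_moment[OF finc] n_def
      by (simp add: sum_distrib_left mult.assoc)
    \<comment> \<open>The second moments turn the sum into \<open>n\<close> times the second-order
      part of the generator, here written as the generator without its drift.\<close>
    finally have B: "(\<Sum>\<xi>\<in>sign_cube. bil_form (J z) (0, \<sigma> z *v \<xi>) (0, \<sigma> z *v \<xi>)) / 2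
      = n * (generator T G b \<sigma> u z - (\<Sum>i\<in>UNIV. b z $ i * J z [space_dir i]))"
      unfolding gen J_def by simp
    have L: "lin_form (J z) (1, b z) = J z [time_dir] + (\<Sum>i\<in>UNIV. b z $ i * J z [space_dir i])"
      unfolding lin_form_space_time by simp
    have "n * (lin_form (J z) (1, b z) + c z * u z + g z)
      + n * (generator T G b \<sigma> u z - (\<Sum>i\<in>UNIV. b z $ i * J z [space_dir i]))
      = n * (J z [time_dir] + generator T G b \<sigma> u z + c z * u z + g z)"
      unfolding L by (simp add: algebra_simps)
    thus ?case unfolding B n_def[symmetric] using pde[OF 26] by simp
  next
    case (27 t z)
    have "(t, z) \<in> {0..T} \<times> closure G" using 27 by (auto simp: frontier_def)
    from pde[OF this] have gu: "generator T G b \<sigma> u (t, z) = - J (t, z) [time_dir] - c (t, z) * u (t, z) - g (t, z)" by linarith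
    show ?case unfolding lin_form_space_time using bc[OF 27] unfolding gu by (simp add: algebra_simps)
  next
    case (28 z)
    have "(T, z) \<in> {0..T} \<times> closure G" using 28 T by (auto simp: frontier_def)
    from pde[OF this] show ?case unfolding lin_form_space_time genT[OF 28] by simp
  next
    case (29 z)
    show ?case unfolding lin_form_space_time genT[OF 29] using bc[of T z] 29 T by simp
  qed
  define R where "R = sticky.error_rate T K * (T + 1)"
  have R: "R > 0" using sticky.error_rate_pos[OF sticky] T by (simp add: R_def)
  \<comment> \<open>For \<open>h < h0\<close> one has
    \<open>64 * K\<^sup>2 * sqrt h < min 1 \<delta>\<close>, which implies both smallness conditions
    on the length scale of a step.\<close>
  define h0 where "h0 = (min 1 \<delta> / (64 * K\<^sup>2))\<^sup>2"
  have K2: "0 < K\<^sup>2" using K(1) by simp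
  have h0: "h0 > 0" using \<delta> K2 by (simp add: h0_def)
  show ?thesis
  proof (rule exI[of _ R], rule conjI[OF R], rule exI[of _ h0], rule conjI[OF h0], intro allI impI)
    fix h assume h: "0 < h \<and> h < h0"
    have "sqrt h < sqrt h0" using h by simp
    also have "sqrt h0 = min 1 \<delta> / (64 * K\<^sup>2)" using \<delta> K2 by (simp add: h0_def)
    finally have "64 * K\<^sup>2 * sqrt h < min 1 \<delta>" using K2 by (simp add: pos_less_divide_eq mult.commute)
    moreover have "0 \<le> K\<^sup>2 * sqrt h" using K2 h by simp
    ultimately have small: "16 * K\<^sup>2 * sqrt h \<le> 1" "2 * (16 * K\<^sup>2 * sqrt h) < \<delta>" by linarith+
    have "x \<in> closure G" using \<open>x \<in> G\<close> closure_subset by blast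
    from sticky.sticky_convergence[OF sticky _ small \<open>0 \<le> t0\<close> \<open>t0 < T\<close> this fin assms(24-28)] h
    show "let V = (\<lambda>\<omega>. payoff \<phi>
               (final_state T (sticky_step T G \<nu> b \<sigma> c g \<gamma> \<psi> \<mu> \<phi> h) (t0, x, 1, 0) (\<lambda>k. \<xi> k \<omega>)))
     in integrable M V \<and> \<bar>(\<integral>\<omega>. V \<omega> \<partial>M) - u (t0, x)\<bar> \<le> R * h"
      unfolding Let_def R_def by blast
  qed
qed

end
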